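(* $f(n,4,3) = \frac{3}{25}\binom{n}{4} + O(n^3)$, and the minimum is achieved by a blow-up of $C_5$ whose five parts have roughly equal sizes (each part has $\frac{n}{5}+o(n)$ vertices). Moreover, the extremal structure is unique for sufficiently large $n$: there is $n_0$ such that for every $n\ge n_0$, up to isomorphism there is exactly one $n$-vertex graph $G$ with $\alpha(G)\le 2$ and $t_4(G)=f(n,4,3)$, and it is a blow-up of $C_5$.
   Context: For a graph $G$, $\alpha(G)$ denotes its independence number and $t_k(G)$ the number of $k$-vertex cliques ($K_k$) in $G$. For integers $k,l\ge 2$ and $n$, $f(n,k,l)$ is the minimum of $t_k(G)$ over all graphs $G$ on $n$ vertices with $\alpha(G)<l$ (equivalently, with no independent set of size $l$). A blow-up of the $5$-cycle $C_5$ is a graph whose vertex set is partitioned into five sets $V_1,\dots,V_5$ (indices taken modulo $5$) such that $V_i\cup V_{i+1}$ is a clique for every $i$ and there are no edges between $V_i$ and $V_{i+2}$ for every $i$.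
   Formalization: That the minimum is achieved by a blow-up of C5 with parts of size n/5+o(n) is stated for all sufficiently large n; for small n it can fail (n=8: f(8,4,3)=0 since R(4,3)=9, but every blow-up of C5 on 8 vertices contains a K4). *)

theory Defs
  imports
    "HOL-Library.Ramsey"
    "HOL-Library.Disjoint_Sets"
    "HOL-Library.Landau_Symbols"
begin

definition fin_graph :: "'a set \<Rightarrow> 'a set set \<Rightarrow> bool" where
  "fin_graph V E \<longleftrightarrow> finite V \<and> E \<subseteq> [V]\<^bsup>2\<^esup>"

definition indep_number :: "'a set \<Rightarrow> 'a set set \<Rightarrow> nat" where
  "indep_number V E = Max {card S | S. S \<subseteq> V \<and> indep S E}"

definition num_cliques :: "nat \<Rightarrow> 'a set \<Rightarrow> 'a set set \<Rightarrow> nat" where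
  "num_cliques k V E = card {S \<in> [V]\<^bsup>k\<^esup>. clique S E}"

(* Vertices are natural numbers, which covers every finite graph up to isomorphism.
   For l >= 2 the set is nonempty (it contains the value of the complete graph),
   so the infimum is an attained minimum. *)
definition min_cliques :: "nat \<Rightarrow> nat \<Rightarrow> nat \<Rightarrow> nat" where
  "min_cliques n k l =
     Inf {num_cliques k V E | (V :: nat set) E.
            fin_graph V E \<and> card V = n \<and> indep_number V E < l}"

(* The parts are P 0, ..., P 4; empty parts are not excluded. *)
definition C5_blowup_parts :: "(nat \<Rightarrow> 'a set) \<Rightarrow> 'a set \<Rightarrow> 'a set set \<Rightarrow> bool" where
  "C5_blowup_parts P V E \<longleftrightarrow>
     (\<Union>i<5. P i) = V \<and> disjoint_family_on P {..<5} \<and>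
     (\<forall>i<5. clique (P i \<union> P ((i + 1) mod 5)) E) \<and>
     (\<forall>i<5. \<forall>u\<in>P i. \<forall>v\<in>P ((i + 2) mod 5). {u, v} \<notin> E)"

definition C5_blowup :: "'a set \<Rightarrow> 'a set set \<Rightarrow> bool" where
  "C5_blowup V E \<longleftrightarrow> (\<exists>P. C5_blowup_parts P V E)"

definition graph_iso :: "'a set \<Rightarrow> 'a set set \<Rightarrow> 'b set \<Rightarrow> 'b set set \<Rightarrow> bool" where
  "graph_iso V E V' E' \<longleftrightarrow>
     (\<exists>\<phi>. bij_betw \<phi> V V' \<and> (\<forall>u\<in>V. \<forall>v\<in>V. {u, v} \<in> E \<longleftrightarrow> {\<phi> u, \<phi> v} \<in> E'))"

end

theory Submission
  imports Defs "HOL-Combinatorics.Multiset_Permutations"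
begin

text \<open>
  We pass to the complement: minimise the number of independent 4-sets in a triangle-free graph.
  Everything is counted over tuples with repetition, so that a flag-algebra argument on five
  vertices gives exact inequalities without error terms. One certificate shows that the density of
  independent 4-tuples is at least 3/25 plus positive multiples of the densities of two disjoint
  edges, of a path on four vertices with an isolated vertex, and of the variance of the degrees
  around 2n/5; a second one shows that an almost optimal graph contains many pentagons.

  Hence an almost optimal graph has a pentagon to which almost all vertices attach as in a blow-up,
  because every other attachment, and every missing edge between two classes, produces one of the
  two rare configurations. In a minimal graph, replacing a vertex by a clone of another one shows
  that all vertices lie in about the same number of independent 4-sets; this forces every vertex
  into one of the five classes, so that the graph is a subgraph of a blow-up of the pentagon, and by
  minimality it is the whole blow-up.

  Finally, if the parts have sizes q + x(i) with n = 5 q + r and |r| at most 2, the number of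
  independent 4-sets is, up to lower order terms, a function of n plus q^2/4 times the positive
  definite form 7 x(i)^2 + 8 x(i) x(i+1) summed over i. Its integer minimisers with coordinate sum r
  are unique up to rotation: 0 for r = 0, (1,-1,1,0,0) for r = 1 and (1,0,1,0,0) for r = 2.
\<close>

section \<open>Flags and the certificate\<close>

text \<open>The value 3/25 is 5 (2/5)^4 - 5 (1/5)^4: in the complement the union of two non-adjacent
  classes is independent, there are five such unions, and every class lies in two of them.
  Repetitions in tuples are harmless because any map of five labels into the graph pulls adjacency
  back to a triangle-free graph on the labels, where labels with equal image are non-adjacent. An
  inequality checked on all labelled five-vertex graphs may thus be summed over all n^5 maps; an
  error of order n^3 appears only on returning to sets. The certificates control averages only. A
  single vertex lies in O(n^3) independent 4-sets, no more than the error term, so they say nothing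
  about an individual vertex; this gap is what cloning closes. Even then the class sizes are known
  only up to a small multiple of n, so the last comparison has to tolerate deviations linear in q.
  Positive definiteness of the quadratic form absorbs the higher terms, and integrality of the
  deviations then gives the exact sizes.\<close>

datatype ix = I0 | I1 | I2 | I3 | I4

definition ind4 :: "('a \<Rightarrow> 'a \<Rightarrow> bool) \<Rightarrow> 'a \<Rightarrow> 'a \<Rightarrow> 'a \<Rightarrow> 'a \<Rightarrow> bool" where
  "ind4 A x y z w \<longleftrightarrow> \<not> A x y \<and> \<not> A x z \<and> \<not> A x w \<and> \<not> A y z \<and> \<not> A y w \<and> \<not> A z w"

text \<open>
  In the sums over \<open>y\<close> and \<open>z\<close> these flags become, for a graph with \<open>n\<close> vertices and degrees \<open>d\<close>:
  \<open>2 n (5 d(x) - 2 n)\<close>; \<open>2 d(x) (5 d(x) - 2 n)\<close>; twice the sum of \<open>5 d(y) - 2 n\<close> over the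
  neighbours \<open>y\<close> of \<open>x\<close>; and \<open>2 (5 d - 2 n)\<close> summed over all vertices. All of them vanish in the
  balanced blow-up of the pentagon, and so do the sums of the two flags below over \<open>w\<close>, for all roots.
\<close>

definition flag_u :: "('a \<Rightarrow> 'a \<Rightarrow> bool) \<Rightarrow> 'a \<Rightarrow> 'a \<Rightarrow> 'a \<Rightarrow> int" where
  "flag_u A x y z = 5 * (of_bool (A x y) + of_bool (A x z)) - 4"
definition flag_q :: "('a \<Rightarrow> 'a \<Rightarrow> bool) \<Rightarrow> 'a \<Rightarrow> 'a \<Rightarrow> 'a \<Rightarrow> int" where
  "flag_q A x y z = 10 * of_bool (A x y \<and> A x z) - 2 * (of_bool (A x y) + of_bool (A x z))"
definition flag_p :: "('a \<Rightarrow> 'a \<Rightarrow> bool) \<Rightarrow> 'a \<Rightarrow> 'a \<Rightarrow> 'a \<Rightarrow> int" where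
  "flag_p A x y z = (5 * of_bool (A y z) - 2) * (of_bool (A x y) + of_bool (A x z))"
definition flag_e :: "('a \<Rightarrow> 'a \<Rightarrow> bool) \<Rightarrow> 'a \<Rightarrow> 'a \<Rightarrow> int" where
  "flag_e A y z = 10 * of_bool (A y z) - 4"

text \<open>The values -2, -3, 4, 3 belong to \<open>w\<close> seeing 0, 1, 2, 3 of the roots. In a
  blow-up independent roots lie in one class, where the five classes of \<open>w\<close> contribute
  three times -2 and twice 3, or split two to one between non-adjacent classes, where they
  contribute -2, -2, -3, 4, 3.\<close>

definition flag_E :: "('a \<Rightarrow> 'a \<Rightarrow> bool) \<Rightarrow> 'a \<Rightarrow> 'a \<Rightarrow> 'a \<Rightarrow> 'a \<Rightarrow> int" where
  "flag_E A x y z w = (if A x y \<or> A x z \<or> A y z then 0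
     else if A x w then (if A y w then (if A z w then 3 else 4) else (if A z w then 4 else - 3))
     else if A y w then (if A z w then 4 else - 3) else (if A z w then - 3 else - 2))"
definition flag_K :: "('a \<Rightarrow> 'a \<Rightarrow> bool) \<Rightarrow> 'a \<Rightarrow> 'a \<Rightarrow> 'a \<Rightarrow> 'a \<Rightarrow> int" where
  "flag_K A x y z w = (if A x y \<and> \<not> A x z \<and> \<not> A y z then of_bool (A x w) - of_bool (A y w) else 0)"

text \<open>Neither this configuration nor \<open>path_pt\<close> occurs in a blow-up of the
  pentagon: any two edges of the pentagon share a vertex or are joined by an edge, and an induced
  path on four vertices meets four classes, which together dominate all five.\<close>

definition two_edges :: "('a \<Rightarrow> 'a \<Rightarrow> bool) \<Rightarrow> 'a \<Rightarrow> 'a \<Rightarrow> 'a \<Rightarrow> 'a \<Rightarrow> bool" where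
  "two_edges A x y z w \<longleftrightarrow> A x y \<and> A z w \<and> \<not> A x z \<and> \<not> A x w \<and> \<not> A y z \<and> \<not> A y w"
definition path_pt :: "('a \<Rightarrow> 'a \<Rightarrow> bool) \<Rightarrow> 'a \<Rightarrow> 'a \<Rightarrow> 'a \<Rightarrow> 'a \<Rightarrow> 'a \<Rightarrow> bool" where
  "path_pt A x y z w t \<longleftrightarrow> A x y \<and> A y z \<and> A z w \<and> \<not> A x z \<and> \<not> A x w \<and> \<not> A y w
     \<and> \<not> A x t \<and> \<not> A y t \<and> \<not> A z t \<and> \<not> A w t"
text \<open>Distinctness and the absence of chords need not be demanded: in a triangle-free graph a
  closed walk of length five is an induced pentagon.\<close>

definition pentagon :: "('a \<Rightarrow> 'a \<Rightarrow> bool) \<Rightarrow> 'a \<Rightarrow> 'a \<Rightarrow> 'a \<Rightarrow> 'a \<Rightarrow> 'a \<Rightarrow> bool" where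
  "pentagon A x y z w t \<longleftrightarrow> A x y \<and> A y z \<and> A z w \<and> A w t \<and> A t x"

text \<open>
  The coefficients of both forms come from rounding the output of a semidefinite programming solver
  inside the affine space of exact solutions. The first makes the certificate tight on all five-vertex
  graphs that occur in a blow-up of the pentagon; the second is perturbed so that only the pentagon
  itself falls below a positive constant.
\<close>

definition bil1 :: "int \<Rightarrow> int \<Rightarrow> int \<Rightarrow> int \<Rightarrow> int \<Rightarrow> int \<Rightarrow> int \<Rightarrow> int \<Rightarrow> int" where
  "bil1 u q p e u' q' p' e' =
     u * (1644 * u' - 1414 * q' - 1606 * p' + 178 * e') +
     q * (- 1414 * u' + 1440 * q' + 1150 * p' - 105 * e') +
     p * (- 1606 * u' + 1150 * q' + 2760 * p' - 625 * e') +
     e * (178 * u' - 105 * q' - 625 * p' + 250 * e')"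
definition bil2 :: "int \<Rightarrow> int \<Rightarrow> int \<Rightarrow> int \<Rightarrow> int \<Rightarrow> int \<Rightarrow> int \<Rightarrow> int \<Rightarrow> int" where
  "bil2 u q p e u' q' p' e' =
     u * (1620 * u' - 1534 * q' - 1756 * p' + 189 * e') +
     q * (- 1534 * u' + 1680 * q' + 1510 * p' - 140 * e') +
     p * (- 1756 * u' + 1510 * q' + 3200 * p' - 700 * e') +
     e * (189 * u' - 140 * q' - 700 * p' + 250 * e')"

definition tri_free :: "('a \<Rightarrow> 'a \<Rightarrow> bool) \<Rightarrow> 'a \<Rightarrow> 'a \<Rightarrow> 'a \<Rightarrow> bool" where
  "tri_free A x y z \<longleftrightarrow> \<not> (A x y \<and> A y z \<and> A x z)"

text \<open>A labelled graph on five vertices is encoded by its ten possible edges, so that a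
  statement about all of them becomes an evaluation over Booleans.\<close>

fun rel :: "bool \<Rightarrow> bool \<Rightarrow> bool \<Rightarrow> bool \<Rightarrow> bool \<Rightarrow> bool \<Rightarrow> bool \<Rightarrow> bool \<Rightarrow> bool \<Rightarrow> bool \<Rightarrow> ix \<Rightarrow> ix \<Rightarrow> bool" where
  "rel b01 b02 b03 b04 b12 b13 b14 b23 b24 b34 I0 I0 = False"
|   "rel b01 b02 b03 b04 b12 b13 b14 b23 b24 b34 I0 I1 = b01"
|   "rel b01 b02 b03 b04 b12 b13 b14 b23 b24 b34 I0 I2 = b02"
|   "rel b01 b02 b03 b04 b12 b13 b14 b23 b24 b34 I0 I3 = b03"
|   "rel b01 b02 b03 b04 b12 b13 b14 b23 b24 b34 I0 I4 = b04"
|   "rel b01 b02 b03 b04 b12 b13 b14 b23 b24 b34 I1 I0 = b01"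
|   "rel b01 b02 b03 b04 b12 b13 b14 b23 b24 b34 I1 I1 = False"
|   "rel b01 b02 b03 b04 b12 b13 b14 b23 b24 b34 I1 I2 = b12"
|   "rel b01 b02 b03 b04 b12 b13 b14 b23 b24 b34 I1 I3 = b13"
|   "rel b01 b02 b03 b04 b12 b13 b14 b23 b24 b34 I1 I4 = b14"
|   "rel b01 b02 b03 b04 b12 b13 b14 b23 b24 b34 I2 I0 = b02"
|   "rel b01 b02 b03 b04 b12 b13 b14 b23 b24 b34 I2 I1 = b12"
|   "rel b01 b02 b03 b04 b12 b13 b14 b23 b24 b34 I2 I2 = False"
|   "rel b01 b02 b03 b04 b12 b13 b14 b23 b24 b34 I2 I3 = b23"
|   "rel b01 b02 b03 b04 b12 b13 b14 b23 b24 b34 I2 I4 = b24"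
|   "rel b01 b02 b03 b04 b12 b13 b14 b23 b24 b34 I3 I0 = b03"
|   "rel b01 b02 b03 b04 b12 b13 b14 b23 b24 b34 I3 I1 = b13"
|   "rel b01 b02 b03 b04 b12 b13 b14 b23 b24 b34 I3 I2 = b23"
|   "rel b01 b02 b03 b04 b12 b13 b14 b23 b24 b34 I3 I3 = False"
|   "rel b01 b02 b03 b04 b12 b13 b14 b23 b24 b34 I3 I4 = b34"
|   "rel b01 b02 b03 b04 b12 b13 b14 b23 b24 b34 I4 I0 = b04"
|   "rel b01 b02 b03 b04 b12 b13 b14 b23 b24 b34 I4 I1 = b14"
|   "rel b01 b02 b03 b04 b12 b13 b14 b23 b24 b34 I4 I2 = b24"
|   "rel b01 b02 b03 b04 b12 b13 b14 b23 b24 b34 I4 I3 = b34"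
|   "rel b01 b02 b03 b04 b12 b13 b14 b23 b24 b34 I4 I4 = False"

text \<open>
  Each summand is symmetrised over one representative per class of orderings of the five vertices
  modulo the symmetries of that summand.
\<close>

definition ind_perms :: "(ix \<times> ix \<times> ix \<times> ix \<times> ix) list" where
  "ind_perms =
    [(I0,I1,I2,I3,I4), (I0,I1,I2,I4,I3), (I0,I1,I3,I4,I2), (I0,I2,I3,I4,I1), (I1,I2,I3,I4,I0)]"

definition flag_perms :: "(ix \<times> ix \<times> ix \<times> ix \<times> ix) list" where
  "flag_perms =
    [(I0,I1,I2,I3,I4), (I0,I1,I3,I2,I4), (I0,I1,I4,I2,I3), (I1,I0,I2,I3,I4), (I1,I0,I3,I2,I4),
     (I1,I0,I4,I2,I3), (I2,I0,I1,I3,I4), (I2,I0,I3,I1,I4), (I2,I0,I4,I1,I3), (I3,I0,I1,I2,I4),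
     (I3,I0,I2,I1,I4), (I3,I0,I4,I1,I2), (I4,I0,I1,I2,I3), (I4,I0,I2,I1,I3), (I4,I0,I3,I1,I2)]"

definition indep_root_perms :: "(ix \<times> ix \<times> ix \<times> ix \<times> ix) list" where
  "indep_root_perms =
    [(I0,I1,I2,I3,I4), (I0,I1,I3,I2,I4), (I0,I1,I4,I2,I3), (I0,I2,I3,I1,I4), (I0,I2,I4,I1,I3),
     (I0,I3,I4,I1,I2), (I1,I2,I3,I0,I4), (I1,I2,I4,I0,I3), (I1,I3,I4,I0,I2), (I2,I3,I4,I0,I1)]"

definition edge_root_perms :: "(ix \<times> ix \<times> ix \<times> ix \<times> ix) list" where
  "edge_root_perms =
    [(I0,I1,I2,I3,I4), (I0,I1,I3,I2,I4), (I0,I1,I4,I2,I3), (I0,I2,I1,I3,I4), (I0,I2,I3,I1,I4),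
     (I0,I2,I4,I1,I3), (I0,I3,I1,I2,I4), (I0,I3,I2,I1,I4), (I0,I3,I4,I1,I2), (I0,I4,I1,I2,I3),
     (I0,I4,I2,I1,I3), (I0,I4,I3,I1,I2), (I1,I2,I0,I3,I4), (I1,I2,I3,I0,I4), (I1,I2,I4,I0,I3),
     (I1,I3,I0,I2,I4), (I1,I3,I2,I0,I4), (I1,I3,I4,I0,I2), (I1,I4,I0,I2,I3), (I1,I4,I2,I0,I3),
     (I1,I4,I3,I0,I2), (I2,I3,I0,I1,I4), (I2,I3,I1,I0,I4), (I2,I3,I4,I0,I1), (I2,I4,I0,I1,I3),
     (I2,I4,I1,I0,I3), (I2,I4,I3,I0,I1), (I3,I4,I0,I1,I2), (I3,I4,I1,I0,I2), (I3,I4,I2,I0,I1)]"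

definition two_edges_perms :: "(ix \<times> ix \<times> ix \<times> ix \<times> ix) list" where
  "two_edges_perms =
    [(I0,I1,I2,I3,I4), (I0,I1,I2,I4,I3), (I0,I1,I3,I4,I2), (I0,I2,I1,I3,I4), (I0,I2,I1,I4,I3),
     (I0,I2,I3,I4,I1), (I0,I3,I1,I2,I4), (I0,I3,I1,I4,I2), (I0,I3,I2,I4,I1), (I0,I4,I1,I2,I3),
     (I0,I4,I1,I3,I2), (I0,I4,I2,I3,I1), (I1,I2,I3,I4,I0), (I1,I3,I2,I4,I0), (I1,I4,I2,I3,I0)]"

definition path_perms :: "(ix \<times> ix \<times> ix \<times> ix \<times> ix) list" where
  "path_perms =
    [(I0,I1,I2,I3,I4), (I0,I1,I2,I4,I3), (I0,I1,I3,I2,I4), (I0,I1,I3,I4,I2), (I0,I1,I4,I2,I3),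
     (I0,I1,I4,I3,I2), (I0,I2,I1,I3,I4), (I0,I2,I1,I4,I3), (I0,I2,I3,I1,I4), (I0,I2,I3,I4,I1),
     (I0,I2,I4,I1,I3), (I0,I2,I4,I3,I1), (I0,I3,I1,I2,I4), (I0,I3,I1,I4,I2), (I0,I3,I2,I1,I4),
     (I0,I3,I2,I4,I1), (I0,I3,I4,I1,I2), (I0,I3,I4,I2,I1), (I0,I4,I1,I2,I3), (I0,I4,I1,I3,I2),
     (I0,I4,I2,I1,I3), (I0,I4,I2,I3,I1), (I0,I4,I3,I1,I2), (I0,I4,I3,I2,I1), (I1,I0,I2,I3,I4),
     (I1,I0,I2,I4,I3), (I1,I0,I3,I2,I4), (I1,I0,I3,I4,I2), (I1,I0,I4,I2,I3), (I1,I0,I4,I3,I2),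
     (I1,I2,I0,I3,I4), (I1,I2,I0,I4,I3), (I1,I2,I3,I4,I0), (I1,I2,I4,I3,I0), (I1,I3,I0,I2,I4),
     (I1,I3,I0,I4,I2), (I1,I3,I2,I4,I0), (I1,I3,I4,I2,I0), (I1,I4,I0,I2,I3), (I1,I4,I0,I3,I2),
     (I1,I4,I2,I3,I0), (I1,I4,I3,I2,I0), (I2,I0,I1,I3,I4), (I2,I0,I1,I4,I3), (I2,I0,I3,I4,I1),
     (I2,I0,I4,I3,I1), (I2,I1,I0,I3,I4), (I2,I1,I0,I4,I3), (I2,I1,I3,I4,I0), (I2,I1,I4,I3,I0),
     (I2,I3,I0,I4,I1), (I2,I3,I1,I4,I0), (I2,I4,I0,I3,I1), (I2,I4,I1,I3,I0), (I3,I0,I1,I4,I2),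
     (I3,I0,I2,I4,I1), (I3,I1,I0,I4,I2), (I3,I1,I2,I4,I0), (I3,I2,I0,I4,I1), (I3,I2,I1,I4,I0)]"

definition pentagon_perms :: "(ix \<times> ix \<times> ix \<times> ix \<times> ix) list" where
  "pentagon_perms =
    [(I0,I1,I2,I3,I4), (I0,I1,I2,I4,I3), (I0,I1,I3,I2,I4), (I0,I1,I3,I4,I2), (I0,I1,I4,I2,I3),
     (I0,I1,I4,I3,I2), (I0,I2,I1,I3,I4), (I0,I2,I1,I4,I3), (I0,I2,I3,I1,I4), (I0,I2,I4,I1,I3),
     (I0,I3,I1,I2,I4), (I0,I3,I2,I1,I4)]"


text \<open>Averaged over all maps of the labels, the first line becomes 750000 times the excess of
  the density of independent 4-tuples over 3/25. The products of flags average to sums of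
  squares.\<close>

definition cert_base :: "(ix \<Rightarrow> ix \<Rightarrow> bool) \<Rightarrow> int" where
  "cert_base R = 150000 * (\<Sum>(a,b,c,d,e)\<leftarrow>ind_perms. of_bool (ind4 R a b c d)) - 90000
    - 3000 * (\<Sum>(a,b,c,d,e)\<leftarrow>indep_root_perms. flag_E R a b c d * flag_E R a b c e)
    - 37500 * (\<Sum>(a,b,c,d,e)\<leftarrow>edge_root_perms. flag_K R a b c d * flag_K R a b c e)"

definition flag_form ::
  "(int \<Rightarrow> int \<Rightarrow> int \<Rightarrow> int \<Rightarrow> int \<Rightarrow> int \<Rightarrow> int \<Rightarrow> int \<Rightarrow> int) \<Rightarrow>
   ('a \<Rightarrow> 'a \<Rightarrow> bool) \<Rightarrow> 'a \<Rightarrow> 'a \<Rightarrow> 'a \<Rightarrow> 'a \<Rightarrow> 'a \<Rightarrow> int" where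
  "flag_form bil A a b c d e =
     bil (flag_u A a b c) (flag_q A a b c) (flag_p A a b c) (flag_e A b c)
         (flag_u A a d e) (flag_q A a d e) (flag_p A a d e) (flag_e A d e)"

definition tri_free5 :: "(ix \<Rightarrow> ix \<Rightarrow> bool) \<Rightarrow> bool" where
  "tri_free5 R \<longleftrightarrow> tri_free R I0 I1 I2 \<and> tri_free R I0 I1 I3 \<and> tri_free R I0 I1 I4 \<and>
     tri_free R I0 I2 I3 \<and> tri_free R I0 I2 I4 \<and> tri_free R I0 I3 I4 \<and> tri_free R I1 I2 I3 \<and>
     tri_free R I1 I2 I4 \<and> tri_free R I1 I3 I4 \<and> tri_free R I2 I3 I4"

definition cert :: "(ix \<Rightarrow> ix \<Rightarrow> bool) \<Rightarrow> bool" where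
  "cert R \<longleftrightarrow> (tri_free5 R \<longrightarrow>
     cert_base R - (\<Sum>(a,b,c,d,e)\<leftarrow>flag_perms. flag_form bil1 R a b c d e) \<ge>
       18000 * (\<Sum>(a,b,c,d,e)\<leftarrow>two_edges_perms. of_bool (two_edges R a b c d)) +
       30000 * (\<Sum>(a,b,c,d,e)\<leftarrow>path_perms. of_bool (path_pt R a b c d e)) \<and>
     cert_base R - (\<Sum>(a,b,c,d,e)\<leftarrow>flag_perms. flag_form bil2 R a b c d e) \<ge>
       480 - 27600 * (\<Sum>(a,b,c,d,e)\<leftarrow>pentagon_perms. of_bool (pentagon R a b c d e)))"

text \<open>The 1024 labelled graphs are evaluated in four batches of 256, according to the edges 01
  and 02.\<close>

lemma cert_False_False:
  "\<forall>c\<in>{False,True}. \<forall>d\<in>{False,True}. \<forall>e\<in>{False,True}. \<forall>f\<in>{False,True}.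
     \<forall>g\<in>{False,True}. \<forall>h\<in>{False,True}. \<forall>i\<in>{False,True}. \<forall>j\<in>{False,True}.
     cert (rel False False c d e f g h i j)"
  by code_simp

lemma cert_False_True:
  "\<forall>c\<in>{False,True}. \<forall>d\<in>{False,True}. \<forall>e\<in>{False,True}. \<forall>f\<in>{False,True}.
     \<forall>g\<in>{False,True}. \<forall>h\<in>{False,True}. \<forall>i\<in>{False,True}. \<forall>j\<in>{False,True}.
     cert (rel False True c d e f g h i j)"
  by code_simp

lemma cert_True_False:
  "\<forall>c\<in>{False,True}. \<forall>d\<in>{False,True}. \<forall>e\<in>{False,True}. \<forall>f\<in>{False,True}.
     \<forall>g\<in>{False,True}. \<forall>h\<in>{False,True}. \<forall>i\<in>{False,True}. \<forall>j\<in>{False,True}.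
     cert (rel True False c d e f g h i j)"
  by code_simp

lemma cert_True_True:
  "\<forall>c\<in>{False,True}. \<forall>d\<in>{False,True}. \<forall>e\<in>{False,True}. \<forall>f\<in>{False,True}.
     \<forall>g\<in>{False,True}. \<forall>h\<in>{False,True}. \<forall>i\<in>{False,True}. \<forall>j\<in>{False,True}.
     cert (rel True True c d e f g h i j)"
  by code_simp

lemma cert_rel: "cert (rel a b c d e f g h i j)"
proof -
  have T: "x \<in> {False, True}" for x by auto
  show ?thesis
    using cert_False_False[rule_format, OF T T T T T T T T]
      cert_False_True[rule_format, OF T T T T T T T T]
      cert_True_False[rule_format, OF T T T T T T T T]
      cert_True_True[rule_format, OF T T T T T T T T]
    by (cases a; cases b) simp_all
qed

section \<open>Counting tuples in triangle-free graphs\<close>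

lemma UNIV_ix: "(UNIV :: ix set) = {I0, I1, I2, I3, I4}"
  using ix.exhaust by auto

lemma distinct_ix_UNIV:
  fixes a :: ix
  assumes "distinct [a, b, c, d, e]"
  shows "UNIV = {a, b, c, d, e}"
proof -
  have "card (set [a, b, c, d, e]) = 5"
    using distinct_card[OF assms] by simp
  moreover have "card (UNIV :: ix set) = 5"
    by (simp add: UNIV_ix)
  moreover have "finite (UNIV :: ix set)"
    by (simp add: UNIV_ix)
  ultimately have "set [a, b, c, d, e] = UNIV"
    by (intro card_subset_eq) simp_all
  then show ?thesis by simp
qed

lemma sum_ix_functions:
  fixes a :: ix and h :: "'a \<Rightarrow> 'a \<Rightarrow> 'a \<Rightarrow> 'a \<Rightarrow> 'a \<Rightarrow> int"
  assumes dist: "distinct [a, b, c, d, e]"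
  shows "(\<Sum>f\<in>UNIV \<rightarrow> V. h (f a) (f b) (f c) (f d) (f e)) =
    (\<Sum>x\<in>V. \<Sum>y\<in>V. \<Sum>z\<in>V. \<Sum>w\<in>V. \<Sum>t\<in>V. h x y z w t)"
proof -
  let ?g = "\<lambda>(x, y, z, w, t) i. if i = a then x else if i = b then y else if i = c then z
    else if i = d then w else t"
  have "(\<Sum>f\<in>UNIV \<rightarrow> V. h (f a) (f b) (f c) (f d) (f e)) =
    (\<Sum>(x, y, z, w, t)\<in>V \<times> V \<times> V \<times> V \<times> V. h x y z w t)"
  proof (rule sum.reindex_bij_witness[where i = ?g and j = "\<lambda>f. (f a, f b, f c, f d, f e)"])
    fix f :: "ix \<Rightarrow> 'a"
    show "?g (f a, f b, f c, f d, f e) = f"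
    proof
      fix i
      have "i \<in> {a, b, c, d, e}" using distinct_ix_UNIV[OF dist] by blast
      then show "?g (f a, f b, f c, f d, f e) i = f i" by auto
    qed
  qed (use dist in auto)
  then show ?thesis by (simp add: sum.cartesian_product)
qed

text \<open>Reading a map of the labels along any ordering is a bijection onto 5-tuples, so each
  ordering in the list contributes the same sum and symmetrisation costs only the factor
  \<open>length L\<close>.\<close>

lemma sum_ix_perms:
  fixes L :: "(ix \<times> ix \<times> ix \<times> ix \<times> ix) list"
    and h :: "'a \<Rightarrow> 'a \<Rightarrow> 'a \<Rightarrow> 'a \<Rightarrow> 'a \<Rightarrow> int"
  assumes "list_all (\<lambda>(a, b, c, d, e). distinct [a, b, c, d, e]) L"
  shows "(\<Sum>f\<in>UNIV \<rightarrow> V. \<Sum>(a, b, c, d, e)\<leftarrow>L. h (f a) (f b) (f c) (f d) (f e)) =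
    int (length L) * (\<Sum>x\<in>V. \<Sum>y\<in>V. \<Sum>z\<in>V. \<Sum>w\<in>V. \<Sum>t\<in>V. h x y z w t)"
  using assms
proof (induction L)
  case (Cons p L)
  obtain a b c d e where p: "p = (a, b, c, d, e)" by (cases p) auto
  then have "distinct [a, b, c, d, e]" using Cons.prems by simp
  from sum_ix_functions[OF this, where V = V and h = h] show ?case
    using Cons p by (simp add: sum.distrib algebra_simps)
qed simp

lemma perms_distinct:
  "list_all (\<lambda>(a, b, c, d, e). distinct [a, b, c, d, e]) ind_perms"
  "list_all (\<lambda>(a, b, c, d, e). distinct [a, b, c, d, e]) indep_root_perms"
  "list_all (\<lambda>(a, b, c, d, e). distinct [a, b, c, d, e]) edge_root_perms"
  "list_all (\<lambda>(a, b, c, d, e). distinct [a, b, c, d, e]) flag_perms"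
  "list_all (\<lambda>(a, b, c, d, e). distinct [a, b, c, d, e]) two_edges_perms"
  "list_all (\<lambda>(a, b, c, d, e). distinct [a, b, c, d, e]) path_perms"
  "list_all (\<lambda>(a, b, c, d, e). distinct [a, b, c, d, e]) pentagon_perms"
  by code_simp+

lemma perms_length:
  "length ind_perms = 5" "length indep_root_perms = 10" "length edge_root_perms = 30"
  "length flag_perms = 15" "length two_edges_perms = 15" "length path_perms = 60"
  "length pentagon_perms = 12"
  by code_simp+

text \<open>Completion of squares with cleared denominators. The reserved multiple of
  \<open>u\<^sup>2\<close> is the source of the degree variance in \<open>ind_tuples_lower\<close>,
  since \<open>u\<close> sums to 2 n (5 d - 2 n).\<close>

lemma bil1_ge: "bil1 u q p e u q p e \<ge> 80 * u\<^sup>2"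
proof -
  have "52925548250 * (bil1 u q p e u q p e - 80 * u\<^sup>2) =
    211702193 * (250 * e - 625 * p - 105 * q + 178 * u)\<^sup>2 +
    11049175 * (2395 * p + 1775 * q - 2322 * u)\<^sup>2 +
    8 * (2209835 * q - 1433381 * u)\<^sup>2 + 57676390000 * u\<^sup>2"
    unfolding bil1_def by algebra
  also have "\<dots> \<ge> 0" by simp
  finally show ?thesis by simp
qed

lemma bil2_ge: "bil2 u q p e u q p e \<ge> 0"
proof -
  have "285223250 * bil2 u q p e u q p e =
    1140893 * (250 * e - 700 * p - 140 * q + 189 * u)\<^sup>2 +
    36803 * (3100 * p + 2795 * q - 3067 * u)\<^sup>2 +
    5 * (184015 * q - 99839 * u)\<^sup>2 + 25281681875 * u\<^sup>2"
    unfolding bil2_def by algebra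
  also have "\<dots> \<ge> 0" by simp
  finally show ?thesis by simp
qed

lemma bil_sum:
  assumes "finite I"
  shows "(\<Sum>i\<in>I. \<Sum>j\<in>I. bil1 (u i) (q i) (p i) (e i) (u j) (q j) (p j) (e j)) =
      bil1 (sum u I) (sum q I) (sum p I) (sum e I) (sum u I) (sum q I) (sum p I) (sum e I)"
    and "(\<Sum>i\<in>I. \<Sum>j\<in>I. bil2 (u i) (q i) (p i) (e i) (u j) (q j) (p j) (e j)) =
      bil2 (sum u I) (sum q I) (sum p I) (sum e I) (sum u I) (sum q I) (sum p I) (sum e I)"
  unfolding bil1_def bil2_def
  by (simp_all only: sum.distrib sum_subtractf sum_distrib_left [symmetric]
      sum_distrib_right [symmetric])

section \<open>Averaging the certificate over a triangle-free graph\<close>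

locale tf_graph =
  fixes V :: "'a set" and A :: "'a \<Rightarrow> 'a \<Rightarrow> bool"
  assumes fin: "finite V"
    and sym: "A x y \<Longrightarrow> A y x"
    and tf: "A x y \<Longrightarrow> A y z \<Longrightarrow> \<not> A x z"
    and sub: "A x y \<Longrightarrow> x \<in> V"
begin

abbreviation n :: nat where "n \<equiv> card V"

definition ind_tuples :: int where
  "ind_tuples = (\<Sum>x\<in>V. \<Sum>y\<in>V. \<Sum>z\<in>V. \<Sum>w\<in>V. of_bool (ind4 A x y z w))"
definition two_edges_tuples :: int where
  "two_edges_tuples = (\<Sum>x\<in>V. \<Sum>y\<in>V. \<Sum>z\<in>V. \<Sum>w\<in>V. of_bool (two_edges A x y z w))"
definition path_pt_tuples :: int where
  "path_pt_tuples = (\<Sum>x\<in>V. \<Sum>y\<in>V. \<Sum>z\<in>V. \<Sum>w\<in>V. \<Sum>t\<in>V. of_bool (path_pt A x y z w t))"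
definition pentagon_tuples :: int where
  "pentagon_tuples = (\<Sum>x\<in>V. \<Sum>y\<in>V. \<Sum>z\<in>V. \<Sum>w\<in>V. \<Sum>t\<in>V. of_bool (pentagon A x y z w t))"
definition deg :: "'a \<Rightarrow> nat" where
  "deg x = card {y \<in> V. A x y}"

lemma irrefl: "\<not> A x x"
  using tf by blast

lemma sym_iff: "A x y \<longleftrightarrow> A y x"
  using sym by blast

text \<open>\<open>f\<close> need not be injective: by irreflexivity labels with the same image are
  non-adjacent, so the pulled back relation is always one of the evaluated patterns.\<close>

lemma cert_pattern: "cert (\<lambda>i j. A (f i) (f j))"
proof -
  have "(\<lambda>i j. A (f i) (f j)) =
    rel (A (f I0) (f I1)) (A (f I0) (f I2)) (A (f I0) (f I3)) (A (f I0) (f I4)) (A (f I1) (f I2))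
        (A (f I1) (f I3)) (A (f I1) (f I4)) (A (f I2) (f I3)) (A (f I2) (f I4)) (A (f I3) (f I4))"
    (is "?l = ?r")
  proof (intro ext)
    fix i j
    show "?l i j = ?r i j"
      using irrefl by (cases i; cases j; simp; metis sym)
  qed
  then show ?thesis using cert_rel by simp
qed

lemma tri_free5_pattern: "tri_free5 (\<lambda>i j. A (f i) (f j))"
  using tf by (auto simp: tri_free5_def tri_free_def)

lemma sum_flag_form:
  assumes "bil = bil1 \<or> bil = bil2"
  shows "(\<Sum>a\<in>V. \<Sum>b\<in>V. \<Sum>c\<in>V. \<Sum>d\<in>V. \<Sum>e\<in>V. flag_form bil A a b c d e) =
    (\<Sum>x\<in>V. bil (\<Sum>(y, z)\<in>V \<times> V. flag_u A x y z) (\<Sum>(y, z)\<in>V \<times> V. flag_q A x y z)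
        (\<Sum>(y, z)\<in>V \<times> V. flag_p A x y z) (\<Sum>(y, z)\<in>V \<times> V. flag_e A y z)
        (\<Sum>(y, z)\<in>V \<times> V. flag_u A x y z) (\<Sum>(y, z)\<in>V \<times> V. flag_q A x y z)
        (\<Sum>(y, z)\<in>V \<times> V. flag_p A x y z) (\<Sum>(y, z)\<in>V \<times> V. flag_e A y z))"
proof (rule sum.cong[OF refl])
  fix x
  have "(\<Sum>b\<in>V. \<Sum>c\<in>V. \<Sum>d\<in>V. \<Sum>e\<in>V. flag_form bil A x b c d e) =
    (\<Sum>i\<in>V \<times> V. \<Sum>j\<in>V \<times> V. bil
      (case i of (y, z) \<Rightarrow> flag_u A x y z) (case i of (y, z) \<Rightarrow> flag_q A x y z)
      (case i of (y, z) \<Rightarrow> flag_p A x y z) (case i of (y, z) \<Rightarrow> flag_e A y z)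
      (case j of (y, z) \<Rightarrow> flag_u A x y z) (case j of (y, z) \<Rightarrow> flag_q A x y z)
      (case j of (y, z) \<Rightarrow> flag_p A x y z) (case j of (y, z) \<Rightarrow> flag_e A y z))"
    by (simp add: sum.cartesian_product' flag_form_def)
  with bil_sum[of "V \<times> V"] fin assms
  show "(\<Sum>b\<in>V. \<Sum>c\<in>V. \<Sum>d\<in>V. \<Sum>e\<in>V. flag_form bil A x b c d e) =
    bil (\<Sum>(y, z)\<in>V \<times> V. flag_u A x y z) (\<Sum>(y, z)\<in>V \<times> V. flag_q A x y z)
        (\<Sum>(y, z)\<in>V \<times> V. flag_p A x y z) (\<Sum>(y, z)\<in>V \<times> V. flag_e A y z)
        (\<Sum>(y, z)\<in>V \<times> V. flag_u A x y z) (\<Sum>(y, z)\<in>V \<times> V. flag_q A x y z)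
        (\<Sum>(y, z)\<in>V \<times> V. flag_p A x y z) (\<Sum>(y, z)\<in>V \<times> V. flag_e A y z)"
    by auto
qed

lemma sum_deg: "(\<Sum>y\<in>V. of_bool (A x y)) = int (deg x)"
  using fin by (simp add: deg_def of_bool_def sum.If_cases Int_def)

lemma sum_flag_u: "(\<Sum>(y, z)\<in>V \<times> V. flag_u A x y z) = 2 * int n * (5 * int (deg x) - 2 * int n)"
proof -
  have "(\<Sum>(y, z)\<in>V \<times> V. flag_u A x y z) = (\<Sum>y\<in>V. \<Sum>z\<in>V. flag_u A x y z)"
    by (simp add: sum.cartesian_product)
  also have "\<dots> = 2 * int n * (5 * int (deg x) - 2 * int n)"
    by (simp add: flag_u_def sum.distrib sum_subtractf flip: sum_distrib_left add: sum_deg algebra_simps)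
  finally show ?thesis .
qed

text \<open>For fixed roots the two extensions \<open>d\<close> and \<open>e\<close> are summed
  independently, which leaves a square.\<close>

lemma sum_flag_E_nonneg:
  "(\<Sum>a\<in>V. \<Sum>b\<in>V. \<Sum>c\<in>V. \<Sum>d\<in>V. \<Sum>e\<in>V. flag_E A a b c d * flag_E A a b c e) \<ge> 0"
  by (simp add: sum_nonneg flip: sum_product)

lemma sum_flag_K_nonneg:
  "(\<Sum>a\<in>V. \<Sum>b\<in>V. \<Sum>c\<in>V. \<Sum>d\<in>V. \<Sum>e\<in>V. flag_K A a b c d * flag_K A a b c e) \<ge> 0"
  by (simp add: sum_nonneg flip: sum_product)

lemma card_functions: "card ((UNIV :: ix set) \<rightarrow> V) = n ^ 5"
proof -
  have "(\<Sum>f\<in>(UNIV :: ix set) \<rightarrow> V. 1 :: int) = int (n ^ 5)"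
    using sum_ix_functions[of I0 I1 I2 I3 I4 "\<lambda>_ _ _ _ _. 1" V] by (simp add: eval_nat_numeral)
  then show ?thesis by simp
qed

lemma cert_base_sum:
  "(\<Sum>f\<in>UNIV \<rightarrow> V. cert_base (\<lambda>i j. A (f i) (f j))) \<le> 750000 * int n * ind_tuples - 90000 * int n ^ 5"
proof -
  have 1: "(\<Sum>f\<in>UNIV \<rightarrow> V. \<Sum>(a,b,c,d,e)\<leftarrow>ind_perms. of_bool (ind4 (\<lambda>i j. A (f i) (f j)) a b c d)) =
      5 * (int n * ind_tuples)"
    using sum_ix_perms[OF perms_distinct(1), of "\<lambda>a b c d e. of_bool (ind4 A a b c d)" V]
    by (simp add: perms_length ind_tuples_def sum_distrib_left ind4_def)
  have 2: "(\<Sum>f\<in>UNIV \<rightarrow> V. \<Sum>(a,b,c,d,e)\<leftarrow>indep_root_perms.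
      flag_E (\<lambda>i j. A (f i) (f j)) a b c d * flag_E (\<lambda>i j. A (f i) (f j)) a b c e) \<ge> 0"
    using sum_ix_perms[OF perms_distinct(2), of "\<lambda>a b c d e. flag_E A a b c d * flag_E A a b c e" V]
      sum_flag_E_nonneg
    by (simp add: perms_length flag_E_def)
  have 3: "(\<Sum>f\<in>UNIV \<rightarrow> V. \<Sum>(a,b,c,d,e)\<leftarrow>edge_root_perms.
      flag_K (\<lambda>i j. A (f i) (f j)) a b c d * flag_K (\<lambda>i j. A (f i) (f j)) a b c e) \<ge> 0"
    using sum_ix_perms[OF perms_distinct(3), of "\<lambda>a b c d e. flag_K A a b c d * flag_K A a b c e" V]
      sum_flag_K_nonneg
    by (simp add: perms_length flag_K_def)
  from 1 2 3 card_functions show ?thesis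
    by (simp add: cert_base_def sum.distrib sum_subtractf flip: sum_distrib_left)
qed

lemma flag_form_sum:
  "(\<Sum>f\<in>UNIV \<rightarrow> V. \<Sum>(a,b,c,d,e)\<leftarrow>flag_perms. flag_form bil (\<lambda>i j. A (f i) (f j)) a b c d e) =
    15 * (\<Sum>a\<in>V. \<Sum>b\<in>V. \<Sum>c\<in>V. \<Sum>d\<in>V. \<Sum>e\<in>V. flag_form bil A a b c d e)"
  using sum_ix_perms[OF perms_distinct(4), of "flag_form bil A" V]
  by (simp add: perms_length flag_form_def flag_u_def flag_q_def flag_p_def flag_e_def)

text \<open>The first inequality of \<open>cert\<close>, summed over all maps of the labels into
  \<open>V\<close> and divided by 15.\<close>

theorem ind_tuples_lower:
  "50000 * int n * ind_tuples \<ge> 6000 * int n ^ 5 + 18000 * int n * two_edges_tuples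
     + 120000 * path_pt_tuples + 320 * int n ^ 2 * (\<Sum>x\<in>V. (5 * int (deg x) - 2 * int n)\<^sup>2)"
proof -
  let ?F = "(UNIV :: ix set) \<rightarrow> V"
  let ?R = "\<lambda>f i j. A (f i) (f j)"
  let ?D = "\<Sum>x\<in>V. (5 * int (deg x) - 2 * int n)\<^sup>2"
  have 1: "(\<Sum>f\<in>?F. \<Sum>(a,b,c,d,e)\<leftarrow>two_edges_perms. of_bool (two_edges (?R f) a b c d)) =
      15 * (int n * two_edges_tuples)"
    using sum_ix_perms[OF perms_distinct(5), of "\<lambda>a b c d e. of_bool (two_edges A a b c d)" V]
    by (simp add: perms_length two_edges_tuples_def sum_distrib_left two_edges_def)
  have 2: "(\<Sum>f\<in>?F. \<Sum>(a,b,c,d,e)\<leftarrow>path_perms. of_bool (path_pt (?R f) a b c d e)) =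
      60 * path_pt_tuples"
    using sum_ix_perms[OF perms_distinct(6), of "\<lambda>a b c d e. of_bool (path_pt A a b c d e)" V]
    by (simp add: perms_length path_pt_tuples_def path_pt_def)
  have "320 * int n ^ 2 * ?D =
      (\<Sum>x\<in>V. 80 * (2 * int n * (5 * int (deg x) - 2 * int n))\<^sup>2)"
    unfolding sum_distrib_left by (intro sum.cong refl) (simp add: power_mult_distrib)
  also have "\<dots> \<le> (\<Sum>a\<in>V. \<Sum>b\<in>V. \<Sum>c\<in>V. \<Sum>d\<in>V. \<Sum>e\<in>V. flag_form bil1 A a b c d e)"
    unfolding sum_flag_form[OF disjI1[OF refl]] sum_flag_u by (intro sum_mono bil1_ge)
  finally have 3: "15 * (320 * int n ^ 2 * ?D) \<le>
      (\<Sum>f\<in>?F. \<Sum>(a,b,c,d,e)\<leftarrow>flag_perms. flag_form bil1 (?R f) a b c d e)"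
    by (simp add: flag_form_sum)
  have "(\<Sum>f\<in>?F. cert_base (?R f) - (\<Sum>(a,b,c,d,e)\<leftarrow>flag_perms. flag_form bil1 (?R f) a b c d e)) \<ge>
    (\<Sum>f\<in>?F. 18000 * (\<Sum>(a,b,c,d,e)\<leftarrow>two_edges_perms. of_bool (two_edges (?R f) a b c d)) +
       30000 * (\<Sum>(a,b,c,d,e)\<leftarrow>path_perms. of_bool (path_pt (?R f) a b c d e)))"
    using cert_pattern tri_free5_pattern by (intro sum_mono) (simp add: cert_def)
  then have "18000 * (15 * (int n * two_edges_tuples)) + 30000 * (60 * path_pt_tuples) \<le>
    (\<Sum>f\<in>?F. cert_base (?R f)) -
    (\<Sum>f\<in>?F. \<Sum>(a,b,c,d,e)\<leftarrow>flag_perms. flag_form bil1 (?R f) a b c d e)"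
    by (simp add: sum.distrib sum_subtractf 1 2 flip: sum_distrib_left)
  with 3 cert_base_sum show ?thesis by (simp add: algebra_simps)
qed

text \<open>Since 6032 exceeds 6000 = 50000 times 3/25, a graph with density close to 3/25 must make
  up the difference by a positive density of pentagons.\<close>

theorem pentagon_tuples_lower:
  "50000 * int n * ind_tuples \<ge> 6032 * int n ^ 5 - 22080 * pentagon_tuples"
proof -
  let ?F = "(UNIV :: ix set) \<rightarrow> V"
  let ?R = "\<lambda>f i j. A (f i) (f j)"
  have 1: "(\<Sum>f\<in>?F. \<Sum>(a,b,c,d,e)\<leftarrow>pentagon_perms. of_bool (pentagon (?R f) a b c d e)) =
      12 * pentagon_tuples"
    using sum_ix_perms[OF perms_distinct(7), of "\<lambda>a b c d e. of_bool (pentagon A a b c d e)" V]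
    by (simp add: perms_length pentagon_tuples_def pentagon_def)
  have "0 \<le> (\<Sum>a\<in>V. \<Sum>b\<in>V. \<Sum>c\<in>V. \<Sum>d\<in>V. \<Sum>e\<in>V. flag_form bil2 A a b c d e)"
    unfolding sum_flag_form[OF disjI2[OF refl]] by (intro sum_nonneg bil2_ge)
  then have 2: "0 \<le> (\<Sum>f\<in>?F. \<Sum>(a,b,c,d,e)\<leftarrow>flag_perms. flag_form bil2 (?R f) a b c d e)"
    by (simp add: flag_form_sum)
  have "(\<Sum>f\<in>?F. cert_base (?R f) - (\<Sum>(a,b,c,d,e)\<leftarrow>flag_perms. flag_form bil2 (?R f) a b c d e)) \<ge>
    (\<Sum>f\<in>?F. 480 - 27600 * (\<Sum>(a,b,c,d,e)\<leftarrow>pentagon_perms. of_bool (pentagon (?R f) a b c d e)))"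
    using cert_pattern tri_free5_pattern by (intro sum_mono) (simp add: cert_def)
  then have "480 * int n ^ 5 - 27600 * (12 * pentagon_tuples) \<le>
    (\<Sum>f\<in>?F. cert_base (?R f)) -
    (\<Sum>f\<in>?F. \<Sum>(a,b,c,d,e)\<leftarrow>flag_perms. flag_form bil2 (?R f) a b c d e)"
    by (simp add: sum.distrib sum_subtractf 1 card_functions flip: sum_distrib_left)
  with 2 cert_base_sum show ?thesis by (simp add: algebra_simps)
qed

end

section \<open>A good pentagon\<close>

text \<open>Cyclic shifts by 1 to 4 on a five-element datatype take the place of arithmetic modulo
  5: rewriting with the composition table and case distinction then settle all questions about
  positions on the pentagon.\<close>

fun s1 :: "ix \<Rightarrow> ix" where
  "s1 I0 = I1" | "s1 I1 = I2" | "s1 I2 = I3" | "s1 I3 = I4" | "s1 I4 = I0"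
definition s2 :: "ix \<Rightarrow> ix" where "s2 i = s1 (s1 i)"
definition s3 :: "ix \<Rightarrow> ix" where "s3 i = s1 (s2 i)"
definition s4 :: "ix \<Rightarrow> ix" where "s4 i = s1 (s3 i)"

lemma shift_simps [simp]:
  "s1 (s1 i) = s2 i" "s1 (s2 i) = s3 i" "s1 (s3 i) = s4 i" "s1 (s4 i) = i"
  "s2 (s1 i) = s3 i" "s2 (s2 i) = s4 i" "s2 (s3 i) = i" "s2 (s4 i) = s1 i"
  "s3 (s1 i) = s4 i" "s3 (s2 i) = i" "s3 (s3 i) = s1 i" "s3 (s4 i) = s2 i"
  "s4 (s1 i) = i" "s4 (s2 i) = s1 i" "s4 (s3 i) = s2 i" "s4 (s4 i) = s3 i"
  by (cases i; simp add: s2_def s3_def s4_def)+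

lemma shift_neq [simp]: "s1 i \<noteq> i" "s2 i \<noteq> i" "s3 i \<noteq> i" "s4 i \<noteq> i"
    "s1 i \<noteq> s2 i" "s1 i \<noteq> s3 i" "s1 i \<noteq> s4 i" "s2 i \<noteq> s3 i" "s2 i \<noteq> s4 i" "s3 i \<noteq> s4 i"
  by (cases i; simp add: s2_def s3_def s4_def)+

lemmas shift_neq' [simp] = shift_neq [THEN not_sym]

lemma shift_eval [simp]: "s2 I0 = I2" "s2 I1 = I3" "s2 I2 = I4" "s2 I3 = I0" "s2 I4 = I1"
  "s3 I0 = I3" "s3 I1 = I4" "s3 I2 = I0" "s3 I3 = I1" "s3 I4 = I2"
  "s4 I0 = I4" "s4 I1 = I0" "s4 I2 = I1" "s4 I3 = I2" "s4 I4 = I3"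
  by (simp_all add: s2_def s3_def s4_def)

lemma ix_shift_cases:
  obtains "j = i" | "j = s1 i" | "j = s2 i" | "j = s3 i" | "j = s4 i"
  by (cases i; cases j; simp add: s2_def s3_def s4_def)

instance ix :: finite
  by standard (simp add: UNIV_ix)

lemma card_ix: "card (UNIV :: ix set) = 5"
  by (simp add: UNIV_ix)

section \<open>Defects of a pentagon and their average\<close>

context tf_graph
begin

definition pent :: "(ix \<Rightarrow> 'a) \<Rightarrow> bool" where
  "pent v \<longleftrightarrow> (\<forall>i. A (v i) (v (s1 i)))"

text \<open>The vertices attached to the pentagon as a clone of \<open>v i\<close> would be. A
  vertex in no such set belongs to \<open>off\<close>, and a pair missing between consecutive sets
  belongs to \<open>gaps\<close>.\<close>

definition U :: "(ix \<Rightarrow> 'a) \<Rightarrow> ix \<Rightarrow> 'a set" where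
  "U v i = {w \<in> V. A w (v (s1 i)) \<and> A w (v (s4 i))}"

definition off :: "(ix \<Rightarrow> 'a) \<Rightarrow> 'a set" where
  "off v = {w \<in> V. \<forall>i. w \<notin> U v i}"

definition gaps :: "(ix \<Rightarrow> 'a) \<Rightarrow> ix \<Rightarrow> ('a \<times> 'a) set" where
  "gaps v i = {(w, w'). w \<in> U v i \<and> w' \<in> U v (s1 i) \<and> \<not> A w w'}"

lemma pent_adj:
  assumes "pent v"
  shows "A (v i) (v (s1 i))" "A (v (s1 i)) (v i)" "A (v i) (v (s4 i))" "A (v (s4 i)) (v i)"
proof -
  show "A (v i) (v (s1 i))" using assms by (simp add: pent_def)
  then show "A (v (s1 i)) (v i)" by (rule sym)
  have "A (v (s4 i)) (v (s1 (s4 i)))" using assms unfolding pent_def by blast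
  then show "A (v (s4 i)) (v i)" by simp
  then show "A (v i) (v (s4 i))" by (rule sym)
qed

lemma no_common_nbr: "A x z \<Longrightarrow> A y z \<Longrightarrow> \<not> A x y"
  using tf sym by blast

lemma pent_nonadj:
  assumes "pent v"
  shows "\<not> A (v i) (v (s2 i))" "\<not> A (v i) (v (s3 i))"
proof -
  show "\<not> A (v i) (v (s2 i))"
    using no_common_nbr[of "v i" "v (s1 i)" "v (s2 i)"] pent_adj[OF assms, of i]
      pent_adj[OF assms, of "s1 i"] by simp
  show "\<not> A (v i) (v (s3 i))"
    using no_common_nbr[of "v i" "v (s4 i)" "v (s3 i)"] pent_adj[OF assms, of i]
      pent_adj[OF assms, of "s4 i"] by simp
qed

text \<open>Two neighbours on the pentagon are at distance two there and put \<open>w\<close> into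
  some \<open>U v i\<close>. A single neighbour \<open>v i\<close> gives an edge that is disjoint
  and non-adjacent from the opposite edge of the pentagon; no neighbour at all makes
  \<open>w\<close> isolated from a path of the pentagon.\<close>

lemma off_cases:
  assumes v: "pent v" and w: "w \<in> off v"
  shows "path_pt A (v I0) (v I1) (v I2) (v I3) w \<or>
    (\<exists>i. two_edges A w (v i) (v (s2 i)) (v (s3 i)))"
proof (cases "\<exists>i. A w (v i)")
  case True
  then obtain i where i: "A w (v i)" by blast
  have "w \<notin> U v (s1 i)" "w \<notin> U v (s4 i)" using w by (auto simp: off_def)
  then have "\<not> A w (v (s2 i))" "\<not> A w (v (s3 i))"
    using i w by (auto simp: U_def off_def)
  moreover have "A (v (s2 i)) (v (s3 i))" using pent_adj(1)[OF v, of "s2 i"] by simp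
  ultimately show ?thesis
    using i pent_nonadj[OF v, of i] unfolding two_edges_def by blast
next
  case False
  have "A (v I0) (v I1)" "A (v I1) (v I2)" "A (v I2) (v I3)"
    using pent_adj(1)[OF v, of I0] pent_adj(1)[OF v, of I1] pent_adj(1)[OF v, of I2] by simp_all
  moreover have "\<not> A (v I0) (v I2)" "\<not> A (v I0) (v I3)" "\<not> A (v I1) (v I3)"
    using pent_nonadj[OF v, of I0] pent_nonadj[OF v, of I1] by simp_all
  ultimately show ?thesis
    using False sym unfolding path_pt_def by blast
qed

text \<open>Each of the two non-adjacent vertices is paired with its neighbour on the pentagon on
  the far side from the other one; all remaining adjacencies would close a triangle.\<close>

lemma gap_two_edges:
  assumes v: "pent v" and "(w, w') \<in> gaps v i"
  shows "two_edges A w (v (s4 i)) w' (v (s2 i))"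
proof -
  have w: "A w (v (s1 i))" "A w (v (s4 i))" "A w' (v (s2 i))" "A w' (v i)" "\<not> A w w'"
    using assms(2) by (auto simp: gaps_def U_def)
  have "\<not> A w (v (s2 i))"
    using tf[OF w(1), of "v (s2 i)"] pent_adj(1)[OF v, of "s1 i"] by simp
  moreover have "\<not> A w' (v (s4 i))"
    using tf[OF w(4), of "v (s4 i)"] pent_adj(3)[OF v, of "i"] by simp
  moreover have "\<not> A (v (s4 i)) (v (s2 i))"
    using pent_nonadj(2)[OF v, of "s4 i"] by simp
  ultimately show ?thesis
    using w sym_iff unfolding two_edges_def by blast
qed

lemma finite_functions: "finite ((UNIV :: ix set) \<rightarrow> V)"
proof -
  have "(UNIV :: ix set) \<rightarrow> V = PiE UNIV (\<lambda>_. V)" by (auto simp: PiE_def extensional_def)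
  then show ?thesis using fin finite_PiE[of "UNIV :: ix set" "\<lambda>_. V"] by simp
qed

lemma pent_in_V: "pent v \<Longrightarrow> v i \<in> V"
  using sub pent_def by blast

lemma card_pent: "int (card {v. pent v}) = pentagon_tuples"
proof -
  have *: "{v. pent v} = {v \<in> UNIV \<rightarrow> V. pentagon A (v I0) (v I1) (v I2) (v I3) (v I4)}"
  proof (intro set_eqI iffI; clarsimp)
    fix v assume v: "pent v"
    show "v \<in> UNIV \<rightarrow> V \<and> pentagon A (v I0) (v I1) (v I2) (v I3) (v I4)"
      using pent_in_V[OF v] pent_adj(1)[OF v, of I0] pent_adj(1)[OF v, of I1]
        pent_adj(1)[OF v, of I2] pent_adj(1)[OF v, of I3] pent_adj(1)[OF v, of I4]
      by (simp add: pentagon_def)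
  next
    fix v assume v: "pentagon A (v I0) (v I1) (v I2) (v I3) (v I4)"
    show "pent v"
      unfolding pent_def
    proof
      fix i show "A (v i) (v (s1 i))" using v by (cases i) (simp_all add: pentagon_def)
    qed
  qed
  have "int (card {v. pent v}) =
      (\<Sum>v\<in>UNIV \<rightarrow> V. of_bool (pentagon A (v I0) (v I1) (v I2) (v I3) (v I4)))"
    unfolding * using finite_functions by (simp add: of_bool_def sum.If_cases Int_def)
  also have "\<dots> = pentagon_tuples"
    unfolding pentagon_tuples_def
    by (rule sum_ix_functions[of I0 I1 I2 I3 I4 "\<lambda>a b c d e. of_bool (pentagon A a b c d e)"]) simp
  finally show ?thesis .
qed

text \<open>The configurations of \<open>off_cases\<close> are counted together with the free
  vertices of the pentagon: the path leaves one vertex free, the two edges leave two, and the latter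
  can sit in five positions.\<close>

lemma sum_off:
  "(\<Sum>v | pent v. int (card (off v))) \<le> int n * path_pt_tuples + 5 * int n ^ 2 * two_edges_tuples"
proof -
  let ?F = "(UNIV :: ix set) \<rightarrow> V"
  have le: "int (card (off v)) \<le> (\<Sum>w\<in>V. of_bool (path_pt A (v I0) (v I1) (v I2) (v I3) w)) +
     (\<Sum>i\<in>UNIV. \<Sum>w\<in>V. of_bool (two_edges A w (v i) (v (s2 i)) (v (s3 i))))" if v: "pent v" for v
  proof -
    have "int (card (off v)) = (\<Sum>w\<in>V. of_bool (w \<in> off v))"
      using fin by (simp add: of_bool_def sum.If_cases Int_def off_def)
    also have "\<dots> \<le> (\<Sum>w\<in>V. of_bool (path_pt A (v I0) (v I1) (v I2) (v I3) w) +
        (\<Sum>i\<in>UNIV. of_bool (two_edges A w (v i) (v (s2 i)) (v (s3 i)))))"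
    proof (rule sum_mono)
      fix w
      show "(of_bool (w \<in> off v) :: int) \<le> of_bool (path_pt A (v I0) (v I1) (v I2) (v I3) w) +
        (\<Sum>i\<in>UNIV. of_bool (two_edges A w (v i) (v (s2 i)) (v (s3 i))))" (is "_ \<le> ?p + ?s")
      proof (cases "\<exists>i. two_edges A w (v i) (v (s2 i)) (v (s3 i))")
        case True
        then obtain i where i: "two_edges A w (v i) (v (s2 i)) (v (s3 i))" by blast
        have "(1 :: int) \<le> ?s"
          using member_le_sum[of i UNIV "\<lambda>i. of_bool (two_edges A w (v i) (v (s2 i)) (v (s3 i))) :: int"] i
          by simp
        then show ?thesis by (simp add: of_bool_def)
      next
        case False
        have "?s \<ge> 0" by (intro sum_nonneg) simp
        then show ?thesis using off_cases[OF v, of w] False by (auto simp: of_bool_def)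
      qed
    qed
    also have "\<dots> = (\<Sum>w\<in>V. of_bool (path_pt A (v I0) (v I1) (v I2) (v I3) w)) +
     (\<Sum>i\<in>UNIV. \<Sum>w\<in>V. of_bool (two_edges A w (v i) (v (s2 i)) (v (s3 i))))"
      by (simp add: sum.distrib sum.swap[of _ V UNIV])
    finally show ?thesis .
  qed
  have "(\<Sum>v | pent v. int (card (off v))) \<le>
     (\<Sum>v | pent v. (\<Sum>w\<in>V. of_bool (path_pt A (v I0) (v I1) (v I2) (v I3) w)) +
     (\<Sum>i\<in>UNIV. \<Sum>w\<in>V. of_bool (two_edges A w (v i) (v (s2 i)) (v (s3 i)))))"
    using le by (intro sum_mono) simp
  also have "\<dots> \<le> (\<Sum>v\<in>?F. (\<Sum>w\<in>V. of_bool (path_pt A (v I0) (v I1) (v I2) (v I3) w)) +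
     (\<Sum>i\<in>UNIV. \<Sum>w\<in>V. of_bool (two_edges A w (v i) (v (s2 i)) (v (s3 i)))))"
    using pent_in_V finite_functions by (intro sum_mono2) (auto intro!: sum_nonneg add_nonneg_nonneg)
  also have "\<dots> = (\<Sum>v\<in>?F. \<Sum>w\<in>V. of_bool (path_pt A (v I0) (v I1) (v I2) (v I3) w)) +
     (\<Sum>i\<in>UNIV. \<Sum>v\<in>?F. \<Sum>w\<in>V. of_bool (two_edges A w (v i) (v (s2 i)) (v (s3 i))))"
    by (simp add: sum.distrib sum.swap[of _ ?F UNIV])
  also have "(\<Sum>v\<in>?F. \<Sum>w\<in>V. of_bool (path_pt A (v I0) (v I1) (v I2) (v I3) w)) =
      int n * path_pt_tuples"
    using sum_ix_functions[of I0 I1 I2 I3 I4 "\<lambda>a b c d e. \<Sum>w\<in>V. of_bool (path_pt A a b c d w)" V]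
    by (simp add: path_pt_tuples_def sum_distrib_left)
  also have "(\<Sum>i\<in>UNIV. \<Sum>v\<in>?F. \<Sum>w\<in>V. of_bool (two_edges A w (v i) (v (s2 i)) (v (s3 i)))) =
      (\<Sum>i\<in>(UNIV :: ix set). int n ^ 2 * two_edges_tuples)"
  proof (rule sum.cong[OF refl])
    fix i
    have "(\<Sum>v\<in>?F. \<Sum>w\<in>V. of_bool (two_edges A w (v i) (v (s2 i)) (v (s3 i)))) =
      (\<Sum>a\<in>V. \<Sum>b\<in>V. \<Sum>c\<in>V. \<Sum>d\<in>V. \<Sum>e\<in>V. \<Sum>w\<in>V. (of_bool (two_edges A w a b c) :: int))"
      using sum_ix_functions[of i "s2 i" "s3 i" "s1 i" "s4 i"
          "\<lambda>a b c d e. \<Sum>w\<in>V. of_bool (two_edges A w a b c)" V]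
      by simp
    also have "\<dots> = int n ^ 2 * (\<Sum>a\<in>V. \<Sum>b\<in>V. \<Sum>c\<in>V. \<Sum>w\<in>V. (of_bool (two_edges A w a b c) :: int))"
      by (simp add: sum_distrib_left power2_eq_square mult.assoc)
    also have "(\<Sum>a\<in>V. \<Sum>b\<in>V. \<Sum>c\<in>V. \<Sum>w\<in>V. (of_bool (two_edges A w a b c) :: int)) =
        (\<Sum>a\<in>V. \<Sum>b\<in>V. \<Sum>w\<in>V. \<Sum>c\<in>V. of_bool (two_edges A w a b c))"
      by (intro sum.cong[OF refl] sum.swap)
    also have "\<dots> = (\<Sum>a\<in>V. \<Sum>w\<in>V. \<Sum>b\<in>V. \<Sum>c\<in>V. of_bool (two_edges A w a b c))"
      by (intro sum.cong[OF refl] sum.swap)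
    also have "\<dots> = two_edges_tuples"
      unfolding two_edges_tuples_def by (rule sum.swap)
    finally show "(\<Sum>v\<in>?F. \<Sum>w\<in>V. of_bool (two_edges A w (v i) (v (s2 i)) (v (s3 i)))) =
      int n ^ 2 * two_edges_tuples" .
  qed
  finally show ?thesis by (simp add: card_ix)
qed

text \<open>The two edges of \<open>gap_two_edges\<close> use two vertices of the pentagon, so three
  are free.\<close>

lemma sum_gaps: "(\<Sum>v | pent v. int (card (gaps v i))) \<le> int n ^ 3 * two_edges_tuples"
proof -
  let ?F = "(UNIV :: ix set) \<rightarrow> V"
  let ?T = "\<lambda>v. \<Sum>w\<in>V. \<Sum>w'\<in>V. (of_bool (two_edges A w (v (s4 i)) w' (v (s2 i))) :: int)"
  have le: "int (card (gaps v i)) \<le> ?T v" if v: "pent v" for v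
  proof -
    have "gaps v i \<subseteq> V \<times> V" by (auto simp: gaps_def U_def)
    then have "int (card (gaps v i)) = (\<Sum>p\<in>V \<times> V. of_bool (p \<in> gaps v i))"
      using fin by (simp add: of_bool_def sum.If_cases Int_absorb1)
    also have "\<dots> \<le> (\<Sum>(w, w')\<in>V \<times> V. of_bool (two_edges A w (v (s4 i)) w' (v (s2 i))))"
      using gap_two_edges[OF v, of _ _ i] by (intro sum_mono) (auto simp: of_bool_def)
    finally show ?thesis by (simp add: sum.cartesian_product)
  qed
  have "(\<Sum>v | pent v. int (card (gaps v i))) \<le> (\<Sum>v | pent v. ?T v)"
    using le by (intro sum_mono) simp
  also have "\<dots> \<le> (\<Sum>v\<in>?F. ?T v)"
    using pent_in_V finite_functions by (intro sum_mono2) (auto intro!: sum_nonneg)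
  also have "\<dots> = (\<Sum>a\<in>V. \<Sum>b\<in>V. \<Sum>c\<in>V. \<Sum>d\<in>V. \<Sum>e\<in>V. \<Sum>w\<in>V. \<Sum>w'\<in>V. (of_bool (two_edges A w a w' b) :: int))"
    using sum_ix_functions[of "s4 i" "s2 i" "s3 i" "s1 i" i
          "\<lambda>a b c d e. \<Sum>w\<in>V. \<Sum>w'\<in>V. of_bool (two_edges A w a w' b)" V]
    by simp
  also have "\<dots> = int n ^ 3 * (\<Sum>a\<in>V. \<Sum>b\<in>V. \<Sum>w\<in>V. \<Sum>w'\<in>V. (of_bool (two_edges A w a w' b) :: int))"
    by (simp add: sum_distrib_left power3_eq_cube mult.assoc)
  also have "(\<Sum>a\<in>V. \<Sum>b\<in>V. \<Sum>w\<in>V. \<Sum>w'\<in>V. (of_bool (two_edges A w a w' b) :: int)) =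
      (\<Sum>a\<in>V. \<Sum>w\<in>V. \<Sum>b\<in>V. \<Sum>w'\<in>V. of_bool (two_edges A w a w' b))"
    by (intro sum.cong[OF refl] sum.swap)
  also have "\<dots> = (\<Sum>w\<in>V. \<Sum>a\<in>V. \<Sum>b\<in>V. \<Sum>w'\<in>V. of_bool (two_edges A w a w' b))"
    by (rule sum.swap)
  also have "\<dots> = two_edges_tuples"
    unfolding two_edges_tuples_def by (intro sum.cong[OF refl] sum.swap)
  finally show ?thesis .
qed

lemma sum_deg_dev:
  "(\<Sum>v | pent v. (5 * int (deg (v i)) - 2 * int n)\<^sup>2) \<le>
    int n ^ 4 * (\<Sum>x\<in>V. (5 * int (deg x) - 2 * int n)\<^sup>2)"
proof -
  let ?F = "(UNIV :: ix set) \<rightarrow> V"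
  have "(\<Sum>v | pent v. (5 * int (deg (v i)) - 2 * int n)\<^sup>2) \<le>
    (\<Sum>v\<in>?F. (5 * int (deg (v i)) - 2 * int n)\<^sup>2)"
    using pent_in_V finite_functions by (intro sum_mono2) auto
  also have "\<dots> = (\<Sum>a\<in>V. \<Sum>b\<in>V. \<Sum>c\<in>V. \<Sum>d\<in>V. \<Sum>e\<in>V. (5 * int (deg a) - 2 * int n)\<^sup>2)"
    using sum_ix_functions[of i "s2 i" "s3 i" "s1 i" "s4 i"
          "\<lambda>a b c d e. (5 * int (deg a) - 2 * int n)\<^sup>2" V]
    by simp
  also have "\<dots> = int n ^ 4 * (\<Sum>x\<in>V. (5 * int (deg x) - 2 * int n)\<^sup>2)"
    by (simp add: sum_distrib_left eval_nat_numeral mult.assoc)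
  finally show ?thesis .
qed

text \<open>The slack in \<open>ind_tuples_lower\<close> is at most 50000 c n^4, and 50000 divided
  by 18000, 120000 and 320 is below 3, 1 and 157. The lower bound on n turns the same slack into at
  most n^5, leaving 31 n^5 of the surplus 32 n^5 for the pentagons, and 31/22080 > 1/1000.\<close>

lemma tuple_bounds:
  fixes c :: real
  assumes T: "real_of_int ind_tuples \<le> 3 / 25 * real n ^ 4 + c * real n ^ 3"
    and c: "c \<ge> 1" and n: "real n \<ge> 50000 * c"
  shows "real_of_int two_edges_tuples \<le> 3 * c * real n ^ 3"
    and "real_of_int path_pt_tuples \<le> c * real n ^ 4"
    and "real_of_int (\<Sum>x\<in>V. (5 * int (deg x) - 2 * int n)\<^sup>2) \<le> 157 * c * real n ^ 2"
    and "real_of_int pentagon_tuples \<ge> real n ^ 5 / 1000"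
proof -
  define N where "N = real n"
  define D where "D = (\<Sum>x\<in>V. (5 * int (deg x) - 2 * int n)\<^sup>2)"
  have N: "N > 0" "N \<ge> 50000 * c" using n c by (simp_all add: N_def)
  have nonneg: "real_of_int two_edges_tuples \<ge> 0" "real_of_int path_pt_tuples \<ge> 0" "real_of_int D \<ge> 0"
    unfolding two_edges_tuples_def path_pt_tuples_def D_def of_int_0_le_iff
    by (intro sum_nonneg; simp)+
  have "real_of_int (6000 * int n ^ 5 + 18000 * int n * two_edges_tuples
     + 120000 * path_pt_tuples + 320 * int n ^ 2 * D) \<le> real_of_int (50000 * int n * ind_tuples)"
    using ind_tuples_lower unfolding of_int_le_iff D_def .
  then have 1: "6000 * N ^ 5 + 18000 * N * real_of_int two_edges_tuples
     + 120000 * real_of_int path_pt_tuples + 320 * N ^ 2 * real_of_int D \<le> 50000 * N * real_of_int ind_tuples"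
    by (simp add: N_def)
  have "50000 * N * real_of_int ind_tuples \<le> 50000 * N * (3 / 25 * N ^ 4 + c * N ^ 3)"
    using T N by (intro mult_left_mono) (simp_all add: N_def)
  also have "\<dots> = 6000 * N ^ 5 + 50000 * c * N ^ 4"
    by (simp add: algebra_simps eval_nat_numeral)
  finally have 2: "50000 * N * real_of_int ind_tuples \<le> 6000 * N ^ 5 + 50000 * c * N ^ 4" .
  have nn: "18000 * N * real_of_int two_edges_tuples \<ge> 0" "320 * N ^ 2 * real_of_int D \<ge> 0" "N ^ 4 * c \<ge> 0"
    using nonneg N c by auto
  have "18000 * N * real_of_int two_edges_tuples \<le> 54000 * c * N ^ 4"
    using 1 2 nonneg nn by linarith
  then have "(18000 * N) * real_of_int two_edges_tuples \<le> (18000 * N) * (3 * c * N ^ 3)"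
    by (simp add: algebra_simps eval_nat_numeral)
  then show "real_of_int two_edges_tuples \<le> 3 * c * real n ^ 3"
    unfolding N_def[symmetric] using N by (simp only: mult_le_cancel_left_pos)
  show "real_of_int path_pt_tuples \<le> c * real n ^ 4"
    using 1 2 nonneg nn unfolding N_def[symmetric] by linarith
  have "320 * N ^ 2 * real_of_int D \<le> 50240 * c * N ^ 4"
    using 1 2 nonneg nn by linarith
  then have "(320 * N ^ 2) * real_of_int D \<le> (320 * N ^ 2) * (157 * c * N ^ 2)"
    by (simp add: algebra_simps eval_nat_numeral)
  then show "real_of_int (\<Sum>x\<in>V. (5 * int (deg x) - 2 * int n)\<^sup>2) \<le> 157 * c * real n ^ 2"
    unfolding N_def[symmetric] D_def[symmetric] by (rule mult_left_le_imp_le) (use N in simp)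
  have "real_of_int (6032 * int n ^ 5 - 22080 * pentagon_tuples) \<le> real_of_int (50000 * int n * ind_tuples)"
    using pentagon_tuples_lower unfolding of_int_le_iff .
  then have 3: "6032 * N ^ 5 - 22080 * real_of_int pentagon_tuples \<le> 50000 * N * real_of_int ind_tuples"
    by (simp add: N_def)
  have "(50000 * c) * N ^ 4 \<le> N * N ^ 4"
    using N by (intro mult_right_mono) auto
  then have "50000 * c * N ^ 4 \<le> N ^ 5"
    by (simp add: eval_nat_numeral)
  moreover have "N ^ 5 > 0" using N by simp
  ultimately show "real_of_int pentagon_tuples \<ge> real n ^ 5 / 1000"
    using 2 3 unfolding N_def[symmetric] by linarith
qed

text \<open>The total defect of all labelled pentagons is at most 816 c n^6, where 816 = 1 + 15 + 15
  + 785, and there are at least n^5/1000 of them, so some pentagon is no worse than the average. The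
  factor n at \<open>off\<close> brings the three kinds of defects to the same order.\<close>

lemma good_pentagon:
  fixes c :: real
  assumes T: "real_of_int ind_tuples \<le> 3 / 25 * real n ^ 4 + c * real n ^ 3"
    and c: "c \<ge> 1" and n: "real n \<ge> 50000 * c"
  obtains v where "pent v"
    and "real n * card (off v) + (\<Sum>i\<in>UNIV. real (card (gaps v i)))
      + (\<Sum>i\<in>UNIV. (5 * real (deg (v i)) - 2 * real n)\<^sup>2) \<le> 816000 * c * real n"
proof -
  define Z where "Z v = int n * int (card (off v)) + (\<Sum>i\<in>UNIV. int (card (gaps v i)))
      + (\<Sum>i\<in>UNIV. (5 * int (deg (v i)) - 2 * int n)\<^sup>2)" for v
  define D where "D = (\<Sum>x\<in>V. (5 * int (deg x) - 2 * int n)\<^sup>2)"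
  define N where "N = real n"
  have N: "N > 0" using n c by (simp add: N_def)
  have finp: "finite {v. pent v}"
    using finite_functions pent_in_V by (elim finite_subset[rotated]) auto
  have "(\<Sum>v | pent v. Z v) = int n * (\<Sum>v | pent v. int (card (off v)))
      + (\<Sum>i\<in>UNIV. \<Sum>v | pent v. int (card (gaps v i)))
      + (\<Sum>i\<in>UNIV. \<Sum>v | pent v. (5 * int (deg (v i)) - 2 * int n)\<^sup>2)"
    by (simp add: Z_def sum.distrib sum_distrib_left sum.swap[of _ UNIV])
  also have "\<dots> \<le> int n * (int n * path_pt_tuples + 5 * int n ^ 2 * two_edges_tuples)
      + (\<Sum>i\<in>(UNIV :: ix set). int n ^ 3 * two_edges_tuples) + (\<Sum>i\<in>(UNIV :: ix set). int n ^ 4 * D)"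
    unfolding D_def by (intro add_mono sum_mono sum_gaps sum_deg_dev mult_left_mono sum_off) simp
  also have "\<dots> = int n ^ 2 * path_pt_tuples + 10 * int n ^ 3 * two_edges_tuples + 5 * int n ^ 4 * D"
    by (simp add: card_ix algebra_simps eval_nat_numeral)
  finally have "real_of_int (\<Sum>v | pent v. Z v) \<le>
      real_of_int (int n ^ 2 * path_pt_tuples + 10 * int n ^ 3 * two_edges_tuples + 5 * int n ^ 4 * D)"
    by (simp only: of_int_le_iff)
  also have "\<dots> = N ^ 2 * real_of_int path_pt_tuples + 10 * N ^ 3 * real_of_int two_edges_tuples
      + 5 * N ^ 4 * real_of_int D"
    by (simp add: N_def)
  also have "\<dots> \<le> N ^ 2 * (c * N ^ 4) + 10 * N ^ 3 * (3 * c * N ^ 3) + 5 * N ^ 4 * (157 * c * N ^ 2)"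
    using tuple_bounds[OF assms] N unfolding D_def N_def
    by (intro add_mono mult_left_mono) auto
  also have "\<dots> = 816 * c * N ^ 6"
    by (simp add: algebra_simps eval_nat_numeral)
  finally have sumZ: "real_of_int (\<Sum>v | pent v. Z v) \<le> 816 * c * N ^ 6" .
  have "\<exists>v. pent v \<and> real_of_int (Z v) \<le> 816000 * c * N"
  proof (rule ccontr)
    assume "\<not> ?thesis"
    then have big: "real_of_int (Z v) > 816000 * c * N" if "pent v" for v
      using that by (auto simp: not_le)
    have cardp: "real (card {v. pent v}) \<ge> N ^ 5 / 1000"
      using tuple_bounds(4)[OF assms] card_pent unfolding N_def by (metis of_int_of_nat_eq)
    have N5: "N ^ 5 / 1000 > 0" using N by simp
    then have ne: "{v. pent v} \<noteq> {}"
      using cardp by (metis card.empty not_less of_nat_0)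
    have "816 * c * N ^ 6 = (N ^ 5 / 1000) * (816000 * c * N)"
      by (simp add: eval_nat_numeral)
    also have "\<dots> \<le> real (card {v. pent v}) * (816000 * c * N)"
      using cardp N c by (intro mult_right_mono) auto
    also have "\<dots> = (\<Sum>v | pent v. 816000 * c * N)" by simp
    also have "\<dots> < (\<Sum>v | pent v. real_of_int (Z v))"
      using big ne finp by (intro sum_strict_mono) auto
    finally show False using sumZ by simp
  qed
  then obtain v where "pent v" "real_of_int (Z v) \<le> 816000 * c * N" by blast
  then show ?thesis
    by (intro that[of v]) (simp_all add: Z_def N_def)
qed

end

section \<open>Independent 4-sets through a vertex\<close>

definition ind4_sets :: "'a set \<Rightarrow> ('a \<Rightarrow> 'a \<Rightarrow> bool) \<Rightarrow> 'a set set" where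
  "ind4_sets V A = {S. S \<subseteq> V \<and> card S = 4 \<and> (\<forall>x\<in>S. \<forall>y\<in>S. \<not> A x y)}"

lemma finite_ind4_sets: "finite V \<Longrightarrow> finite (ind4_sets V A)"
  by (rule finite_subset[of _ "Pow V"]) (auto simp: ind4_sets_def)

lemma card_distinct_lists:
  assumes "finite I" "\<And>S. S \<in> I \<Longrightarrow> finite S \<and> card S = k"
  shows "finite {xs. distinct xs \<and> set xs \<in> I}"
    and "card {xs. distinct xs \<and> set xs \<in> I} = fact k * card I"
proof -
  have *: "{xs. distinct xs \<and> set xs \<in> I} = (\<Union>S\<in>I. permutations_of_set S)"
    by (auto simp: permutations_of_set_def)
  show "finite {xs. distinct xs \<and> set xs \<in> I}"
    unfolding * by (intro finite_UN_I assms(1) finite_permutations_of_set)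
  have "card (\<Union>S\<in>I. permutations_of_set S) = (\<Sum>S\<in>I. card (permutations_of_set S))"
    by (intro card_UN_disjoint ballI impI assms(1) finite_permutations_of_set)
      (auto simp: permutations_of_set_def)
  also have "\<dots> = (\<Sum>S\<in>I. fact k)"
    using assms by (intro sum.cong) auto
  finally show "card {xs. distinct xs \<and> set xs \<in> I} = fact k * card I"
    unfolding * by simp
qed

context tf_graph
begin

definition ind_triples :: "'a \<Rightarrow> int" where
  "ind_triples v = (\<Sum>x\<in>V. \<Sum>y\<in>V. \<Sum>z\<in>V. of_bool (ind4 A v x y z))"

text \<open>Each of the six possible coincidences between two entries accounts for at most n^3
  tuples; the remaining tuples are orderings of independent 4-sets, 24 for each.\<close>

lemma ind_tuples_le: "ind_tuples \<le> 24 * int (card (ind4_sets V A)) + 6 * int n ^ 3"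
proof -
  let ?D = "\<lambda>x y z w. ind4 A x y z w \<and> distinct [x, y, z, w]"
  have "ind_tuples \<le> (\<Sum>x\<in>V. \<Sum>y\<in>V. \<Sum>z\<in>V. \<Sum>w\<in>V. of_bool (?D x y z w) + of_bool (x = y)
      + of_bool (x = z) + of_bool (x = w) + of_bool (y = z) + of_bool (y = w) + of_bool (z = w))"
    unfolding ind_tuples_def by (intro sum_mono) (auto simp: of_bool_def)
  also have "\<dots> = (\<Sum>x\<in>V. \<Sum>y\<in>V. \<Sum>z\<in>V. \<Sum>w\<in>V. of_bool (?D x y z w)) + 6 * int n ^ 3"
    using fin by (simp add: sum.distrib of_bool_def sum.delta sum.delta' power3_eq_cube del: distinct.simps
        flip: sum_distrib_left)
  also have "(\<Sum>x\<in>V. \<Sum>y\<in>V. \<Sum>z\<in>V. \<Sum>w\<in>V. of_bool (?D x y z w)) =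
      (\<Sum>(x, y, z, w)\<in>V \<times> V \<times> V \<times> V. of_bool (?D x y z w) :: int)"
    by (simp add: sum.cartesian_product del: distinct.simps)
  also have "\<dots> = int (card {(x, y, z, w) \<in> V \<times> V \<times> V \<times> V. ?D x y z w})"
    using fin by (simp add: of_bool_def split_def sum.If_cases Int_def mem_Times_iff del: distinct.simps)
  also have "card {(x, y, z, w) \<in> V \<times> V \<times> V \<times> V. ?D x y z w} \<le>
      card {xs. distinct xs \<and> set xs \<in> ind4_sets V A}"
  proof (rule card_inj_on_le[where f = "\<lambda>(x, y, z, w). [x, y, z, w]"])
    show "inj_on (\<lambda>(x, y, z, w). [x, y, z, w]) {(x, y, z, w) \<in> V \<times> V \<times> V \<times> V. ?D x y z w}"
      by (auto simp: inj_on_def)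
    show "(\<lambda>(x, y, z, w). [x, y, z, w]) ` {(x, y, z, w) \<in> V \<times> V \<times> V \<times> V. ?D x y z w} \<subseteq>
        {xs. distinct xs \<and> set xs \<in> ind4_sets V A}"
      using irrefl sym by (auto simp: ind4_sets_def ind4_def)
    show "finite {xs. distinct xs \<and> set xs \<in> ind4_sets V A}"
      using fin by (intro card_distinct_lists(1)[where k = 4] finite_ind4_sets)
        (auto simp: ind4_sets_def intro: finite_subset)
  qed
  also have "card {xs. distinct xs \<and> set xs \<in> ind4_sets V A} = fact 4 * card (ind4_sets V A)"
    using fin by (intro card_distinct_lists(2) finite_ind4_sets)
      (auto simp: ind4_sets_def intro: finite_subset)
  finally show ?thesis by (simp add: fact_numeral)
qed

lemma ind_triples_le:
  assumes v: "v \<in> V"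
  shows "ind_triples v \<le> 6 * int (card {S \<in> ind4_sets V A. v \<in> S}) + 6 * int n ^ 2"
proof -
  let ?D = "\<lambda>x y z. ind4 A v x y z \<and> distinct [v, x, y, z]"
  let ?I = "(\<lambda>S. S - {v}) ` {S \<in> ind4_sets V A. v \<in> S}"
  have "ind_triples v \<le> (\<Sum>x\<in>V. \<Sum>y\<in>V. \<Sum>z\<in>V. of_bool (?D x y z) + of_bool (x = y)
      + of_bool (x = z) + of_bool (y = z) + of_bool (x = v) + of_bool (y = v) + of_bool (z = v))"
    unfolding ind_triples_def by (intro sum_mono) (auto simp: of_bool_def)
  also have "\<dots> = (\<Sum>x\<in>V. \<Sum>y\<in>V. \<Sum>z\<in>V. of_bool (?D x y z)) + 6 * int n ^ 2"
    using fin v by (simp add: sum.distrib of_bool_def sum.delta sum.delta' power2_eq_square del: distinct.simps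
        flip: sum_distrib_left)
  also have "(\<Sum>x\<in>V. \<Sum>y\<in>V. \<Sum>z\<in>V. of_bool (?D x y z)) =
      (\<Sum>(x, y, z)\<in>V \<times> V \<times> V. of_bool (?D x y z) :: int)"
    by (simp add: sum.cartesian_product del: distinct.simps)
  also have "\<dots> = int (card {(x, y, z) \<in> V \<times> V \<times> V. ?D x y z})"
    using fin by (simp add: of_bool_def split_def sum.If_cases Int_def mem_Times_iff del: distinct.simps)
  also have "card {(x, y, z) \<in> V \<times> V \<times> V. ?D x y z} \<le> card {xs. distinct xs \<and> set xs \<in> ?I}"
  proof (rule card_inj_on_le[where f = "\<lambda>(x, y, z). [x, y, z]"])
    show "inj_on (\<lambda>(x, y, z). [x, y, z]) {(x, y, z) \<in> V \<times> V \<times> V. ?D x y z}"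
      by (auto simp: inj_on_def)
    show "(\<lambda>(x, y, z). [x, y, z]) ` {(x, y, z) \<in> V \<times> V \<times> V. ?D x y z} \<subseteq>
        {xs. distinct xs \<and> set xs \<in> ?I}"
    proof clarify
      fix x y z assume V: "x \<in> V" "y \<in> V" "z \<in> V" and i: "ind4 A v x y z" and d: "distinct [v, x, y, z]"
      have "{v, x, y, z} \<in> {S \<in> ind4_sets V A. v \<in> S}"
        using V i d v irrefl sym by (auto simp: ind4_sets_def ind4_def)
      moreover have "set [x, y, z] = {v, x, y, z} - {v}" using d by auto
      ultimately show "distinct [x, y, z] \<and> set [x, y, z] \<in> ?I" using d by auto
    qed
    show "finite {xs. distinct xs \<and> set xs \<in> ?I}"
      using finite_ind4_sets[OF fin, of A] fin
      by (intro card_distinct_lists(1)[where k = 3])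
        (auto simp: ind4_sets_def intro: finite_subset)
  qed
  also have "card {xs. distinct xs \<and> set xs \<in> ?I} = fact 3 * card ?I"
    using finite_ind4_sets[OF fin, of A] fin
    by (intro card_distinct_lists(2)) (auto simp: ind4_sets_def intro: finite_subset)
  also have "card ?I \<le> card {S \<in> ind4_sets V A. v \<in> S}"
    using finite_ind4_sets[OF fin, of A] by (intro card_image_le) auto
  finally show ?thesis by (simp add: fact_numeral)
qed

end

section \<open>Equal vertex counts in a minimal graph\<close>

locale tf_min = tf_graph +
  assumes min: "tf_graph V A' \<Longrightarrow> card (ind4_sets V A) \<le> card (ind4_sets V A')"
begin

text \<open>After the replacement, sets avoiding \<open>v\<close> are unchanged, and sets through
  \<open>v\<close> but not \<open>u\<close> become sets through \<open>u\<close> in the old graph by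
  exchanging the two vertices. Only sets containing both escape this injection, which costs
  n^2.\<close>

lemma ind4_clone:
  assumes u: "u \<in> V" and v: "v \<in> V"
  shows "card {S \<in> ind4_sets V A. v \<in> S} \<le> card {S \<in> ind4_sets V A. u \<in> S} + n ^ 2"
proof (cases "u = v")
  case False
  \<comment> \<open>\<open>v\<close> is replaced by a clone of \<open>u\<close>\<close>
  define A' where "A' x y = (if x = v then A u y \<and> y \<noteq> v else if y = v then A u x \<and> x \<noteq> v else A x y)" for x y
  have "tf_graph V A'"
  proof
    show "A' x y \<Longrightarrow> A' y x" for x y
      using sym by (auto simp: A'_def split: if_splits)
    show "A' x y \<Longrightarrow> A' y z \<Longrightarrow> \<not> A' x z" for x y z
      using sym tf unfolding A'_def by (smt (verit))
    show "A' x y \<Longrightarrow> x \<in> V" for x y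
      using sub sym v by (auto simp: A'_def split: if_splits)
  qed (rule fin)
  from min[OF this] have le: "card (ind4_sets V A) \<le> card (ind4_sets V A')" .
  have split: "card (ind4_sets V B) = card {S \<in> ind4_sets V B. v \<notin> S} + card {S \<in> ind4_sets V B. v \<in> S}" for B
    using finite_ind4_sets[OF fin, of B]
    by (subst card_Un_disjoint[symmetric]) (auto intro!: arg_cong[where f = card])
  have "{S \<in> ind4_sets V A. v \<notin> S} = {S \<in> ind4_sets V A'. v \<notin> S}"
    by (rule Collect_cong) (auto simp: ind4_sets_def A'_def)
  with le split[of A] split[of A'] have "card {S \<in> ind4_sets V A. v \<in> S} \<le> card {S \<in> ind4_sets V A'. v \<in> S}"
    by simp
  also have "\<dots> \<le> card {S \<in> ind4_sets V A'. v \<in> S \<and> u \<notin> S} + card {S \<in> ind4_sets V A'. v \<in> S \<and> u \<in> S}"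
    by (rule order_trans[OF _ card_Un_le]) (use finite_ind4_sets[OF fin, of A'] in \<open>auto intro!: card_mono\<close>)
  also have "card {S \<in> ind4_sets V A'. v \<in> S \<and> u \<notin> S} \<le> card {S \<in> ind4_sets V A. u \<in> S}"
  proof (rule card_inj_on_le[where f = "\<lambda>S. insert u (S - {v})"])
    show "inj_on (\<lambda>S. insert u (S - {v})) {S \<in> ind4_sets V A'. v \<in> S \<and> u \<notin> S}"
    proof (rule inj_onI, clarify)
      fix S T assume "v \<in> S" "u \<notin> S" "v \<in> T" "u \<notin> T" and eq: "insert u (S - {v}) = insert u (T - {v})"
      then have "S - {v} = T - {v}" by auto
      then show "S = T" using \<open>v \<in> S\<close> \<open>v \<in> T\<close> by auto
    qed
    show "(\<lambda>S. insert u (S - {v})) ` {S \<in> ind4_sets V A'. v \<in> S \<and> u \<notin> S} \<subseteq> {S \<in> ind4_sets V A. u \<in> S}"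
    proof clarify
      fix S assume S: "S \<in> ind4_sets V A'" "v \<in> S" "u \<notin> S"
      then have fS: "finite S" using fin by (auto simp: ind4_sets_def intro: finite_subset)
      have "card (insert u (S - {v})) = 4"
        using S fS by (auto simp: ind4_sets_def card_insert_if card_Diff_singleton)
      moreover have "\<not> A u x" "\<not> A x u" if "x \<in> S" "x \<noteq> v" for x
      proof -
        have "\<not> A' v x" using S that by (auto simp: ind4_sets_def)
        then show "\<not> A u x" using that by (simp add: A'_def)
        then show "\<not> A x u" using sym by blast
      qed
      moreover have "\<not> A x y" if "x \<in> S" "y \<in> S" "x \<noteq> v" "y \<noteq> v" for x y
      proof -
        have "\<not> A' x y" using S that by (auto simp: ind4_sets_def)
        then show ?thesis using that by (simp add: A'_def)
      qed
      ultimately show "insert u (S - {v}) \<in> ind4_sets V A \<and> u \<in> insert u (S - {v})"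
        using S u irrefl unfolding ind4_sets_def by auto
    qed
    show "finite {S \<in> ind4_sets V A. u \<in> S}" using finite_ind4_sets[OF fin] by auto
  qed
  also have "card {S \<in> ind4_sets V A'. v \<in> S \<and> u \<in> S} \<le> n ^ 2"
  proof -
    have "{S \<in> ind4_sets V A'. v \<in> S \<and> u \<in> S} \<subseteq> (\<lambda>(a, b). {u, v, a, b}) ` (V \<times> V)"
    proof clarify
      fix S assume S: "S \<in> ind4_sets V A'" "v \<in> S" "u \<in> S"
      then have fS: "finite S" using fin by (auto simp: ind4_sets_def intro: finite_subset)
      have "card (S - {u, v}) = 2"
        using S False fS by (subst card_Diff_subset) (auto simp: ind4_sets_def)
      then obtain a b where ab: "S - {u, v} = {a, b}" by (auto simp: card_2_iff)
      then have "S = {u, v, a, b}" using S by auto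
      moreover have "a \<in> V" "b \<in> V" using ab S by (auto simp: ind4_sets_def)
      ultimately show "S \<in> (\<lambda>(a, b). {u, v, a, b}) ` (V \<times> V)" by auto
    qed
    then have "card {S \<in> ind4_sets V A'. v \<in> S \<and> u \<in> S} \<le> card (V \<times> V)"
      using fin by (meson card_image_le card_mono finite_SigmaI finite_imageI order_trans)
    then show ?thesis by (simp add: card_cartesian_product power2_eq_square)
  qed
  finally show ?thesis by simp
qed simp

text \<open>\<open>ind4_clone\<close> is averaged over all \<open>u\<close>; double counting gives
  four times the number of sets on the right.\<close>

lemma ind4_vertex:
  assumes v: "v \<in> V"
  shows "n * card {S \<in> ind4_sets V A. v \<in> S} \<le> 4 * card (ind4_sets V A) + n ^ 3"
proof -
  have fI: "finite (ind4_sets V A)" using finite_ind4_sets[OF fin] .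
  have "(\<Sum>u\<in>V. card {S \<in> ind4_sets V A. u \<in> S}) = (\<Sum>u\<in>V. \<Sum>S\<in>ind4_sets V A. of_bool (u \<in> S))"
    using fI by (simp add: of_bool_def sum.If_cases Int_def)
  also have "\<dots> = (\<Sum>S\<in>ind4_sets V A. \<Sum>u\<in>V. of_bool (u \<in> S))"
    by (rule sum.swap)
  also have "\<dots> = (\<Sum>S\<in>ind4_sets V A. 4)"
  proof (rule sum.cong[OF refl])
    fix S assume "S \<in> ind4_sets V A"
    then have "S \<subseteq> V" "card S = 4" by (auto simp: ind4_sets_def)
    then show "(\<Sum>u\<in>V. of_bool (u \<in> S)) = (4 :: nat)"
      using fin by (simp add: of_bool_def sum.If_cases Int_absorb1)
  qed
  finally have sum: "(\<Sum>u\<in>V. card {S \<in> ind4_sets V A. u \<in> S}) = 4 * card (ind4_sets V A)" by simp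
  have "n * card {S \<in> ind4_sets V A. v \<in> S} = (\<Sum>u\<in>V. card {S \<in> ind4_sets V A. v \<in> S})" by simp
  also have "\<dots> \<le> (\<Sum>u\<in>V. card {S \<in> ind4_sets V A. u \<in> S} + n ^ 2)"
    using v by (intro sum_mono ind4_clone)
  also have "\<dots> = 4 * card (ind4_sets V A) + n ^ 3"
    by (simp add: sum.distrib sum power2_eq_square power3_eq_cube)
  finally show ?thesis .
qed

lemma ind_triples_min:
  assumes v: "v \<in> V"
  shows "int n * ind_triples v \<le> 24 * int (card (ind4_sets V A)) + 12 * int n ^ 3"
proof -
  have "int n * ind_triples v \<le> int n * (6 * int (card {S \<in> ind4_sets V A. v \<in> S}) + 6 * int n ^ 2)"
    using ind_triples_le[OF v] by (intro mult_left_mono) auto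
  also have "\<dots> = 6 * int (n * card {S \<in> ind4_sets V A. v \<in> S}) + 6 * int n ^ 3"
    by (simp add: algebra_simps eval_nat_numeral)
  also have "int (n * card {S \<in> ind4_sets V A. v \<in> S}) \<le> int (4 * card (ind4_sets V A) + n ^ 3)"
    using ind4_vertex[OF v] by (simp only: of_nat_le_iff)
  finally show ?thesis by simp
qed

end

section \<open>Minimal graphs are blow-ups\<close>

text \<open>The triangle-free side of a blow-up: classes are independent, and consecutive labels
  mean completely joined classes. The cliques of the original graph are therefore unions of classes
  with labels at distance two.\<close>

definition blowup :: "'a set \<Rightarrow> ('a \<Rightarrow> ix) \<Rightarrow> 'a \<Rightarrow> 'a \<Rightarrow> bool" where
  "blowup V \<kappa> x y \<longleftrightarrow> x \<in> V \<and> y \<in> V \<and> (\<kappa> y = s1 (\<kappa> x) \<or> \<kappa> y = s4 (\<kappa> x))"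

lemma tf_graph_blowup: "finite V \<Longrightarrow> tf_graph V (blowup V \<kappa>)"
  by unfold_locales (auto simp: blowup_def)

text \<open>An independent set of the pentagon lies in the neighbourhood \<open>s1 i\<close>,
  \<open>s4 i\<close> of some vertex \<open>i\<close>.\<close>

lemma ix_no_two_consecutive:
  assumes "\<And>j. \<not> (P j \<and> P (s1 j))"
  obtains i where "\<not> P i" "\<not> P (s2 i)" "\<not> P (s3 i)"
proof -
  have "\<exists>i. \<not> P i \<and> \<not> P (s2 i) \<and> \<not> P (s3 i)"
    using assms[of I0] assms[of I1] assms[of I2] assms[of I3] assms[of I4]
    by (metis s1.simps shift_eval)
  then show ?thesis using that by blast
qed

section \<open>Classes around a fixed pentagon\<close>

context tf_graph
begin

lemma U_subset: "U v i \<subseteq> V"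
  by (auto simp: U_def)

lemma finite_U: "finite (U v i)"
  using finite_subset[OF U_subset fin] .

lemma U_nonadj:
  assumes "x \<in> U v i" "y \<in> U v i \<or> y \<in> U v (s2 i) \<or> y \<in> U v (s3 i)"
  shows "\<not> A x y"
  using assms no_common_nbr[of x "v (s1 i)" y] no_common_nbr[of x "v (s4 i)" y]
  by (auto simp: U_def)

lemma U_nbr:
  assumes v: "pent v" and w: "w \<in> U v j" "A w (v i)"
  shows "i = s1 j \<or> i = s4 j"
proof (cases rule: ix_shift_cases[of i j])
  case 1
  then show ?thesis
    using w pent_adj(1)[OF v, of j] no_common_nbr[of w "v (s1 j)" "v j"] by (auto simp: U_def)
next
  case 3
  then show ?thesis
    using w pent_adj(1)[OF v, of "s1 j"] tf[of w "v (s1 j)" "v (s2 j)"] by (auto simp: U_def)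
next
  case 4
  then show ?thesis
    using w pent_adj(3)[OF v, of "s4 j"] tf[of w "v (s4 j)" "v (s3 j)"] by (auto simp: U_def)
qed auto

lemma U_disjoint:
  assumes v: "pent v" and "i \<noteq> j"
  shows "U v i \<inter> U v j = {}"
proof (rule ccontr)
  assume "U v i \<inter> U v j \<noteq> {}"
  then obtain w where w: "w \<in> U v i" "w \<in> U v j" by blast
  then have "A w (v (s1 i))" "A w (v (s4 i))" by (auto simp: U_def)
  with U_nbr[OF v w(2)] have "s1 i = s1 j \<or> s1 i = s4 j" "s4 i = s1 j \<or> s4 i = s4 j" by blast+
  then show False using assms(2) by (cases i; cases j) auto
qed

text \<open>Neighbours of the same vertex are never adjacent. Hence, when gaps are rare, no vertex
  has many neighbours in two consecutive classes.\<close>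

lemma nbr_pair_gaps:
  "card {w \<in> U v j. A x w} * card {w \<in> U v (s1 j). A x w} \<le> card (gaps v j)"
proof -
  have "{w \<in> U v j. A x w} \<times> {w \<in> U v (s1 j). A x w} \<subseteq> gaps v j"
  proof clarify
    fix a b assume ab: "a \<in> U v j" "b \<in> U v (s1 j)" "A x a" "A x b"
    then have "\<not> A a b" using no_common_nbr[of a x b] sym by blast
    then show "(a, b) \<in> gaps v j" using ab by (simp add: gaps_def)
  qed
  moreover have "finite (gaps v j)"
    by (rule finite_subset[of _ "U v j \<times> U v (s1 j)"]) (auto simp: gaps_def finite_U)
  ultimately show ?thesis
    unfolding card_cartesian_product[symmetric] by (intro card_mono)
qed

text \<open>A neighbour of \<open>v i\<close> that lies in some class lies in one of the two
  adjacent ones. This converts the degrees of the pentagon into class sizes.\<close>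

lemma deg_pent:
  assumes v: "pent v"
  shows "card (U v (s1 i)) + card (U v (s4 i)) \<le> deg (v i)"
    and "deg (v i) \<le> card (U v (s1 i)) + card (U v (s4 i)) + card (off v)"
proof -
  have un: "card (U v (s1 i) \<union> U v (s4 i)) = card (U v (s1 i)) + card (U v (s4 i))"
    using U_disjoint[OF v, of "s1 i" "s4 i"] by (intro card_Un_disjoint) (auto simp: finite_U)
  have "U v (s1 i) \<union> U v (s4 i) \<subseteq> {y \<in> V. A (v i) y}"
    using sym by (auto simp: U_def)
  then have "card (U v (s1 i) \<union> U v (s4 i)) \<le> deg (v i)"
    unfolding deg_def by (rule card_mono[rotated]) (use fin in simp)
  with un show "card (U v (s1 i)) + card (U v (s4 i)) \<le> deg (v i)" by simp
  have "{y \<in> V. A (v i) y} \<subseteq> (U v (s1 i) \<union> U v (s4 i)) \<union> off v"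
  proof
    fix y assume y: "y \<in> {y \<in> V. A (v i) y}"
    then have "A y (v i)" using sym by blast
    with U_nbr[OF v, of y _ i] have "y \<in> U v j \<Longrightarrow> j = s1 i \<or> j = s4 i" for j
      by fastforce
    then show "y \<in> (U v (s1 i) \<union> U v (s4 i)) \<union> off v" using y by (auto simp: off_def)
  qed
  then have "deg (v i) \<le> card ((U v (s1 i) \<union> U v (s4 i)) \<union> off v)"
    unfolding deg_def using fin by (intro card_mono) (auto simp: finite_U off_def)
  also have "\<dots> \<le> card (U v (s1 i) \<union> U v (s4 i)) + card (off v)" by (rule card_Un_le)
  finally show "deg (v i) \<le> card (U v (s1 i)) + card (U v (s4 i)) + card (off v)" using un by simp
qed

text \<open>Non-neighbours of \<open>x\<close> in two classes at distance two span no edge. The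
  cubes count triples in the classes \<open>i\<close>, \<open>s2 i\<close> and in \<open>i\<close>,
  \<open>s3 i\<close>, whose common part lies in class \<open>i\<close>. The last two terms use only
  triples starting in \<open>s4 i\<close> or \<open>s1 i\<close>: they are linear in the
  non-neighbours there, which is the quantity that \<open>cls_exists\<close> has to bound.\<close>

lemma ind_triples_U_lower:
  fixes x :: 'a and v :: "ix \<Rightarrow> 'a"
  defines "M \<equiv> \<lambda>j. card {w \<in> U v j. \<not> A x w}"
  assumes v: "pent v"
  shows "ind_triples x \<ge> (int (M i) + int (M (s2 i))) ^ 3 + (int (M i) + int (M (s3 i))) ^ 3 - int (M i) ^ 3
    + int (M (s4 i)) * int (M (s2 i)) ^ 2 + int (M (s1 i)) * int (M (s3 i)) ^ 2"
proof -
  define R where "R j = {w \<in> U v j. \<not> A x w}" for j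
  have finR: "finite (R j)" for j using finite_U by (auto simp: R_def)
  have cR: "card (R j) = M j" for j by (simp add: R_def M_def)
  have disj: "R j \<inter> R k = {}" if "j \<noteq> k" for j k using U_disjoint[OF v that] by (auto simp: R_def)
  have RV: "R j \<subseteq> V" for j using U_subset by (auto simp: R_def)
  have non: "\<not> A a b" if "a \<in> R j" "b \<in> R j \<or> b \<in> R (s2 j) \<or> b \<in> R (s3 j)" for a b j
    using U_nonadj[of a v j b] that by (auto simp: R_def)
  have nonx: "\<not> A x a" if "a \<in> R j" for a j using that by (simp add: R_def)
  define P where "P = R i \<union> R (s2 i)"
  define Q where "Q = R i \<union> R (s3 i)"
  have PP: "\<not> A a b" if "a \<in> P" "b \<in> P" for a b
    using that non[of a i b] non[of a "s2 i" b] by (auto simp: P_def)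
  have QQ: "\<not> A a b" if "a \<in> Q" "b \<in> Q" for a b
    using that non[of a i b] non[of a "s3 i" b] by (auto simp: Q_def)
  have finPQ: "finite P" "finite Q" using finR by (auto simp: P_def Q_def)
  have cP: "card P = M i + M (s2 i)" "card Q = M i + M (s3 i)"
    unfolding P_def Q_def using finR disj by (simp_all add: card_Un_disjoint cR)
  have PQ: "P \<inter> Q = R i" using disj[of "s2 i" i] disj[of "s2 i" "s3 i"] disj[of i "s3 i"]
    by (auto simp: P_def Q_def)
  define T where "T = {(a, b, c) \<in> V \<times> V \<times> V. ind4 A x a b c}"
  have finT: "finite T" unfolding T_def
    by (rule finite_subset[of _ "V \<times> V \<times> V"]) (use fin in auto)
  have "ind_triples x = (\<Sum>(a, b, c)\<in>V \<times> V \<times> V. of_bool (ind4 A x a b c))"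
    by (simp add: ind_triples_def sum.cartesian_product)
  also have "\<dots> = int (card T)"
    unfolding T_def
    using fin by (simp add: of_bool_def split_def sum.If_cases Int_def mem_Times_iff)
  finally have T: "ind_triples x = int (card T)" .
  let ?X = "P \<times> P \<times> P \<union> Q \<times> Q \<times> Q"
  let ?Y = "R (s4 i) \<times> R (s2 i) \<times> R (s2 i)"
  let ?Z = "R (s1 i) \<times> R (s3 i) \<times> R (s3 i)"
  have "?X \<union> ?Y \<union> ?Z \<subseteq> T"
  proof -
    have "P \<times> P \<times> P \<subseteq> T"
      using PP nonx RV unfolding T_def ind4_def P_def by (auto; blast)
    moreover have "Q \<times> Q \<times> Q \<subseteq> T"
      using QQ nonx RV unfolding T_def ind4_def Q_def by (auto; blast)
    moreover have "?Y \<subseteq> T"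
      using non[of _ "s4 i"] non[of _ "s2 i"] nonx RV unfolding T_def ind4_def by (auto; blast)
    moreover have "?Z \<subseteq> T"
      using non[of _ "s1 i"] non[of _ "s3 i"] nonx RV unfolding T_def ind4_def by (auto; blast)
    ultimately show ?thesis by blast
  qed
  then have "card (?X \<union> ?Y \<union> ?Z) \<le> card T" by (rule card_mono[OF finT])
  moreover have "card (?X \<union> ?Y \<union> ?Z) = card ?X + card ?Y + card ?Z"
  proof -
    have "(?X \<union> ?Y) \<inter> ?Z = {}" "?X \<inter> ?Y = {}"
      using disj[of "s1 i" i] disj[of "s1 i" "s2 i"] disj[of "s1 i" "s3 i"] disj[of "s1 i" "s4 i"]
        disj[of "s4 i" i] disj[of "s4 i" "s2 i"] disj[of "s4 i" "s3 i"]
      by (auto simp: P_def Q_def)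
    then show ?thesis using finPQ finR by (simp add: card_Un_disjoint)
  qed
  moreover have "card ?X + card (R i) ^ 3 = card P ^ 3 + card Q ^ 3"
  proof -
    have "(P \<times> P \<times> P) \<inter> (Q \<times> Q \<times> Q) = R i \<times> R i \<times> R i"
      using PQ by blast
    then show ?thesis
      using card_Un_Int[of "P \<times> P \<times> P" "Q \<times> Q \<times> Q"] finPQ
      by (simp add: card_cartesian_product power3_eq_cube)
  qed
  moreover have "card ?Y = M (s4 i) * M (s2 i) ^ 2" "card ?Z = M (s1 i) * M (s3 i) ^ 2"
    by (simp_all add: card_cartesian_product cR power2_eq_square)
  ultimately have "(M i + M (s2 i)) ^ 3 + (M i + M (s3 i)) ^ 3 + M (s4 i) * M (s2 i) ^ 2 + M (s1 i) * M (s3 i) ^ 2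
      \<le> card T + M i ^ 3"
    by (simp add: cP cR)
  then have "int ((M i + M (s2 i)) ^ 3 + (M i + M (s3 i)) ^ 3 + M (s4 i) * M (s2 i) ^ 2 + M (s1 i) * M (s3 i) ^ 2)
      \<le> int (card T + M i ^ 3)"
    by (simp only: of_nat_le_iff)
  then show ?thesis unfolding T by simp
qed

end

text \<open>What a good pentagon and minimality provide, expressed with one constant. The bound on
  \<open>gaps\<close> is a square because it is compared with a product of two neighbourhood
  sizes.\<close>

locale near_blowup = tf_graph +
  fixes v :: "ix \<Rightarrow> 'a" and \<delta> :: real
  assumes pent: "pent v"
    and \<delta>: "\<delta> = 1 / 100000"
    and large: "card V > 1000"
    and off_le: "real (card (off v)) \<le> \<delta> * real (card V)"
    and gaps_le: "real (card (gaps v i)) \<le> (\<delta> * real (card V))\<^sup>2"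
    and deg_dev: "\<bar>5 * real (deg (v i)) - 2 * real (card V)\<bar> \<le> \<delta> * real (card V)"
    and triples: "x \<in> V \<Longrightarrow> real_of_int (ind_triples x) \<le> (3 / 25 + \<delta>) * real (card V) ^ 3"
begin

definition miss :: "'a \<Rightarrow> ix \<Rightarrow> nat" where
  "miss x j = card {w \<in> U v j. \<not> A x w}"

text \<open>Membership by a threshold instead of by \<open>U\<close>: it also applies to the
  vertices of \<open>off\<close>, and it tolerates a few missing edges. The value 1/100 is small
  against the class size 1/5 and large against \<open>\<delta>\<close>.\<close>

definition cls :: "'a \<Rightarrow> ix \<Rightarrow> bool" where
  "cls x i \<longleftrightarrow> real (miss x (s1 i)) \<le> real n / 100 \<and> real (miss x (s4 i)) \<le> real n / 100"

text \<open>The degrees give the sums of sizes over pairs of classes at distance two. These pairs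
  form a 5-cycle; as 5 is odd, the alternating sum around it, starting and ending with the two pairs
  containing \<open>i\<close>, is twice the size of class \<open>i\<close>. The errors add up to 4
  \<open>\<delta>\<close> n.\<close>

lemma card_U_ge: "real (card (U v i)) \<ge> (1 / 5 - 2 * \<delta>) * real n"
proof -
  note * = deg_pent[OF pent, of i] deg_pent[OF pent, of "s1 i"] deg_pent[OF pent, of "s2 i"]
    deg_pent[OF pent, of "s3 i"] deg_pent[OF pent, of "s4 i"]
  note * = *[folded of_nat_le_iff[where 'a = real], unfolded of_nat_add shift_simps]
  show ?thesis
    using * off_le abs_le_D1[OF deg_dev[of i]] abs_le_D2[OF deg_dev[of i]]
      abs_le_D1[OF deg_dev[of "s1 i"]] abs_le_D2[OF deg_dev[of "s1 i"]]
      abs_le_D1[OF deg_dev[of "s2 i"]] abs_le_D2[OF deg_dev[of "s2 i"]]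
      abs_le_D1[OF deg_dev[of "s3 i"]] abs_le_D2[OF deg_dev[of "s3 i"]]
      abs_le_D1[OF deg_dev[of "s4 i"]] abs_le_D2[OF deg_dev[of "s4 i"]]
    unfolding \<delta> by argo
qed

lemma nbr_miss: "real (card {w \<in> U v j. A x w}) = real (card (U v j)) - real (miss x j)"
proof -
  have "card (U v j) = card {w \<in> U v j. A x w} + card {w \<in> U v j. \<not> A x w}"
    by (subst card_Un_disjoint[symmetric]) (auto simp: finite_U intro!: arg_cong[where f = card])
  then show ?thesis by (simp add: miss_def)
qed

text \<open>By \<open>nbr_pair_gaps\<close>, no two consecutive classes both contain more than
  \<open>\<delta>\<close> n neighbours of \<open>x\<close>, so \<open>x\<close> misses almost all of
  three classes \<open>i\<close>, \<open>s2 i\<close>, \<open>s3 i\<close>. These alone account for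
  nearly all independent triples that minimality allows at \<open>x\<close>, which bounds the misses
  in the other two.\<close>

lemma cls_exists:
  assumes x: "x \<in> V"
  shows "\<exists>i. cls x i"
proof -
  define N where "N = real n"
  have N: "N > 0" using large by (simp add: N_def)
  have dN: "\<delta> * N > 0" using N by (simp add: \<delta>)
  let ?P = "\<lambda>j. real (card {w \<in> U v j. A x w}) > \<delta> * N"
  have "\<not> (?P j \<and> ?P (s1 j))" for j
  proof
    assume "?P j \<and> ?P (s1 j)"
    then have "(\<delta> * N) * (\<delta> * N) < real (card {w \<in> U v j. A x w}) * real (card {w \<in> U v (s1 j). A x w})"
      using dN by (intro mult_strict_mono) auto
    also have "\<dots> \<le> real (card (gaps v j))"
      using nbr_pair_gaps[of v j x] by (simp flip: of_nat_mult)
    also have "\<dots> \<le> (\<delta> * N)\<^sup>2" using gaps_le by (simp add: N_def)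
    finally show False by (simp add: power2_eq_square)
  qed
  then obtain i where "\<not> ?P i" "\<not> ?P (s2 i)" "\<not> ?P (s3 i)"
    by (rule ix_no_two_consecutive)
  then have m: "real (miss x j) \<ge> (1 / 5 - 3 * \<delta>) * N" if "j = i \<or> j = s2 i \<or> j = s3 i" for j
    using nbr_miss[of j x] card_U_ge[of j] that by (auto simp: N_def algebra_simps)
  define m where "m = (1 / 5 - 3 * \<delta>) * N"
  define b c d s t where "b = real (miss x i)" and "c = real (miss x (s2 i))" and "d = real (miss x (s3 i))"
    and "s = real (miss x (s4 i))" and "t = real (miss x (s1 i))"
  have mp: "m > 0" using N by (simp add: m_def \<delta>)
  have ge: "b \<ge> m" "c \<ge> m" "d \<ge> m" "s \<ge> 0" "t \<ge> 0"
    using m by (simp_all add: m_def b_def c_def d_def s_def t_def)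
  have "real_of_int ((int (miss x i) + int (miss x (s2 i))) ^ 3 + (int (miss x i) + int (miss x (s3 i))) ^ 3
      - int (miss x i) ^ 3 + int (miss x (s4 i)) * int (miss x (s2 i)) ^ 2 + int (miss x (s1 i)) * int (miss x (s3 i)) ^ 2)
      \<le> real_of_int (ind_triples x)"
    using ind_triples_U_lower[OF pent, where x = x and i = i] unfolding of_int_le_iff miss_def .
  then have "(b + c) ^ 3 + (b + d) ^ 3 - b ^ 3 + s * c\<^sup>2 + t * d\<^sup>2 \<le> real_of_int (ind_triples x)"
    by (simp add: b_def c_def d_def s_def t_def)
  also have "\<dots> \<le> (3 / 25 + \<delta>) * N ^ 3" using triples[OF x] by (simp add: N_def)
  finally have up: "(b + c) ^ 3 + (b + d) ^ 3 - b ^ 3 + s * c\<^sup>2 + t * d\<^sup>2 \<le> (3 / 25 + \<delta>) * N ^ 3" .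
  \<comment> \<open>The cubes contribute 8 + 7 = 15 times \<open>m ^ 3\<close>, and 15 (1/5)^3 =
    3/25 is exactly the leading term of the upper bound.\<close>
  have "(m + m) ^ 3 \<le> (b + c) ^ 3" using ge mp by (intro power_mono) auto
  moreover have "m * m * m \<le> d * d * d" "m * m * m \<le> d * d * b" "m * m * m \<le> d * b * b"
    using ge mp by (intro mult_mono; simp)+
  then have "7 * m ^ 3 \<le> (b + d) ^ 3 - b ^ 3"
    by (simp add: power3_eq_cube algebra_simps)
  moreover have "s * m\<^sup>2 \<le> s * c\<^sup>2" "t * m\<^sup>2 \<le> t * d\<^sup>2"
    using ge mp by (intro mult_left_mono power_mono; simp)+
  ultimately have "(s + t) * m\<^sup>2 \<le> (3 / 25 + \<delta>) * N ^ 3 - 15 * m ^ 3"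
    using up by (simp add: power3_eq_cube algebra_simps)
  also have "\<dots> \<le> (N / 100) * m\<^sup>2"
    using N by (simp add: m_def \<delta> power_mult_distrib power2_eq_square power3_eq_cube)
  finally have "s + t \<le> N / 100" using mp by simp
  then show ?thesis using ge unfolding cls_def N_def s_def t_def by (intro exI[of _ i]) simp
qed

lemma miss_common:
  assumes "real (miss x j) \<le> real n / 100" "real (miss y j) \<le> real n / 100"
  shows "\<not> A x y"
proof -
  have "\<exists>w. A x w \<and> A y w"
  proof (rule ccontr)
    assume "\<not> ?thesis"
    then have "U v j \<subseteq> {w \<in> U v j. \<not> A x w} \<union> {w \<in> U v j. \<not> A y w}" by blast
    then have "card (U v j) \<le> card ({w \<in> U v j. \<not> A x w} \<union> {w \<in> U v j. \<not> A y w})"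
      by (intro card_mono) (auto simp: finite_U)
    also have "\<dots> \<le> miss x j + miss y j"
      unfolding miss_def by (rule card_Un_le)
    finally have "real (card (U v j)) \<le> real (miss x j) + real (miss y j)" by linarith
    then show False using assms card_U_ge[of j] large unfolding \<delta> by simp
  qed
  then show ?thesis using no_common_nbr by blast
qed

lemma miss_consecutive:
  assumes "real (miss x j) \<le> real n / 100" "real (miss x (s1 j)) \<le> real n / 100"
  shows False
proof -
  define N where "N = real n"
  have N: "N > 0" using large by (simp add: N_def)
  have "(1 / 10 * N) * (1 / 10 * N) \<le> real (card {w \<in> U v j. A x w}) * real (card {w \<in> U v (s1 j). A x w})"
    using assms card_U_ge[of j] card_U_ge[of "s1 j"] N unfolding nbr_miss \<delta> N_def
    by (intro mult_mono) auto
  also have "\<dots> \<le> real (card (gaps v j))"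
    using nbr_pair_gaps[of v j x] by (simp flip: of_nat_mult)
  also have "\<dots> \<le> (\<delta> * N)\<^sup>2" using gaps_le by (simp add: N_def)
  finally show False using N unfolding \<delta> by (simp add: power2_eq_square)
qed

text \<open>For distinct \<open>i\<close> and \<open>j\<close> the neighbouring labels of
  \<open>i\<close> and of \<open>j\<close> include two consecutive ones, so \<open>x\<close> would
  have many neighbours in two consecutive classes.\<close>

lemma cls_unique:
  assumes "cls x i" "cls x j"
  shows "i = j"
  using ix_shift_cases[of j i]
proof cases
  case 2
  then show ?thesis using assms miss_consecutive[of x i] by (simp add: cls_def)
next
  case 3
  then show ?thesis using assms miss_consecutive[of x "s3 i"] by (simp add: cls_def)
next
  case 4
  then show ?thesis using assms miss_consecutive[of x "s1 i"] by (simp add: cls_def)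
next
  case 5
  then show ?thesis using assms miss_consecutive[of x "s3 i"] by (simp add: cls_def)
qed simp

lemma cls_nonadj:
  assumes "cls x i" "cls y j" "j = i \<or> j = s2 i \<or> j = s3 i"
  shows "\<not> A x y"
  using assms miss_common[of x "s1 i" y] miss_common[of x "s4 i" y] by (auto simp: cls_def)

lemma cls_pent: "cls (v i) i"
proof -
  have "{w \<in> U v (s1 i). \<not> A (v i) w} = {}" "{w \<in> U v (s4 i). \<not> A (v i) w} = {}"
    using sym by (auto simp: U_def)
  then have "miss (v i) (s1 i) = 0" "miss (v i) (s4 i) = 0"
    unfolding miss_def by (simp_all only: card.empty)
  then show ?thesis by (simp add: cls_def)
qed

lemma cls_U:
  assumes w: "w \<in> U v k"
  shows "cls w k"
proof -
  obtain i where i: "cls w i" using cls_exists w U_subset by blast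
  have adj: "A w (v (s1 k))" "A w (v (s4 k))" using w by (auto simp: U_def)
  have "i = k"
    using ix_shift_cases[of i k]
  proof cases
    case 2
    then show ?thesis using cls_nonadj[OF i cls_pent[of "s1 k"]] adj by simp
  next
    case 3
    then show ?thesis using cls_nonadj[OF i cls_pent[of "s4 k"]] adj by simp
  next
    case 4
    then show ?thesis using cls_nonadj[OF i cls_pent[of "s1 k"]] adj by simp
  next
    case 5
    then show ?thesis using cls_nonadj[OF i cls_pent[of "s4 k"]] adj by simp
  qed simp
  then show ?thesis using i by simp
qed

definition part :: "'a \<Rightarrow> ix" where
  "part x = (SOME i. cls x i)"

lemma cls_part: "x \<in> V \<Longrightarrow> cls x (part x)"
  unfolding part_def using cls_exists by (rule someI_ex)

lemma card_part: "real (card {x \<in> V. part x = k}) \<ge> (1 / 5 - 2 * \<delta>) * real n"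
proof -
  have "U v k \<subseteq> {x \<in> V. part x = k}"
    using cls_U cls_part cls_unique U_subset by blast
  then have "card (U v k) \<le> card {x \<in> V. part x = k}"
    using fin by (intro card_mono) auto
  then show ?thesis using card_U_ge[of k] by linarith
qed

lemma adj_blowup:
  assumes "A x y"
  shows "blowup V part x y"
proof -
  have V: "x \<in> V" "y \<in> V" using assms sub sym by blast+
  then show ?thesis
    using cls_nonadj[OF cls_part[OF V(1)] cls_part[OF V(2)]] assms ix_shift_cases[of "part y" "part x"]
    by (auto simp: blowup_def)
qed

lemma part_two:
  obtains z z' where "z \<in> V" "z' \<in> V" "part z = k" "part z' = k" "z \<noteq> z'"
proof -
  have "real (card {x \<in> V. part x = k}) > 1"
    using card_part[of k] large unfolding \<delta> by simp
  then have "\<not> card {x \<in> V. part x = k} \<le> 1" by simp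
  then show ?thesis using that card_le_Suc0_iff_eq[of "{x \<in> V. part x = k}"] fin by auto
qed

text \<open>Passing to the full blow-up only destroys independent sets. If an edge
  \<open>x y\<close> is missing, two vertices of the class opposite to it complete \<open>x\<close>,
  \<open>y\<close> to an independent 4-set that the blow-up does not have, so the blow-up would have
  strictly fewer.\<close>

lemma min_eq_blowup:
  assumes min: "card (ind4_sets V A) \<le> card (ind4_sets V (blowup V part))"
  shows "A = blowup V part"
proof (rule ccontr)
  assume "A \<noteq> blowup V part"
  then obtain x y where xy: "blowup V part x y" "\<not> A x y"
    using adj_blowup by blast
  have sub': "ind4_sets V (blowup V part) \<subseteq> ind4_sets V A"
    using adj_blowup unfolding ind4_sets_def by blast
  with min have eq: "ind4_sets V (blowup V part) = ind4_sets V A"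
    using finite_ind4_sets[OF fin] by (intro card_seteq)
  have V: "x \<in> V" "y \<in> V" using xy by (auto simp: blowup_def)
  obtain k where k: "k = s2 (part x) \<or> k = s3 (part x)" "k = s2 (part y) \<or> k = s3 (part y)"
    using xy by (cases "part y = s1 (part x)") (fastforce simp: blowup_def)+
  obtain z z' where z: "z \<in> V" "z' \<in> V" "part z = k" "part z' = k" "z \<noteq> z'"
    by (rule part_two)
  have non: "\<not> A a b" if "a \<in> V" "b \<in> V" "part b = part a \<or> part b = s2 (part a) \<or> part b = s3 (part a)" for a b
    using that cls_nonadj[OF cls_part cls_part] by blast
  have non': "\<not> A a b" if "a \<in> V" "b \<in> V" "part b = k" "k = s2 (part a) \<or> k = s3 (part a)" for a b
    using that by (intro non) auto
  have "\<not> A x z" "\<not> A x z'" "\<not> A y z" "\<not> A y z'" "\<not> A z z'"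
    using non'[OF V(1) z(1,3) k(1)] non'[OF V(1) z(2,4) k(1)] non'[OF V(2) z(1,3) k(2)]
      non'[OF V(2) z(2,4) k(2)] non[OF z(1,2)] z(3,4) by simp_all
  moreover from this xy(2) have "\<not> A z x" "\<not> A z' x" "\<not> A z y" "\<not> A z' y" "\<not> A z' z" "\<not> A y x"
    using sym by blast+
  moreover have "part x \<noteq> k" "part y \<noteq> k" "part x \<noteq> part y"
    using k xy(1) unfolding blowup_def by (metis shift_neq(1-4))+
  then have "x \<noteq> z" "x \<noteq> z'" "y \<noteq> z" "y \<noteq> z'" "x \<noteq> y"
    using z(3,4) by blast+
  then have "card {x, y, z, z'} = 4" using z(5) by simp
  ultimately have "{x, y, z, z'} \<in> ind4_sets V A"
    using V z(1,2) xy(2) unfolding ind4_sets_def by (simp add: irrefl)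
  moreover have "{x, y, z, z'} \<notin> ind4_sets V (blowup V part)"
    using xy by (auto simp: ind4_sets_def)
  ultimately show False using eq by blast
qed

end

text \<open>The lower bound on n is what makes the defect 816000 (c + 12) n of
  \<open>good_pentagon\<close> at most \<open>(\<delta> * n)\<^sup>2\<close>. The summand 12 covers
  the error terms of \<open>ind_tuples_le\<close> and \<open>ind_triples_min\<close>.\<close>

theorem (in tf_min) min_is_blowup:
  fixes c :: real
  assumes I: "24 * real (card (ind4_sets V A)) \<le> 3 / 25 * real n ^ 4 + c * real n ^ 3"
    and c: "c \<ge> 0" and n: "real n \<ge> 816000 * 100000 ^ 2 * (c + 12)"
  obtains \<kappa> where "A = blowup V \<kappa>"
    and "\<And>k. real (card {x \<in> V. \<kappa> x = k}) \<ge> (1 / 5 - 2 / 100000) * real n"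
proof -
  define N where "N = real n"
  define \<delta> :: real where "\<delta> = 1 / 100000"
  have N: "N > 0" "N \<ge> 816000 * 100000 ^ 2 * (c + 12)" using n c by (simp_all add: N_def)
  have "real_of_int ind_tuples \<le> real_of_int (24 * int (card (ind4_sets V A)) + 6 * int n ^ 3)"
    using ind_tuples_le by (simp only: of_int_le_iff)
  also have "\<dots> \<le> 3 / 25 * N ^ 4 + (c + 6) * N ^ 3"
    using I by (simp add: N_def algebra_simps)
  also have "\<dots> \<le> 3 / 25 * N ^ 4 + (c + 12) * N ^ 3"
    using N by simp
  finally have T: "real_of_int ind_tuples \<le> 3 / 25 * real n ^ 4 + (c + 12) * real n ^ 3"
    by (simp add: N_def)
  obtain v where v: "pent v" and Z: "real n * card (off v) + (\<Sum>i\<in>UNIV. real (card (gaps v i)))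
      + (\<Sum>i\<in>UNIV. (5 * real (deg (v i)) - 2 * real n)\<^sup>2) \<le> 816000 * (c + 12) * real n"
    using good_pentagon[OF T] c n by auto
  have b: "816000 * (c + 12) \<le> \<delta>\<^sup>2 * N" using N by (simp add: \<delta>_def field_simps)
  have "816000 * (c + 12) * real n \<le> (\<delta>\<^sup>2 * N) * N"
    unfolding N_def[symmetric] using b N by (intro mult_right_mono) auto
  then have Z': "N * card (off v) + (\<Sum>i\<in>UNIV. real (card (gaps v i)))
      + (\<Sum>i\<in>UNIV. (5 * real (deg (v i)) - 2 * N)\<^sup>2) \<le> (\<delta> * N)\<^sup>2"
    using Z by (simp add: N_def power2_eq_square algebra_simps)
  have nonneg: "N * card (off v) \<ge> 0" "(\<Sum>i\<in>UNIV. real (card (gaps v i))) \<ge> 0"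
      "(\<Sum>i\<in>UNIV. (5 * real (deg (v i)) - 2 * N)\<^sup>2) \<ge> 0"
    using N by (auto intro: sum_nonneg)
  interpret near_blowup V A v \<delta>
  proof
    show "pent v" by (rule v)
    show "\<delta> = 1 / 100000" by (rule \<delta>_def)
    have "N > 1000" using N(2) c by simp
    then show "card V > 1000" by (simp add: N_def)
    have "N * card (off v) \<le> N * (\<delta> * N)"
    proof -
      have "\<delta> * (\<delta> * (N * N)) \<le> 1 * (\<delta> * (N * N))"
        using N by (intro mult_right_mono) (simp_all add: \<delta>_def)
      then show ?thesis using Z' nonneg by (simp add: power2_eq_square algebra_simps)
    qed
    then show "real (card (off v)) \<le> \<delta> * real (card V)"
      using N by (simp add: N_def)
    fix i
    have "real (card (gaps v i)) \<le> (\<Sum>i\<in>UNIV. real (card (gaps v i)))"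
      by (rule member_le_sum) auto
    then show "real (card (gaps v i)) \<le> (\<delta> * real (card V))\<^sup>2"
      unfolding N_def[symmetric] using Z' nonneg by linarith
    have "(5 * real (deg (v i)) - 2 * N)\<^sup>2 \<le> (\<Sum>i\<in>UNIV. (5 * real (deg (v i)) - 2 * N)\<^sup>2)"
      by (rule member_le_sum) auto
    then have "(5 * real (deg (v i)) - 2 * N)\<^sup>2 \<le> (\<delta> * N)\<^sup>2"
      using Z' nonneg by linarith
    then have "\<bar>5 * real (deg (v i)) - 2 * N\<bar> \<le> \<bar>\<delta> * N\<bar>"
      by (simp only: abs_le_square_iff)
    then show "\<bar>5 * real (deg (v i)) - 2 * real (card V)\<bar> \<le> \<delta> * real (card V)"
      using N by (simp add: N_def \<delta>_def)
  next
    fix x assume x: "x \<in> V"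
    have "real_of_int (int n * ind_triples x) \<le> real_of_int (24 * int (card (ind4_sets V A)) + 12 * int n ^ 3)"
      using ind_triples_min[OF x] by (simp only: of_int_le_iff)
    then have "N * real_of_int (ind_triples x) \<le> 24 * real (card (ind4_sets V A)) + 12 * N ^ 3"
      by (simp add: N_def)
    also have "\<dots> \<le> 3 / 25 * N ^ 4 + (c + 12) * N ^ 3"
      using I by (simp add: N_def algebra_simps)
    also have "(c + 12) * N ^ 3 \<le> (\<delta> * N) * N ^ 3"
      using N c by (intro mult_right_mono) (simp_all add: \<delta>_def)
    finally have "N * real_of_int (ind_triples x) \<le> N * ((3 / 25 + \<delta>) * N ^ 3)"
      by (simp add: algebra_simps eval_nat_numeral)
    then show "real_of_int (ind_triples x) \<le> (3 / 25 + \<delta>) * real (card V) ^ 3"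
      using N by (simp add: N_def)
  qed
  show ?thesis
  proof (rule that)
    show "A = blowup V part"
      by (rule min_eq_blowup) (rule min[OF tf_graph_blowup[OF fin]])
    show "real (card {x \<in> V. part x = k}) \<ge> (1 / 5 - 2 / 100000) * real n" for k
      using card_part[of k] by (simp add: \<delta>_def)
  qed
qed

section \<open>Independent 4-sets in a blow-up\<close>

definition fall4 :: "real \<Rightarrow> real" where
  "fall4 m = m * (m - 1) * (m - 2) * (m - 3)"

text \<open>Consecutive arguments are sizes of non-adjacent classes, that is, of labels at distance
  two. Each class lies in two of the five unions, hence is subtracted once.\<close>

definition blow_poly :: "real \<Rightarrow> real \<Rightarrow> real \<Rightarrow> real \<Rightarrow> real \<Rightarrow> real" where
  "blow_poly a b c d e = fall4 (a + b) + fall4 (b + c) + fall4 (c + d) + fall4 (d + e) + fall4 (e + a)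
     - (fall4 a + fall4 b + fall4 c + fall4 d + fall4 e)"

text \<open>Equal to 4 times the sum of the squares of neighbouring sums minus the sum of squares,
  the second-order part of \<open>blow_poly\<close> at five equal sizes q divided by 6 q^2, up to
  terms of lower order in q. Rings are kept general since integers and reals are both
  needed.\<close>

definition quad :: "'a::comm_ring_1 \<Rightarrow> 'a \<Rightarrow> 'a \<Rightarrow> 'a \<Rightarrow> 'a \<Rightarrow> 'a" where
  "quad a b c d e = 7 * (a\<^sup>2 + b\<^sup>2 + c\<^sup>2 + d\<^sup>2 + e\<^sup>2) + 8 * (a * b + b * c + c * d + d * e + e * a)"

lemma choose4_fall4: "24 * real (m choose 4) = fall4 (real m)"
  by (simp add: binomial_gbinomial gbinomial_prod_rev fall4_def eval_nat_numeral fact_numeral)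

lemma card_ind4_blowup:
  assumes "finite V"
  shows "24 * real (card (ind4_sets V (blowup V \<kappa>))) =
    blow_poly (real (card {x \<in> V. \<kappa> x = I0})) (real (card {x \<in> V. \<kappa> x = I2})) (real (card {x \<in> V. \<kappa> x = I4}))
      (real (card {x \<in> V. \<kappa> x = I1})) (real (card {x \<in> V. \<kappa> x = I3}))"
proof -
  define P where "P k = {x \<in> V. \<kappa> x = k}" for k
  \<comment> \<open>An independent set meeting two classes lies in exactly one union of two classes;
    removing the sets inside the second class assigns a set inside a single class to that class
    only, so the families partition all independent 4-sets.\<close>
  define X where "X k = {S. S \<subseteq> P k \<union> P (s2 k) \<and> card S = 4} - {S. S \<subseteq> P (s2 k) \<and> card S = 4}" for k
  have finP: "finite (P k)" for k using assms by (simp add: P_def)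
  have "ind4_sets V (blowup V \<kappa>) = (\<Union>k\<in>UNIV. X k)"
  proof (intro equalityI subsetI)
    fix S assume S: "S \<in> ind4_sets V (blowup V \<kappa>)"
    then have SV: "S \<subseteq> V" "card S = 4" by (auto simp: ind4_sets_def)
    have rel: "\<kappa> y = \<kappa> x \<or> \<kappa> y = s2 (\<kappa> x) \<or> \<kappa> y = s3 (\<kappa> x)" if "x \<in> S" "y \<in> S" for x y
    proof -
      have "\<not> blowup V \<kappa> x y" using S that unfolding ind4_sets_def by blast
      moreover have "x \<in> V" "y \<in> V" using SV(1) that by blast+
      ultimately have "\<kappa> y \<noteq> s1 (\<kappa> x)" "\<kappa> y \<noteq> s4 (\<kappa> x)" unfolding blowup_def by blast+
      then show ?thesis by (cases rule: ix_shift_cases[of "\<kappa> y" "\<kappa> x"]) blast+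
    qed
    obtain x where x: "x \<in> S" using SV(2) by fastforce
    show "S \<in> (\<Union>k\<in>UNIV. X k)"
    proof (cases "\<exists>y\<in>S. \<kappa> y = s3 (\<kappa> x)")
      case True
      then obtain y where y: "y \<in> S" "\<kappa> y = s3 (\<kappa> x)" by blast
      have "\<kappa> z = \<kappa> y \<or> \<kappa> z = \<kappa> x" if "z \<in> S" for z
        using rel[OF x that] rel[OF y(1) that, unfolded y(2) shift_simps] y(2) by (metis shift_neq(5))
      moreover have "s2 (\<kappa> y) = \<kappa> x" using y(2) by simp
      ultimately have "z \<in> P (\<kappa> y) \<union> P (s2 (\<kappa> y))" if "z \<in> S" for z
        using SV(1) that by (auto simp: P_def)
      then have "S \<subseteq> P (\<kappa> y) \<union> P (s2 (\<kappa> y))" by blast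
      moreover have "y \<notin> P (s2 (\<kappa> y))" by (simp add: P_def)
      ultimately have "S \<in> X (\<kappa> y)" using SV(2) y(1) unfolding X_def by blast
      then show ?thesis by blast
    next
      case False
      then have "S \<subseteq> P (\<kappa> x) \<union> P (s2 (\<kappa> x))"
        using SV(1) rel[OF x] unfolding P_def by blast
      moreover have "x \<notin> P (s2 (\<kappa> x))" by (simp add: P_def)
      ultimately have "S \<in> X (\<kappa> x)" using SV(2) x unfolding X_def by blast
      then show ?thesis by blast
    qed
  next
    fix S assume "S \<in> (\<Union>k\<in>UNIV. X k)"
    then obtain k where k: "S \<subseteq> P k \<union> P (s2 k)" "card S = 4" unfolding X_def by blast
    have "\<not> blowup V \<kappa> x y" if "x \<in> S" "y \<in> S" for x y
    proof -
      have "\<kappa> x = k \<or> \<kappa> x = s2 k" "\<kappa> y = k \<or> \<kappa> y = s2 k"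
        using k(1) that unfolding P_def by blast+
      then show ?thesis unfolding blowup_def by (elim disjE) simp_all
    qed
    moreover have "S \<subseteq> V" using k(1) unfolding P_def by blast
    ultimately show "S \<in> ind4_sets V (blowup V \<kappa>)"
      using k(2) unfolding ind4_sets_def by blast
  qed
  then have "card (ind4_sets V (blowup V \<kappa>)) = card (\<Union>k\<in>UNIV. X k)" by simp
  also have "\<dots> = (\<Sum>k\<in>UNIV. card (X k))"
  proof (rule card_UN_disjoint)
    show "\<forall>k\<in>UNIV. finite (X k)" using finP by (auto simp: X_def)
    show "\<forall>i\<in>UNIV. \<forall>j\<in>UNIV. i \<noteq> j \<longrightarrow> X i \<inter> X j = {}"
    proof (intro ballI impI)
      fix i j :: ix assume "i \<noteq> j"
      show "X i \<inter> X j = {}"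
      proof (rule ccontr)
        assume "X i \<inter> X j \<noteq> {}"
        then obtain S where S: "S \<in> X i" "S \<in> X j" by blast
        obtain x where x: "x \<in> S" "\<kappa> x = i" using S(1) by (auto simp: X_def P_def)
        obtain y where y: "y \<in> S" "\<kappa> y = j" using S(2) by (auto simp: X_def P_def)
        have "S \<subseteq> P i \<union> P (s2 i)" "S \<subseteq> P j \<union> P (s2 j)" using S unfolding X_def by blast+
        then have "\<kappa> x = j \<or> \<kappa> x = s2 j" "\<kappa> y = i \<or> \<kappa> y = s2 i"
          using x(1) y(1) unfolding P_def by blast+
        then have "i = s2 j" "j = s2 i" using x(2) y(2) \<open>i \<noteq> j\<close> by metis+
        then show False by (metis shift_simps(6) shift_neq(4))
      qed
    qed
  qed simp
  finally have "24 * real (card (ind4_sets V (blowup V \<kappa>))) = (\<Sum>k\<in>UNIV. 24 * real (card (X k)))"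
    by (simp add: sum_distrib_left)
  also have "\<dots> = (\<Sum>k\<in>UNIV. fall4 (real (card (P k)) + real (card (P (s2 k)))) - fall4 (real (card (P (s2 k)))))"
  proof (rule sum.cong[OF refl])
    fix k
    have "card (X k) = card {S. S \<subseteq> P k \<union> P (s2 k) \<and> card S = 4} - card {S. S \<subseteq> P (s2 k) \<and> card S = 4}"
      unfolding X_def using finP by (intro card_Diff_subset) auto
    also have "\<dots> = (card (P k \<union> P (s2 k)) choose 4) - (card (P (s2 k)) choose 4)"
      using finP by (simp add: n_subsets)
    also have "card (P k \<union> P (s2 k)) = card (P k) + card (P (s2 k))"
      using finP by (intro card_Un_disjoint) (auto simp: P_def)
    finally have "24 * real (card (X k)) =
        24 * real ((card (P k) + card (P (s2 k))) choose 4) - 24 * real (card (P (s2 k)) choose 4)"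
      using binomial_right_mono[of "card (P (s2 k))" "card (P k) + card (P (s2 k))" 4] by (simp add: of_nat_diff)
    then show "24 * real (card (X k)) =
        fall4 (real (card (P k)) + real (card (P (s2 k)))) - fall4 (real (card (P (s2 k))))"
      unfolding choose4_fall4 by simp
  qed
  finally show ?thesis
    by (simp add: UNIV_ix blow_poly_def P_def algebra_simps)
qed

section \<open>Taylor estimates for the counting polynomial\<close>

lemma fall4_taylor:
  "fall4 (m + y) = fall4 m + (4 * m ^ 3 - 18 * m\<^sup>2 + 22 * m - 6) * y + (6 * m\<^sup>2 - 18 * m + 11) * y\<^sup>2
     + (4 * m - 6) * y ^ 3 + y ^ 4"
  unfolding fall4_def by algebra

text \<open>\<open>y\<close> may be of order q, so the cubic term cannot be treated as an error;
  with the bound on \<open>y\<close> it is absorbed into the quadratic coefficient.\<close>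

lemma fall4_taylor_lower:
  fixes q t y :: real
  assumes "\<bar>y\<bar> \<le> 2 * t" "q \<ge> 1" "t \<ge> 0"
  shows "fall4 (2 * q + y) \<ge> fall4 (2 * q) + (32 * q ^ 3 - 72 * q\<^sup>2 + 44 * q - 6) * y
     + (24 * q\<^sup>2 - 36 * q - 16 * q * t) * y\<^sup>2"
proof -
  have "- (2 * t) * y\<^sup>2 \<le> y * y\<^sup>2"
    using assms(1) by (intro mult_right_mono) (auto simp: abs_le_iff)
  then have "(8 * q - 6) * (- (2 * t) * y\<^sup>2) \<le> (8 * q - 6) * y ^ 3"
    using assms by (intro mult_left_mono) (auto simp: eval_nat_numeral)
  moreover have "(8 * q) * (2 * t * y\<^sup>2) \<ge> (8 * q - 6) * (2 * t * y\<^sup>2)"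
    using assms by (intro mult_right_mono) auto
  moreover have "y ^ 4 \<ge> 0" "y\<^sup>2 \<ge> 0" by simp_all
  moreover have "fall4 (2 * q + y) - (fall4 (2 * q) + (32 * q ^ 3 - 72 * q\<^sup>2 + 44 * q - 6) * y
     + (24 * q\<^sup>2 - 36 * q - 16 * q * t) * y\<^sup>2) = ((8 * q - 6) * y ^ 3 - (8 * q - 6) * (- (2 * t) * y\<^sup>2))
     + ((8 * q) * (2 * t * y\<^sup>2) - (8 * q - 6) * (2 * t * y\<^sup>2)) + y ^ 4 + 11 * y\<^sup>2"
    unfolding fall4_def by algebra
  ultimately show ?thesis by linarith
qed

lemma fall4_taylor_upper:
  fixes q t x :: real
  assumes "\<bar>x\<bar> \<le> t" "q \<ge> 2" "t \<ge> 0"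
  shows "fall4 (q + x) \<le> fall4 q + (4 * q ^ 3 - 18 * q\<^sup>2 + 22 * q - 6) * x + (6 * q\<^sup>2 + 4 * q * t + t\<^sup>2) * x\<^sup>2"
proof -
  have "x * x\<^sup>2 \<le> t * x\<^sup>2"
    using assms(1) by (intro mult_right_mono) (auto simp: abs_le_iff)
  then have "(4 * q - 6) * x ^ 3 \<le> (4 * q - 6) * (t * x\<^sup>2)"
    using assms by (intro mult_left_mono) (auto simp: eval_nat_numeral)
  moreover have "(4 * q - 6) * (t * x\<^sup>2) \<le> (4 * q) * (t * x\<^sup>2)"
    using assms by (intro mult_right_mono) auto
  moreover have "x\<^sup>2 \<le> t\<^sup>2" using assms by (metis abs_le_square_iff abs_of_nonneg)
  then have "x\<^sup>2 * x\<^sup>2 \<le> t\<^sup>2 * x\<^sup>2" by (intro mult_right_mono) auto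
  moreover have "18 * q * x\<^sup>2 \<ge> 11 * x\<^sup>2" using assms by (intro mult_right_mono) auto
  ultimately show ?thesis
    unfolding fall4_taylor by (simp add: algebra_simps eval_nat_numeral)
qed

text \<open>The constant and linear part of the expansion. The linear part sees the deviations only
  through their sum, so it is the same for all part sizes with given total.\<close>

definition lin_part :: "real \<Rightarrow> real \<Rightarrow> real" where
  "lin_part q r = 5 * (fall4 (2 * q) - fall4 q)
     + (2 * (32 * q ^ 3 - 72 * q\<^sup>2 + 44 * q - 6) - (4 * q ^ 3 - 18 * q\<^sup>2 + 22 * q - 6)) * r"

text \<open>The matrix is circulant with least eigenvalue 7 + 8 cos(4 pi / 5) = 5 - 2 sqrt 5 > 1/2;
  the identity is a rational completion of squares.\<close>

lemma quad_ge: "a\<^sup>2 + b\<^sup>2 + c\<^sup>2 + d\<^sup>2 + e\<^sup>2 \<le> 2 * quad a b c d (e :: real)"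
proof -
  have "11696685 * (2 * quad a b c d e - (a\<^sup>2 + b\<^sup>2 + c\<^sup>2 + d\<^sup>2 + e\<^sup>2)) =
    899745 * (13 * a + 8 * b + 8 * e)\<^sup>2 + 8569 * (105 * b + 104 * c - 64 * e)\<^sup>2
    + 209 * (533 * c + 840 * d + 512 * e)\<^sup>2 + 105 * (209 * d + 168 * e)\<^sup>2 + 1622985 * e\<^sup>2"
    unfolding quad_def by algebra
  also have "\<dots> \<ge> 0" by simp
  finally show ?thesis by simp
qed

lemma blow_poly_lower:
  fixes q :: real
  assumes x: "\<bar>a\<bar> \<le> q / 500" "\<bar>b\<bar> \<le> q / 500" "\<bar>c\<bar> \<le> q / 500" "\<bar>d\<bar> \<le> q / 500" "\<bar>e\<bar> \<le> q / 500"
    and q: "q \<ge> 15000"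
  shows "blow_poly (q + a) (q + b) (q + c) (q + d) (q + e) \<ge>
    lin_part q (a + b + c + d + e) + 57 / 10 * q\<^sup>2 * quad a b c d e"
proof -
  define t where "t = q / 500"
  define X where "X = a\<^sup>2 + b\<^sup>2 + c\<^sup>2 + d\<^sup>2 + e\<^sup>2"
  define Y where "Y = (a + b)\<^sup>2 + (b + c)\<^sup>2 + (c + d)\<^sup>2 + (d + e)\<^sup>2 + (e + a)\<^sup>2"
  define L where "L = 32 * q ^ 3 - 72 * q\<^sup>2 + 44 * q - 6"
  define M where "M = 4 * q ^ 3 - 18 * q\<^sup>2 + 22 * q - 6"
  define B where "B = 24 * q\<^sup>2 - 36 * q - 16 * q * t"
  define C where "C = 6 * q\<^sup>2 + 4 * q * t + t\<^sup>2"
  have t: "t \<ge> 0" "q \<ge> 1" "q \<ge> 2" using q by (simp_all add: t_def)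
  have lo: "fall4 ((q + y) + (q + z)) \<ge> fall4 (2 * q) + L * (y + z) + B * (y + z)\<^sup>2"
    if "\<bar>y\<bar> \<le> q / 500" "\<bar>z\<bar> \<le> q / 500" for y z
  proof -
    have "\<bar>y + z\<bar> \<le> 2 * t" using that abs_triangle_ineq[of y z] by (simp add: t_def)
    from fall4_taylor_lower[OF this t(2,1)] show ?thesis
      unfolding L_def B_def by (simp add: algebra_simps)
  qed
  have up: "fall4 (q + y) \<le> fall4 q + M * y + C * y\<^sup>2" if "\<bar>y\<bar> \<le> q / 500" for y
    using fall4_taylor_upper[of y t q] that t unfolding M_def C_def by (simp add: t_def)
  have "blow_poly (q + a) (q + b) (q + c) (q + d) (q + e) \<ge>
    (fall4 (2 * q) + L * (a + b) + B * (a + b)\<^sup>2) + (fall4 (2 * q) + L * (b + c) + B * (b + c)\<^sup>2)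
    + (fall4 (2 * q) + L * (c + d) + B * (c + d)\<^sup>2) + (fall4 (2 * q) + L * (d + e) + B * (d + e)\<^sup>2)
    + (fall4 (2 * q) + L * (e + a) + B * (e + a)\<^sup>2) - ((fall4 q + M * a + C * a\<^sup>2) + (fall4 q + M * b + C * b\<^sup>2)
    + (fall4 q + M * c + C * c\<^sup>2) + (fall4 q + M * d + C * d\<^sup>2) + (fall4 q + M * e + C * e\<^sup>2))" (is "_ \<ge> ?R")
    unfolding blow_poly_def by (intro diff_mono add_mono lo up x)
  also have "?R = lin_part q (a + b + c + d + e) + B * Y - C * X"
    unfolding lin_part_def X_def Y_def L_def[symmetric] M_def[symmetric] by (simp add: algebra_simps)
  finally have 1: "blow_poly (q + a) (q + b) (q + c) (q + d) (q + e) \<ge>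
    lin_part q (a + b + c + d + e) + B * Y - C * X" .
  have YX: "4 * Y - X = quad a b c d e"
    unfolding X_def Y_def quad_def by algebra
  have "Y \<le> 4 * X"
    unfolding X_def Y_def
    using zero_le_power2[of "a - b"] zero_le_power2[of "b - c"]
      zero_le_power2[of "c - d"] zero_le_power2[of "d - e"] zero_le_power2[of "e - a"]
    by (simp add: power2_eq_square algebra_simps)
  then have 2: "(36 * q + 16 * q * t) * Y \<le> (36 * q + 16 * q * t) * (4 * X)"
    using t by (intro mult_left_mono) auto
  have X0: "X \<ge> 0" by (simp add: X_def)
  \<comment> \<open>Here 144 = 4 times 36 and 68 = 4 times 16 plus 4 come from
    \<open>Y \<le> 4 * X\<close>. With t = q/500 and large q the total stays below 0.15 q^2; by
    \<open>quad_ge\<close> this costs 0.3 of the coefficient 6, which is why 57/10 remains.\<close>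
  have "(144 * q + 68 * q * t + t\<^sup>2) \<le> 15 / 100 * q\<^sup>2"
    using q by (simp add: t_def power2_eq_square field_simps)
  then have 3: "(144 * q + 68 * q * t + t\<^sup>2) * X \<le> 15 / 100 * q\<^sup>2 * X"
    using X0 by (intro mult_right_mono)
  have 4: "15 / 100 * q\<^sup>2 * X \<le> 15 / 100 * q\<^sup>2 * (2 * quad a b c d e)"
    using quad_ge[of a b c d e] by (intro mult_left_mono) (auto simp: X_def)
  have "B * Y - C * X = 6 * q\<^sup>2 * (4 * Y - X) - (36 * q + 16 * q * t) * Y - (4 * q * t + t\<^sup>2) * X"
    by (simp add: B_def C_def algebra_simps)
  then show ?thesis using 1 2 3 4 unfolding YX by (simp add: algebra_simps)
qed

text \<open>Used only for the optimal deviations, which are in {-1, 0, 1}; there a crude error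
  linear in q is affordable.\<close>

lemma blow_poly_upper:
  fixes q :: real
  assumes x: "\<bar>a\<bar> \<le> 1" "\<bar>b\<bar> \<le> 1" "\<bar>c\<bar> \<le> 1" "\<bar>d\<bar> \<le> 1" "\<bar>e\<bar> \<le> 1" and q: "q \<ge> 2"
  shows "blow_poly (q + a) (q + b) (q + c) (q + d) (q + e) \<le>
    lin_part q (a + b + c + d + e) + 6 * q\<^sup>2 * quad a b c d e + 600 * q"
proof -
  define L where "L = 32 * q ^ 3 - 72 * q\<^sup>2 + 44 * q - 6"
  define M where "M = 4 * q ^ 3 - 18 * q\<^sup>2 + 22 * q - 6"
  have up: "fall4 ((q + y) + (q + z)) \<le> fall4 (2 * q) + L * (y + z) + 24 * q\<^sup>2 * (y + z)\<^sup>2 + (64 * q + 60)"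
    if "\<bar>y\<bar> \<le> 1" "\<bar>z\<bar> \<le> 1" for y z
  proof -
    define w where "w = y + z"
    have w: "\<bar>w\<bar> \<le> 2" using that by (simp add: w_def)
    have w2: "w\<^sup>2 \<le> 4" using power_mono[OF w, of 2] by simp
    have w4: "w ^ 4 \<le> 16" using power_mono[OF w, of 4] by simp
    have "w ^ 3 \<le> 8" using power_mono[OF w, of 3] abs_ge_self[of "w ^ 3"] by (simp add: power_abs)
    then have "(8 * q - 6) * w ^ 3 \<le> (8 * q - 6) * 8"
      using q by (intro mult_left_mono) auto
    moreover have "36 * q * w\<^sup>2 \<ge> 0" using q by simp
    ultimately have "fall4 (2 * q + w) \<le> fall4 (2 * q) + L * w + 24 * q\<^sup>2 * w\<^sup>2 + (64 * q + 60)"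
      unfolding fall4_taylor L_def using w2 w4 by (simp add: algebra_simps power_mult_distrib)
    then show ?thesis by (simp add: w_def algebra_simps)
  qed
  have lo: "fall4 (q + y) \<ge> fall4 q + M * y + 6 * q\<^sup>2 * y\<^sup>2 - 22 * q" if "\<bar>y\<bar> \<le> 1" for y
  proof -
    have y2: "y\<^sup>2 \<le> 1" using power_mono[OF that, of 2] by simp
    have "- (y ^ 3) \<le> 1" using power_mono[OF that, of 3] abs_ge_minus_self[of "y ^ 3"] by (simp add: power_abs)
    then have "(4 * q - 6) * (- (y ^ 3)) \<le> (4 * q - 6) * 1"
      using q by (intro mult_left_mono) auto
    moreover have "18 * q * y\<^sup>2 \<le> 18 * q * 1" using q y2 by (intro mult_left_mono) auto
    moreover have "y ^ 4 \<ge> 0" "y\<^sup>2 \<ge> 0" by simp_all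
    moreover have "fall4 (q + y) - (fall4 q + M * y + 6 * q\<^sup>2 * y\<^sup>2 - 22 * q) =
      ((4 * q - 6) * 1 - (4 * q - 6) * (- (y ^ 3))) + (18 * q * 1 - 18 * q * y\<^sup>2) + y ^ 4 + 11 * y\<^sup>2 + 6"
      unfolding fall4_def M_def by algebra
    ultimately show ?thesis by linarith
  qed
  have "blow_poly (q + a) (q + b) (q + c) (q + d) (q + e) \<le>
    (fall4 (2 * q) + L * (a + b) + 24 * q\<^sup>2 * (a + b)\<^sup>2 + (64 * q + 60))
    + (fall4 (2 * q) + L * (b + c) + 24 * q\<^sup>2 * (b + c)\<^sup>2 + (64 * q + 60))
    + (fall4 (2 * q) + L * (c + d) + 24 * q\<^sup>2 * (c + d)\<^sup>2 + (64 * q + 60))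
    + (fall4 (2 * q) + L * (d + e) + 24 * q\<^sup>2 * (d + e)\<^sup>2 + (64 * q + 60))
    + (fall4 (2 * q) + L * (e + a) + 24 * q\<^sup>2 * (e + a)\<^sup>2 + (64 * q + 60))
    - ((fall4 q + M * a + 6 * q\<^sup>2 * a\<^sup>2 - 22 * q) + (fall4 q + M * b + 6 * q\<^sup>2 * b\<^sup>2 - 22 * q)
    + (fall4 q + M * c + 6 * q\<^sup>2 * c\<^sup>2 - 22 * q) + (fall4 q + M * d + 6 * q\<^sup>2 * d\<^sup>2 - 22 * q)
    + (fall4 q + M * e + 6 * q\<^sup>2 * e\<^sup>2 - 22 * q))" (is "_ \<le> ?R")
    unfolding blow_poly_def by (intro diff_mono add_mono lo up x)
  also have "?R = lin_part q (a + b + c + d + e) + 6 * q\<^sup>2 * quad a b c d e + (430 * q + 300)"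
    unfolding lin_part_def quad_def L_def[symmetric] M_def[symmetric]
    by (simp add: algebra_simps power2_eq_square)
  finally show ?thesis using q by simp
qed

text \<open>The constant vector with sum r is an eigenvector and has value 3 r^2, so the excess is
  the value at the deviations from the mean. On vectors with sum zero the form is definite and
  controls each coordinate; the constant 125/6 is slightly above the best one, 20.\<close>

lemma quad_coord:
  fixes a b c d e :: int
  shows "6 * (5 * a - (a + b + c + d + e))\<^sup>2 \<le> 125 * (quad a b c d e - 3 * (a + b + c + d + e)\<^sup>2)"
proof -
  have "573276 * (125 * (quad a b c d e - 3 * (a + b + c + d + e)\<^sup>2) - 6 * (5 * a - (a + b + c + d + e))\<^sup>2) =
    1419 * (404 * a + 149 * b - 351 * c - 351 * d + 149 * e)\<^sup>2
    + 125 * (1419 * b + 803 * c - 813 * d - 1409 * e)\<^sup>2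
    + 277750 * (10 * c - 9 * d - e)\<^sup>2 + 3257250 * (d - e)\<^sup>2"
    unfolding quad_def by algebra
  also have "\<dots> \<ge> 0" by simp
  finally show ?thesis by simp
qed

lemma quad_coords:
  fixes a b c d e r :: int
  assumes "a + b + c + d + e = r" "quad a b c d e \<le> m" "x \<in> {a, b, c, d, e}"
  shows "6 * (5 * x - r)\<^sup>2 \<le> 125 * (m - 3 * r\<^sup>2)"
proof -
  have rot: "quad b c d e a = quad a b c d e" "quad c d e a b = quad a b c d e"
    "quad d e a b c = quad a b c d e" "quad e a b c d = quad a b c d e"
    by (simp_all add: quad_def algebra_simps)
  have s: "b + c + d + e + a = r" "c + d + e + a + b = r" "d + e + a + b + c = r" "e + a + b + c + d = r"
    using assms(1) by simp_all
  have "6 * (5 * x - r)\<^sup>2 \<le> 125 * (quad a b c d e - 3 * r\<^sup>2)"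
    using assms(3) quad_coord[of a b c d e] quad_coord[of b c d e a] quad_coord[of c d e a b]
      quad_coord[of d e a b c] quad_coord[of e a b c d]
    unfolding rot s assms(1) by auto
  also have "\<dots> \<le> 125 * (m - 3 * r\<^sup>2)" using assms(2) by simp
  finally show ?thesis .
qed

section \<open>Optimal part sizes\<close>

fun shift :: "ix \<Rightarrow> ix \<Rightarrow> ix" where
  "shift I0 k = k" | "shift I1 k = s1 k" | "shift I2 k = s2 k" | "shift I3 k = s3 k" | "shift I4 k = s4 k"

lemma shift_commute: "shift j (s1 k) = s1 (shift j k)" "shift j (s4 k) = s4 (shift j k)"
  by (cases j; simp)+

lemma shift_eq_iff [simp]: "shift j k = shift j l \<longleftrightarrow> k = l"
  by (cases j; cases k; cases l; simp)

lemma shift_surj: "\<exists>k. shift j k = l"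
  by (cases j; cases l) (metis shift.simps shift_simps)+

text \<open>Read along the cycle \<open>I0, I2, I4, I1, I3\<close>, these are \<open>(1,-1,1,0,0)\<close> and \<open>(1,0,1,0,0)\<close>.\<close>

fun opt1 :: "ix \<Rightarrow> int" where
  "opt1 I0 = 1" | "opt1 I1 = 0" | "opt1 I2 = - 1" | "opt1 I3 = 0" | "opt1 I4 = 1"
fun opt2 :: "ix \<Rightarrow> int" where
  "opt2 I0 = 1" | "opt2 I1 = 0" | "opt2 I2 = 0" | "opt2 I3 = 0" | "opt2 I4 = 1"

definition opt :: "int \<Rightarrow> ix \<Rightarrow> int" where
  "opt r k = (if r = 0 then 0 else if \<bar>r\<bar> = 1 then r * opt1 k else sgn r * opt2 k)"

lemma small_int_cases:
  fixes r :: int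
  assumes "\<bar>r\<bar> \<le> 2"
  obtains "r = 0" | "r = 1" | "r = - 1" | "r = 2" | "r = - 2"
  using assms by linarith

lemma opt_bound: "\<bar>opt r k\<bar> \<le> 1"
  by (cases k) (auto simp: opt_def abs_if sgn_if)

lemma opt_sum: "\<bar>r\<bar> \<le> 2 \<Longrightarrow> (\<Sum>k\<in>UNIV. opt r k) = r"
  by (erule small_int_cases) (simp_all add: opt_def UNIV_ix)

text \<open>The box comes from \<open>quad_coords\<close>: both for sum 1 with value 5 and for sum 2
  with value 14 the right-hand side is 250, which forces 5 x - r between -6 and 6. The rest is
  evaluation.\<close>

lemma quad_opt1:
  "\<forall>a\<in>{-1,0,1::int}. \<forall>b\<in>{-1,0,1}. \<forall>c\<in>{-1,0,1}. \<forall>d\<in>{-1,0,1}. \<forall>e\<in>{-1,0,1}.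
    a + b + c + d + e = 1 \<and> quad a b c d e \<le> 5 \<longrightarrow>
    (\<exists>j\<in>{I0,I1,I2,I3,I4}. a = opt1 (shift j I0) \<and> b = opt1 (shift j I2) \<and> c = opt1 (shift j I4)
      \<and> d = opt1 (shift j I1) \<and> e = opt1 (shift j I3))"
  by code_simp

lemma quad_opt2:
  "\<forall>a\<in>{0,1::int}. \<forall>b\<in>{0,1}. \<forall>c\<in>{0,1}. \<forall>d\<in>{0,1}. \<forall>e\<in>{0,1}.
    a + b + c + d + e = 2 \<and> quad a b c d e \<le> 14 \<longrightarrow>
    (\<exists>j\<in>{I0,I1,I2,I3,I4}. a = opt2 (shift j I0) \<and> b = opt2 (shift j I2) \<and> c = opt2 (shift j I4)
      \<and> d = opt2 (shift j I1) \<and> e = opt2 (shift j I3))"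
  by code_simp

abbreviation quad_of :: "(ix \<Rightarrow> 'a::comm_ring_1) \<Rightarrow> 'a" where
  "quad_of x \<equiv> quad (x I0) (x I2) (x I4) (x I1) (x I3)"

lemma quad_of_uminus: "quad_of (\<lambda>k. - x k) = quad_of x"
  by (simp add: quad_def)

lemma quad_of_opt: "\<bar>r\<bar> \<le> 2 \<Longrightarrow> quad_of (opt r) = (if r = 0 then 0 else if \<bar>r\<bar> = 1 then 5 else 14)"
  by (erule small_int_cases) (simp_all add: opt_def quad_def)

lemma int_square_bound:
  fixes y :: int
  assumes "6 * y\<^sup>2 \<le> 250"
  shows "- 6 \<le> y \<and> y \<le> 6"
proof (rule ccontr)
  assume "\<not> ?thesis"
  then have "7 \<le> \<bar>y\<bar>" by linarith
  then have "7\<^sup>2 \<le> \<bar>y\<bar>\<^sup>2" by (intro power_mono) auto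
  then show False using assms by simp
qed

lemma quad_min_pos:
  fixes x :: "ix \<Rightarrow> int"
  assumes sum: "(\<Sum>k\<in>UNIV. x k) = r" and r: "r = 0 \<or> r = 1 \<or> r = 2" and Q: "quad_of x \<le> quad_of (opt r)"
  shows "\<exists>j. \<forall>k. x k = opt r (shift j k)"
proof -
  have s: "x I0 + x I2 + x I4 + x I1 + x I3 = r" using sum by (simp add: UNIV_ix)
  have b: "6 * (5 * x k - r)\<^sup>2 \<le> 125 * (quad_of (opt r) - 3 * r\<^sup>2)" for k
    using quad_coords[OF s Q] by (cases k) auto
  from r consider "r = 0" | "r = 1" | "r = 2" by blast
  then show ?thesis
  proof cases
    case 1
    then have "x k = 0" for k using b[of k] by (simp add: quad_of_opt)
    then show ?thesis using 1 by (simp add: opt_def)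
  next
    case 2
    have x: "x k \<in> {-1, 0, 1}" for k
      using int_square_bound[of "5 * x k - r"] b[of k] 2 by (simp add: quad_of_opt) presburger
    have "quad_of x \<le> 5" using Q 2 by (simp add: quad_of_opt)
    then obtain j where "x I0 = opt1 (shift j I0)" "x I2 = opt1 (shift j I2)" "x I4 = opt1 (shift j I4)"
      "x I1 = opt1 (shift j I1)" "x I3 = opt1 (shift j I3)"
      using quad_opt1[rule_format, OF x[of I0] x[of I2] x[of I4] x[of I1] x[of I3]] s 2 by blast
    then have "x k = opt r (shift j k)" for k using 2 by (cases k) (simp_all add: opt_def)
    then show ?thesis by blast
  next
    case 3
    have x: "x k \<in> {0, 1}" for k
      using int_square_bound[of "5 * x k - r"] b[of k] 3 by (simp add: quad_of_opt) presburger
    have "quad_of x \<le> 14" using Q 3 by (simp add: quad_of_opt)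
    then obtain j where "x I0 = opt2 (shift j I0)" "x I2 = opt2 (shift j I2)" "x I4 = opt2 (shift j I4)"
      "x I1 = opt2 (shift j I1)" "x I3 = opt2 (shift j I3)"
      using quad_opt2[rule_format, OF x[of I0] x[of I2] x[of I4] x[of I1] x[of I3]] s 3 by blast
    then have "x k = opt r (shift j k)" for k using 3 by (cases k) (simp_all add: opt_def)
    then show ?thesis by blast
  qed
qed

lemma quad_min:
  fixes x :: "ix \<Rightarrow> int"
  assumes sum: "(\<Sum>k\<in>UNIV. x k) = r" and r: "\<bar>r\<bar> \<le> 2" and Q: "quad_of x \<le> quad_of (opt r)"
  shows "\<exists>j. \<forall>k. x k = opt r (shift j k)"
proof (cases "r \<ge> 0")
  case True
  then have "r = 0 \<or> r = 1 \<or> r = 2" using r by linarith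
  then show ?thesis by (rule quad_min_pos[OF sum _ Q])
next
  case False
  have neg: "opt (- r) k = - opt r k" for k
    using r by (cases rule: small_int_cases[OF r]) (simp_all add: opt_def)
  have "quad_of (\<lambda>k. - x k) \<le> quad_of (opt (- r))"
    unfolding neg quad_of_uminus by (rule Q)
  moreover have "(\<Sum>k\<in>UNIV. - x k) = - r" using sum by (simp add: sum_negf)
  moreover have "- r = 0 \<or> - r = 1 \<or> - r = 2" using False r by linarith
  ultimately obtain j where "\<forall>k. - x k = opt (- r) (shift j k)"
    using quad_min_pos[of "\<lambda>k. - x k" "- r"] by blast
  then show ?thesis unfolding neg by auto
qed

text \<open>Rounding to the nearest integer makes the remainder lie between -2 and 2, so that
  negative remainders reduce to positive ones by changing signs.\<close>

definition quot5 :: "nat \<Rightarrow> int" where "quot5 n = (int n + 2) div 5"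
definition rem5 :: "nat \<Rightarrow> int" where "rem5 n = int n - 5 * quot5 n"

lemma rem5_bound: "\<bar>rem5 n\<bar> \<le> 2"
  unfolding rem5_def quot5_def by linarith

lemma quot5_rem5: "int n = 5 * quot5 n + rem5 n"
  by (simp add: rem5_def)

definition opt_parts :: "'a set \<Rightarrow> ('a \<Rightarrow> ix) \<Rightarrow> bool" where
  "opt_parts V \<kappa> \<longleftrightarrow> (\<forall>k. int (card {x \<in> V. \<kappa> x = k}) = quot5 (card V) + opt (rem5 (card V)) k)"

definition opt_count :: "nat \<Rightarrow> real" where
  "opt_count n = (let q = real_of_int (quot5 n); y = \<lambda>k. real_of_int (opt (rem5 n) k)
     in blow_poly (q + y I0) (q + y I2) (q + y I4) (q + y I1) (q + y I3))"

lemma card_parts: "finite V \<Longrightarrow> (\<Sum>k\<in>UNIV. card {x \<in> V. (\<kappa> x :: ix) = k}) = card V"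
proof -
  assume V: "finite V"
  have "card (\<Union>k\<in>UNIV. {x \<in> V. \<kappa> x = k}) = (\<Sum>k\<in>UNIV. card {x \<in> V. \<kappa> x = k})"
    using V by (intro card_UN_disjoint) auto
  moreover have "(\<Union>k\<in>UNIV. {x \<in> V. \<kappa> x = k}) = V" by auto
  ultimately show ?thesis by simp
qed

lemma opt_parts_exists:
  assumes V: "finite V" and n: "card V \<ge> 10"
  shows "\<exists>\<kappa>. opt_parts V \<kappa>"
proof -
  define a where "a k = nat (quot5 (card V) + opt (rem5 (card V)) k)" for k
  have "quot5 (card V) \<ge> 1" using n unfolding quot5_def by linarith
  then have "0 \<le> quot5 (card V) + opt (rem5 (card V)) k" for k
    using opt_bound[of "rem5 (card V)" k] by linarith
  then have a: "int (a k) = quot5 (card V) + opt (rem5 (card V)) k" for k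
    unfolding a_def by (rule nat_0_le)
  \<comment> \<open>One slot for each place in each class; a bijection from \<open>V\<close> onto
    the slots, followed by the first component, is the required labelling.\<close>
  define W where "W = (SIGMA k:UNIV. {..<a k})"
  have "int (card W) = (\<Sum>k\<in>(UNIV :: ix set). int (a k))"
    by (simp add: W_def)
  also have "\<dots> = 5 * quot5 (card V) + rem5 (card V)"
    by (simp add: a sum.distrib card_ix opt_sum[OF rem5_bound])
  finally have "card W = card V" using quot5_rem5[of "card V"] by simp
  moreover have finW: "finite W" by (simp add: W_def)
  ultimately obtain f where f: "bij_betw f V W"
    using V finite_same_card_bij by metis
  have "card {x \<in> V. fst (f x) = k} = a k" for k
  proof -
    have "bij_betw f {x \<in> V. fst (f x) = k} {p \<in> W. fst p = k}"
      using f by (auto simp: bij_betw_def inj_on_def)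
    then have "card {x \<in> V. fst (f x) = k} = card {p \<in> W. fst p = k}"
      by (rule bij_betw_same_card)
    also have "{p \<in> W. fst p = k} = {k} \<times> {..<a k}" by (auto simp: W_def)
    finally show ?thesis by (simp add: card_cartesian_product)
  qed
  then show ?thesis using a by (intro exI[of _ "fst \<circ> f"]) (simp add: opt_parts_def)
qed

lemma opt_parts_count:
  assumes "finite V" "opt_parts V \<kappa>"
  shows "24 * real (card (ind4_sets V (blowup V \<kappa>))) = opt_count (card V)"
proof -
  have "real (card {x \<in> V. \<kappa> x = k}) = real_of_int (quot5 (card V)) + real_of_int (opt (rem5 (card V)) k)" for k
  proof -
    have "real_of_int (int (card {x \<in> V. \<kappa> x = k})) = real_of_int (quot5 (card V) + opt (rem5 (card V)) k)"
      using assms(2) unfolding opt_parts_def by simp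
    then show ?thesis by simp
  qed
  then show ?thesis unfolding card_ind4_blowup[OF assms(1)] opt_count_def Let_def by simp
qed

lemma blowup_shift: "blowup V (\<lambda>x. shift j (\<kappa> x)) = blowup V \<kappa>"
  by (intro ext) (simp add: blowup_def flip: shift_commute)

text \<open>The lower estimate at the given sizes is compared with the upper estimate at the optimal
  ones. Both contain the same \<open>lin_part\<close>, so only the quadratic forms remain.\<close>

lemma near_opt_parts:
  assumes V: "finite V" and n: "card V \<ge> 1000000"
    and parts: "\<And>k. real (card {x \<in> V. \<kappa> x = k}) \<ge> (1 / 5 - 2 / 100000) * real (card V)"
    and le: "24 * real (card (ind4_sets V (blowup V \<kappa>))) \<le> opt_count (card V)"
  obtains j where "opt_parts V (\<lambda>x. shift j (\<kappa> x))"
proof -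
  define q r where "q = quot5 (card V)" and "r = rem5 (card V)"
  define x where "x k = int (card {x \<in> V. \<kappa> x = k}) - q" for k
  define Q where "Q = real_of_int q"
  have N: "real (card V) = 5 * Q + real_of_int r"
    using quot5_rem5[of "card V"] unfolding Q_def q_def r_def
    by (metis of_int_add of_int_mult of_int_numeral of_int_of_nat_eq)
  have r: "\<bar>r\<bar> \<le> 2" unfolding r_def by (rule rem5_bound)
  then have r': "\<bar>real_of_int r\<bar> \<le> 2" by (simp flip: of_int_abs)
  have Qlarge: "Q \<ge> 150000" using N n r' by linarith
  have c: "real (card {x \<in> V. \<kappa> x = k}) = Q + real_of_int (x k)" for k
    by (simp add: x_def Q_def)
  have "(\<Sum>k\<in>UNIV. int (card {x \<in> V. \<kappa> x = k})) = int (card V)"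
    using card_parts[OF V, of \<kappa>] by (simp flip: of_nat_sum)
  then have sum: "(\<Sum>k\<in>UNIV. x k) = r"
    using quot5_rem5[of "card V"] by (simp add: x_def sum_subtractf card_ix q_def r_def)
  then have sum': "real_of_int (x I0) + real_of_int (x I1) + real_of_int (x I2) + real_of_int (x I3)
      + real_of_int (x I4) = real_of_int r"
    by (simp add: UNIV_ix flip: of_int_add)
  have lo: "real_of_int (x k) \<ge> - (3 / 10000) * Q" for k
    using parts[of k] Qlarge r' unfolding c N by (simp add: algebra_simps abs_le_iff)
  \<comment> \<open>The upper bound follows from the fixed sum and the lower bounds for the other
    four coordinates.\<close>
  have up: "real_of_int (x k) \<le> 2 / 1000 * Q" for k
    using sum' lo[of I0] lo[of I1] lo[of I2] lo[of I3] lo[of I4] r' Qlarge by (cases k) (simp_all add: abs_le_iff)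
  have bd: "\<bar>real_of_int (x k)\<bar> \<le> Q / 500" for k
    using lo[of k] up[of k] Qlarge by (simp add: abs_le_iff)
  have ob: "\<bar>real_of_int (opt r k)\<bar> \<le> 1" for k
    using opt_bound[of r k] by (simp flip: of_int_abs)
  have osum: "real_of_int (opt r I0) + real_of_int (opt r I2) + real_of_int (opt r I4)
      + real_of_int (opt r I1) + real_of_int (opt r I3) = real_of_int r"
    using opt_sum[OF r] by (simp add: UNIV_ix flip: of_int_add)
  have xsum: "real_of_int (x I0) + real_of_int (x I2) + real_of_int (x I4)
      + real_of_int (x I1) + real_of_int (x I3) = real_of_int r"
    using sum' by simp
  define m where "m = quad_of (opt r)"
  have "lin_part Q (real_of_int r) + 57 / 10 * Q\<^sup>2 * quad_of (\<lambda>k. real_of_int (x k)) \<le>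
      24 * real (card (ind4_sets V (blowup V \<kappa>)))"
    unfolding card_ind4_blowup[OF V] c
    using blow_poly_lower[OF bd bd bd bd bd, of I0 I2 I4 I1 I3] Qlarge by (simp add: xsum)
  also have "\<dots> \<le> opt_count (card V)" by (rule le)
  also have "\<dots> \<le> lin_part Q (real_of_int r) + 6 * Q\<^sup>2 * quad_of (\<lambda>k. real_of_int (opt r k)) + 600 * Q"
    unfolding opt_count_def Let_def q_def[symmetric] r_def[symmetric] Q_def[symmetric]
    using blow_poly_upper[OF ob ob ob ob ob, of Q I0 I2 I4 I1 I3] Qlarge by (simp add: osum)
  also have "quad_of (\<lambda>k. real_of_int (opt r k)) = real_of_int m"
    by (simp add: m_def quad_def)
  also have "quad_of (\<lambda>k. real_of_int (x k)) = real_of_int (quad_of x)"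
    by (simp add: quad_def)
  finally have "Q\<^sup>2 * (57 / 10 * real_of_int (quad_of x)) \<le> Q\<^sup>2 * (6 * real_of_int m) + 600 * Q"
    by simp
  also have "600 * Q \<le> Q\<^sup>2 * (1 / 100)"
    using Qlarge by (simp add: power2_eq_square)
  finally have "Q\<^sup>2 * (57 / 10 * real_of_int (quad_of x)) \<le> Q\<^sup>2 * (6 * real_of_int m + 1 / 100)"
    by (simp add: algebra_simps)
  then have "57 / 10 * real_of_int (quad_of x) \<le> 6 * real_of_int m + 1 / 100"
    using Qlarge by simp
  \<comment> \<open>For m at most 14, 6 m + 1/100 is below 57/10 (m + 1). The loss from 6 to 57/10
    is thus less than one unit of the integer-valued form.\<close>
  moreover have "m \<le> 14" using r by (simp add: m_def quad_of_opt)
  ultimately have "quad_of x < m + 1" by linarith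
  then have "quad_of x \<le> quad_of (opt r)" by (simp add: m_def)
  from quad_min[OF sum r this] obtain j where j: "\<And>k. x k = opt r (shift j k)" by blast
  have "int (card {y \<in> V. shift j (\<kappa> y) = l}) = q + opt r l" for l
  proof -
    obtain k where k: "l = shift j k" using shift_surj by metis
    have "int (card {y \<in> V. \<kappa> y = k}) = q + opt r l" using j[of k] by (simp add: x_def k)
    then show ?thesis by (simp add: k)
  qed
  then have "opt_parts V (\<lambda>x. shift j (\<kappa> x))"
    by (simp add: opt_parts_def q_def r_def)
  then show ?thesis by (rule that)
qed

text \<open>The leading coefficients combine to 5 times 16 minus 5 = 75 = 3/25 times 5^4; everything
  else is estimated crudely, which produces the constant c = 1500 behind \<open>N0\<close>.\<close>

lemma opt_count_upper:
  assumes "n \<ge> 10"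
  shows "opt_count n \<le> 3 / 25 * real n ^ 4 + 1500 * real n ^ 3"
proof -
  define Q where "Q = real_of_int (quot5 n)"
  define y where "y k = real_of_int (opt (rem5 n) k)" for k
  define N where "N = real n"
  have N: "N = 5 * Q + real_of_int (rem5 n)"
    unfolding Q_def N_def by (metis of_int_add of_int_mult of_int_numeral of_int_of_nat_eq quot5_rem5)
  have r: "\<bar>real_of_int (rem5 n)\<bar> \<le> 2" using rem5_bound[of n] by (simp flip: of_int_abs)
  have N1: "N \<ge> 10" using assms by (simp add: N_def)
  have Q1: "Q \<ge> 1" and QN: "5 * Q \<le> N + 2" "Q \<le> N" using N N1 r by (auto simp: abs_le_iff)
  have y: "\<bar>y k\<bar> \<le> 1" for k unfolding y_def using opt_bound[of "rem5 n" k] by (simp flip: of_int_abs)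
  have up: "fall4 ((Q + y k) + (Q + y l)) \<le> 16 * Q ^ 4 + 240 * Q ^ 3" for k l
  proof -
    define z where "z = (Q + y k) + (Q + y l)"
    have z: "0 \<le> z" "z \<le> 2 * Q + 2" using y[of k] y[of l] Q1 by (auto simp: z_def abs_le_iff)
    have "z ^ 4 - fall4 z = z * (6 * (z - 1)\<^sup>2 + z)"
      unfolding fall4_def by algebra
    also have "\<dots> \<ge> 0" using z by simp
    finally have "fall4 z \<le> z ^ 4" by simp
    also have "\<dots> \<le> (2 * Q + 2) ^ 4" using z by (intro power_mono) auto
    also have "\<dots> = 16 * Q ^ 4 + (64 * Q ^ 3 + 96 * Q\<^sup>2 + 64 * Q + 16)" by algebra
    also have "\<dots> \<le> 16 * Q ^ 4 + 240 * Q ^ 3"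
    proof -
      have "Q ^ 2 \<le> Q ^ 3" "Q ^ 1 \<le> Q ^ 3" "Q ^ 0 \<le> Q ^ 3" using Q1 by (intro power_increasing; simp)+
      then show ?thesis by simp
    qed
    finally show ?thesis by (simp add: z_def)
  qed
  have lo: "fall4 (Q + y k) \<ge> Q ^ 4 - 58 * Q ^ 3" for k
  proof -
    define z where "z = Q + y k"
    have z: "Q - 1 \<le> z" "z \<le> Q + 1" using y[of k] by (auto simp: z_def abs_le_iff)
    have "fall4 z - (z ^ 4 - 6 * z ^ 3) = z * (11 * z - 6)" unfolding fall4_def by algebra
    also have "\<dots> \<ge> - 6"
    proof -
      have "z * (11 * z - 6) = 11 * (z - 3 / 11)\<^sup>2 + 57 / 11 - 6"
        by (simp add: power2_eq_square algebra_simps)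
      then show ?thesis using zero_le_power2[of "z - 3 / 11"] by linarith
    qed
    finally have "fall4 z \<ge> z ^ 4 - 6 * z ^ 3 - 6" by simp
    moreover have "z ^ 4 \<ge> (Q - 1) ^ 4" using z Q1 by (intro power_mono) auto
    moreover have "(Q - 1) ^ 4 = Q ^ 4 - 4 * Q ^ 3 + (6 * (Q\<^sup>2 - Q) + 2 * Q + 1)"
      by algebra
    moreover have "6 * (Q\<^sup>2 - Q) + 2 * Q + 1 \<ge> 0"
      using Q1 by (simp add: power2_eq_square add_nonneg_nonneg)
    moreover have "z ^ 3 \<le> (Q + 1) ^ 3" using z Q1 by (intro power_mono) auto
    moreover have "(Q + 1) ^ 3 = Q ^ 3 + 3 * Q\<^sup>2 + 3 * Q + 1" by algebra
    moreover have "Q ^ 2 \<le> Q ^ 3" "Q ^ 1 \<le> Q ^ 3" "Q ^ 0 \<le> Q ^ 3" using Q1 by (intro power_increasing; simp)+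
    ultimately show ?thesis unfolding z_def[symmetric] by simp
  qed
  define u l where "u = 16 * Q ^ 4 + 240 * Q ^ 3" and "l = Q ^ 4 - 58 * Q ^ 3"
  have "opt_count n \<le> (u + u + u + u + u) - (l + l + l + l + l)"
    unfolding opt_count_def Let_def blow_poly_def Q_def[symmetric] y_def[symmetric] u_def l_def
    by (intro diff_mono add_mono up lo)
  also have "\<dots> = 3 / 25 * (5 * Q) ^ 4 + 1490 * Q ^ 3"
    by (simp add: u_def l_def power_mult_distrib)
  also have "\<dots> \<le> 3 / 25 * (N + 2) ^ 4 + 1490 * N ^ 3"
    using QN Q1 by (intro add_mono mult_left_mono power_mono) auto
  also have "(N + 2) ^ 4 = N ^ 4 + (8 * N ^ 3 + 24 * N\<^sup>2 + 32 * N + 16)" by algebra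
  also have "3 / 25 * (N ^ 4 + (8 * N ^ 3 + 24 * N\<^sup>2 + 32 * N + 16)) + 1490 * N ^ 3 \<le>
      3 / 25 * N ^ 4 + 1500 * N ^ 3"
  proof -
    have "N ^ 2 \<le> N ^ 3" "N ^ 1 \<le> N ^ 3" "N ^ 0 \<le> N ^ 3" using N1 by (intro power_increasing; simp)+
    then show ?thesis by (simp add: algebra_simps)
  qed
  finally show ?thesis by (simp add: N_def)
qed

lemma opt_parts_bij:
  assumes V: "finite V" "opt_parts V \<kappa>" and V': "finite V'" "opt_parts V' \<kappa>'" and c: "card V = card V'"
  obtains \<phi> where "bij_betw \<phi> V V'" "\<And>x. x \<in> V \<Longrightarrow> \<kappa>' (\<phi> x) = \<kappa> x"
proof -
  have "card {x \<in> V. \<kappa> x = k} = card {x \<in> V'. \<kappa>' x = k}" for k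
    using V(2) V'(2) c unfolding opt_parts_def by (metis of_nat_eq_iff)
  then have "\<exists>f. bij_betw f {x \<in> V. \<kappa> x = k} {x \<in> V'. \<kappa>' x = k}" for k
    using V V' by (intro finite_same_card_bij) auto
  then obtain f where f: "\<And>k. bij_betw (f k) {x \<in> V. \<kappa> x = k} {x \<in> V'. \<kappa>' x = k}" by metis
  define \<phi> where "\<phi> x = f (\<kappa> x) x" for x
  have \<phi>: "\<phi> x \<in> V'" "\<kappa>' (\<phi> x) = \<kappa> x" if "x \<in> V" for x
    using bij_betwE[OF f[of "\<kappa> x"]] that unfolding \<phi>_def by auto
  have "bij_betw \<phi> V V'"
    unfolding bij_betw_def
  proof
    show "inj_on \<phi> V"
    proof (rule inj_onI)
      fix x y assume xy: "x \<in> V" "y \<in> V" "\<phi> x = \<phi> y"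
      then have "\<kappa> x = \<kappa> y" using \<phi> by metis
      then show "x = y"
        using xy bij_betw_imp_inj_on[OF f[of "\<kappa> x"]] unfolding \<phi>_def inj_on_def by auto
    qed
    show "\<phi> ` V = V'"
    proof
      show "\<phi> ` V \<subseteq> V'" using \<phi> by blast
      show "V' \<subseteq> \<phi> ` V"
      proof
        fix y assume y: "y \<in> V'"
        then obtain x where "x \<in> V" "\<kappa> x = \<kappa>' y" "y = f (\<kappa>' y) x"
          using bij_betw_imp_surj_on[OF f[of "\<kappa>' y"]] by blast
        then show "y \<in> \<phi> ` V" by (intro image_eqI[of _ _ x]) (simp_all add: \<phi>_def)
      qed
    qed
  qed
  then show ?thesis using that \<phi> by blast
qed

section \<open>Back to cliques\<close>

definition compl_adj :: "'a set \<Rightarrow> 'a set set \<Rightarrow> 'a \<Rightarrow> 'a \<Rightarrow> bool" where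
  "compl_adj V E x y \<longleftrightarrow> x \<in> V \<and> y \<in> V \<and> x \<noteq> y \<and> {x, y} \<notin> E"

lemma finite_indep_cards: "finite V \<Longrightarrow> finite {card S | S. S \<subseteq> V \<and> indep S E}"
  by (rule finite_subset[of _ "card ` Pow V"]) auto

lemma tf_graph_compl_adj:
  assumes "fin_graph V E" "indep_number V E < 3"
  shows "tf_graph V (compl_adj V E)"
proof
  show fin: "finite V" using assms(1) by (simp add: fin_graph_def)
  show "compl_adj V E x y \<Longrightarrow> compl_adj V E y x" for x y
    by (auto simp: compl_adj_def insert_commute)
  show "compl_adj V E x y \<Longrightarrow> x \<in> V" for x y by (simp add: compl_adj_def)
  show "\<not> compl_adj V E x z" if "compl_adj V E x y" "compl_adj V E y z" for x y z
  proof
    assume "compl_adj V E x z"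
    with that have "{x, y, z} \<subseteq> V" "indep {x, y, z} E" "card {x, y, z} = 3"
      by (auto simp: compl_adj_def indep_def insert_commute)
    then have "3 \<in> {card S | S. S \<subseteq> V \<and> indep S E}" by force
    then have "3 \<le> indep_number V E"
      unfolding indep_number_def by (rule Max_ge[OF finite_indep_cards[OF fin]])
    then show False using assms(2) by simp
  qed
qed

lemma num_cliques_compl_adj:
  assumes "fin_graph V E"
  shows "num_cliques 4 V E = card (ind4_sets V (compl_adj V E))"
proof -
  have "{S \<in> [V]\<^bsup>4\<^esup>. clique S E} = ind4_sets V (compl_adj V E)"
    by (auto simp: nsets_def clique_def ind4_sets_def compl_adj_def card_ge_0_finite)
  then show ?thesis by (simp add: num_cliques_def)
qed

text \<open>Together with \<open>tf_graph_compl_adj\<close> this makes complementation a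
  correspondence, so minimising over graphs and over triangle-free relations is the same.\<close>

lemma tf_graph_realized:
  assumes "tf_graph V A"
  obtains E where "fin_graph V E" "indep_number V E < 3" "compl_adj V E = A"
proof -
  interpret tf_graph V A by fact
  define E where "E = {{x, y} | x y. x \<in> V \<and> y \<in> V \<and> x \<noteq> y \<and> \<not> A x y}"
  have E: "{x, y} \<in> E \<longleftrightarrow> x \<in> V \<and> y \<in> V \<and> x \<noteq> y \<and> \<not> A x y" for x y
    unfolding E_def using sym_iff by (auto simp: doubleton_eq_iff)
  have "fin_graph V E"
    using fin by (auto simp: fin_graph_def E_def nsets_def)
  moreover have "compl_adj V E = A"
    using sub sym irrefl by (intro ext) (auto simp: compl_adj_def E)
  moreover have "indep_number V E < 3"
  proof -
    have "card S < 3" if S: "S \<subseteq> V" "indep S E" for S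
    proof (rule ccontr)
      assume "\<not> card S < 3"
      then obtain T where "T \<subseteq> S" "card T = 3" by (meson not_less obtain_subset_with_card_n)
      then obtain x y z where xyz: "x \<in> S" "y \<in> S" "z \<in> S" "x \<noteq> y" "y \<noteq> z" "x \<noteq> z"
        by (auto simp: card_3_iff)
      then have "A x y" "A y z" "A x z" using S by (auto simp: indep_def E)
      then show False using tf by blast
    qed
    moreover have "{card S | S. S \<subseteq> V \<and> indep S E} \<noteq> {}" using null_indep by blast
    ultimately show ?thesis
      unfolding indep_number_def using finite_indep_cards[OF fin] by (subst Max_less_iff) auto
  qed
  ultimately show ?thesis using that by blast
qed

lemma min_cliques_le:
  fixes V :: "nat set"
  assumes "tf_graph V A"
  shows "min_cliques (card V) 4 3 \<le> card (ind4_sets V A)"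
proof -
  obtain E where E: "fin_graph V E" "indep_number V E < 3" "compl_adj V E = A"
    using tf_graph_realized[OF assms] .
  then have "num_cliques 4 V E = card (ind4_sets V A)" using num_cliques_compl_adj by metis
  then show ?thesis
    unfolding min_cliques_def using E
    by (intro wellorder_Inf_le1 CollectI exI[of _ V] exI[of _ E]) simp
qed

lemma min_cliques_attained:
  obtains V :: "nat set" and E where "fin_graph V E" "card V = n" "indep_number V E < 3"
    "num_cliques 4 V E = min_cliques n 4 3"
proof -
  have "tf_graph {..<n} (\<lambda>_ _. False)" by unfold_locales auto
  then obtain E where "fin_graph {..<n} E" "indep_number {..<n} E < 3"
    using tf_graph_realized by metis
  then have "{num_cliques 4 V E | (V :: nat set) E. fin_graph V E \<and> card V = n \<and> indep_number V E < 3} \<noteq> {}"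
    by (metis (mono_tags, lifting) card_lessThan empty_iff mem_Collect_eq)
  from Inf_nat_def1[OF this] show ?thesis
    using that unfolding min_cliques_def by fastforce
qed

lemma tf_min_extremal:
  fixes V :: "nat set"
  assumes "fin_graph V E" "indep_number V E < 3" "num_cliques 4 V E = min_cliques (card V) 4 3"
  shows "tf_min V (compl_adj V E)"
proof -
  interpret tf_graph V "compl_adj V E" using assms by (intro tf_graph_compl_adj)
  show ?thesis
    using assms min_cliques_le by unfold_locales (simp add: num_cliques_compl_adj)
qed

lemma min_cliques_upper:
  assumes "n \<ge> 10"
  shows "24 * real (min_cliques n 4 3) \<le> opt_count n"
proof -
  obtain \<kappa> :: "nat \<Rightarrow> ix" where \<kappa>: "opt_parts {..<n} \<kappa>"
    using opt_parts_exists[of "{..<n}"] assms by auto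
  have "min_cliques n 4 3 \<le> card (ind4_sets {..<n} (blowup {..<n} \<kappa>))"
    using min_cliques_le[OF tf_graph_blowup[of "{..<n}" \<kappa>]] by simp
  then show ?thesis using opt_parts_count[OF _ \<kappa>] by simp
qed

lemma min_cliques_lower: "24 * real (min_cliques n 4 3) \<ge> 3 / 25 * real n ^ 4 - 6 * real n ^ 3"
\<comment> \<open>The averaged inequality carries a common factor n that has to be
  cancelled.\<close>
proof (cases "n = 0")
  case False
  obtain V :: "nat set" and E where E: "fin_graph V E" "card V = n" "indep_number V E < 3"
    "num_cliques 4 V E = min_cliques n 4 3" by (rule min_cliques_attained)
  interpret tf_graph V "compl_adj V E" using E by (intro tf_graph_compl_adj)
  have nonneg: "two_edges_tuples \<ge> 0" "path_pt_tuples \<ge> 0" "(\<Sum>x\<in>V. (5 * int (deg x) - 2 * int (card V))\<^sup>2) \<ge> 0"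
    unfolding two_edges_tuples_def path_pt_tuples_def by (intro sum_nonneg; simp)+
  have "6000 * int n ^ 5 \<le> 50000 * int n * ind_tuples"
    using ind_tuples_lower nonneg unfolding E(2)
    by (smt (verit, best) mult_nonneg_nonneg of_nat_0_le_iff zero_le_power2)
  then have "int n * (6000 * int n ^ 4) \<le> int n * (50000 * ind_tuples)"
    by (simp add: eval_nat_numeral algebra_simps)
  then have "6000 * int n ^ 4 \<le> 50000 * ind_tuples"
    using False by simp
  also have "\<dots> \<le> 50000 * (24 * int (min_cliques n 4 3) + 6 * int n ^ 3)"
    using ind_tuples_le E by (simp add: num_cliques_compl_adj)
  finally have "real_of_int (6000 * int n ^ 4) \<le> real_of_int (50000 * (24 * int (min_cliques n 4 3) + 6 * int n ^ 3))"
    by (simp only: of_int_le_iff)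
  then show ?thesis by simp
qed simp

text \<open>The threshold of \<open>min_is_blowup\<close> for c = 1500, where 1512 = 1500 +
  12.\<close>

definition N0 :: nat where "N0 = 816000 * 100000 ^ 2 * 1512"

lemma extremal_opt_parts:
  fixes V :: "nat set"
  assumes E: "fin_graph V E" "indep_number V E < 3" "num_cliques 4 V E = min_cliques (card V) 4 3"
    and n: "card V \<ge> N0"
  obtains \<kappa> where "compl_adj V E = blowup V \<kappa>" "opt_parts V \<kappa>"
proof -
  interpret tf_min V "compl_adj V E" by (rule tf_min_extremal[OF E])
  have large: "card V \<ge> 1000000" using n by (simp add: N0_def)
  have I: "24 * real (card (ind4_sets V (compl_adj V E))) \<le> opt_count (card V)"
    using min_cliques_upper[of "card V"] E large by (simp add: num_cliques_compl_adj)
  also have "\<dots> \<le> 3 / 25 * real (card V) ^ 4 + 1500 * real (card V) ^ 3"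
    using large by (intro opt_count_upper) simp
  finally have I': "24 * real (card (ind4_sets V (compl_adj V E)))
      \<le> 3 / 25 * real (card V) ^ 4 + 1500 * real (card V) ^ 3" .
  have n': "real (card V) \<ge> 816000 * 100000 ^ 2 * (1500 + 12)"
  proof -
    have "real N0 \<le> real (card V)" using n by (simp only: of_nat_le_iff)
    then show ?thesis by (simp add: N0_def)
  qed
  obtain \<kappa> where \<kappa>: "compl_adj V E = blowup V \<kappa>"
      "\<And>k. real (card {x \<in> V. \<kappa> x = k}) \<ge> (1 / 5 - 2 / 100000) * real (card V)"
    using min_is_blowup[OF I' _ n'] by auto
  obtain j where j: "opt_parts V (\<lambda>x. shift j (\<kappa> x))"
    by (rule near_opt_parts[OF fin large \<kappa>(2) I[unfolded \<kappa>(1)]])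
  show ?thesis
    by (rule that[of "\<lambda>x. shift j (\<kappa> x)"]) (simp_all add: \<kappa>(1) blowup_shift j)
qed

text \<open>Consecutive parts of a blow-up are joined in the graph, hence are classes at distance two in
  the complement.\<close>

definition part_ix :: "nat \<Rightarrow> ix" where
  "part_ix i = [I0, I2, I4, I1, I3] ! i"

lemma less5_cases:
  assumes "(i :: nat) < 5"
  obtains "i = 0" | "i = 1" | "i = 2" | "i = 3" | "i = 4"
  using assms by linarith

lemma part_ix_next:
  assumes "i < 5"
  shows "part_ix ((i + 1) mod 5) = s2 (part_ix i)" "part_ix ((i + 2) mod 5) = s4 (part_ix i)"
  using assms by (cases rule: less5_cases[OF assms]; simp add: part_ix_def)+

lemma part_ix_inj: "inj_on part_ix {..<5}"
  by (auto simp: inj_on_def part_ix_def elim!: less5_cases)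

lemma part_ix_surj: "\<exists>i<5. part_ix i = k"
proof -
  have "part_ix 0 = I0" "part_ix 3 = I1" "part_ix 1 = I2" "part_ix 4 = I3" "part_ix 2 = I4"
    by (simp_all add: part_ix_def)
  moreover have "0 < (5::nat)" "1 < (5::nat)" "2 < (5::nat)" "3 < (5::nat)" "4 < (5::nat)" by simp_all
  ultimately show ?thesis by (cases k) blast+
qed

lemma C5_blowup_parts_compl:
  assumes "compl_adj V E = blowup V \<kappa>"
  shows "C5_blowup_parts (\<lambda>i. {x \<in> V. \<kappa> x = part_ix i}) V E"
  unfolding C5_blowup_parts_def
proof (intro conjI allI impI ballI)
  have adj: "x \<in> V \<and> y \<in> V \<and> x \<noteq> y \<and> {x, y} \<notin> E \<longleftrightarrow>
      x \<in> V \<and> y \<in> V \<and> (\<kappa> y = s1 (\<kappa> x) \<or> \<kappa> y = s4 (\<kappa> x))" for x y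
    using assms unfolding fun_eq_iff compl_adj_def blowup_def by blast
  show "(\<Union>i<5. {x \<in> V. \<kappa> x = part_ix i}) = V"
  proof -
    have "\<exists>i<5. \<kappa> x = part_ix i" for x using part_ix_surj[of "\<kappa> x"] by metis
    then show ?thesis by blast
  qed
  show "disjoint_family_on (\<lambda>i. {x \<in> V. \<kappa> x = part_ix i}) {..<5}"
    using part_ix_inj by (auto simp: disjoint_family_on_def inj_on_def)
  fix i :: nat assume i: "i < 5"
  show "clique ({x \<in> V. \<kappa> x = part_ix i} \<union> {x \<in> V. \<kappa> x = part_ix ((i + 1) mod 5)}) E"
    unfolding clique_def part_ix_next(1)[OF i]
  proof (intro ballI impI)
    fix u w assume u: "u \<in> {x \<in> V. \<kappa> x = part_ix i} \<union> {x \<in> V. \<kappa> x = s2 (part_ix i)}"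
      and w: "w \<in> {x \<in> V. \<kappa> x = part_ix i} \<union> {x \<in> V. \<kappa> x = s2 (part_ix i)}" and "u \<noteq> w"
    then have "\<not> (\<kappa> w = s1 (\<kappa> u) \<or> \<kappa> w = s4 (\<kappa> u))" by auto
    then show "{u, w} \<in> E" using adj[of u w] u w \<open>u \<noteq> w\<close> by blast
  qed
  fix u w assume "u \<in> {x \<in> V. \<kappa> x = part_ix i}" "w \<in> {x \<in> V. \<kappa> x = part_ix ((i + 2) mod 5)}"
  then show "{u, w} \<notin> E" using adj[of u w] unfolding part_ix_next(2)[OF i] by auto
qed

lemma opt_parts_dev:
  assumes "opt_parts V \<kappa>"
  shows "\<bar>real (card {x \<in> V. \<kappa> x = k}) - real (card V) / 5\<bar> \<le> 2"
proof -
  have "\<bar>5 * int (card {x \<in> V. \<kappa> x = k}) - int (card V)\<bar> \<le> 10"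
  proof -
    have "int (card {x \<in> V. \<kappa> x = k}) = quot5 (card V) + opt (rem5 (card V)) k"
      using assms by (simp add: opt_parts_def)
    then have "5 * int (card {x \<in> V. \<kappa> x = k}) - int (card V) =
        5 * opt (rem5 (card V)) k - rem5 (card V)"
      by (simp add: rem5_def)
    then show ?thesis
      using rem5_bound[of "card V"] opt_bound[of "rem5 (card V)" k] by linarith
  qed
  then have "real_of_int \<bar>5 * int (card {x \<in> V. \<kappa> x = k}) - int (card V)\<bar> \<le> real_of_int 10"
    by (simp only: of_int_le_iff)
  then show ?thesis by (simp add: abs_le_iff)
qed

lemma opt_parts_graph_iso:
  assumes E: "compl_adj V E = blowup V \<kappa>" "opt_parts V \<kappa>" "fin_graph V E"
    and E': "compl_adj V' E' = blowup V' \<kappa>'" "opt_parts V' \<kappa>'" "fin_graph V' E'"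
    and c: "card V = card V'"
  shows "graph_iso V E V' E'"
proof -
  have fin: "finite V" "finite V'" using E E' by (auto simp: fin_graph_def)
  have loop: "{u} \<notin> E" for u
    using E(3) by (auto simp: fin_graph_def nsets_def)
  have loop': "{u} \<notin> E'" for u
    using E'(3) by (auto simp: fin_graph_def nsets_def)
  obtain \<phi> where \<phi>: "bij_betw \<phi> V V'" "\<And>x. x \<in> V \<Longrightarrow> \<kappa>' (\<phi> x) = \<kappa> x"
    by (rule opt_parts_bij[OF fin(1) E(2) fin(2) E'(2) c]) blast
  have "{u, w} \<in> E \<longleftrightarrow> {\<phi> u, \<phi> w} \<in> E'" if uw: "u \<in> V" "w \<in> V" for u w
  proof (cases "u = w")
    case False
    have V': "\<phi> u \<in> V'" "\<phi> w \<in> V'" using \<phi>(1) uw by (auto dest: bij_betwE)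
    have ne: "\<phi> u \<noteq> \<phi> w" using \<phi>(1) uw False by (auto simp: bij_betw_def inj_on_def)
    have "{u, w} \<notin> E \<longleftrightarrow> compl_adj V E u w" using uw False by (simp add: compl_adj_def)
    also have "\<dots> \<longleftrightarrow> compl_adj V' E' (\<phi> u) (\<phi> w)"
      unfolding E(1) E'(1) blowup_def using uw V' \<phi>(2) by simp
    also have "\<dots> \<longleftrightarrow> {\<phi> u, \<phi> w} \<notin> E'" using V' ne by (simp add: compl_adj_def)
    finally show ?thesis by blast
  qed (simp add: loop loop')
  then show ?thesis unfolding graph_iso_def using \<phi>(1) by blast
qed

lemma min_cliques_asymp:
  "(\<lambda>n. real (min_cliques n 4 3) - 3 / 25 * real (n choose 4)) \<in> O(\<lambda>n. real n ^ 3)"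
\<comment> \<open>After division by 24 the dominant error 1500 n^3 is 62.5 n^3, so 100 leaves room
  for the lower terms.\<close>
proof (rule bigoI[where c = 100])
  show "\<forall>\<^sub>F n in sequentially. norm (real (min_cliques n 4 3) - 3 / 25 * real (n choose 4)) \<le> 100 * norm (real n ^ 3)"
    using eventually_ge_at_top[of 10]
  proof eventually_elim
    case (elim n)
    define N where "N = real n"
    have "N ^ 4 - fall4 N = N * (6 * (N - 1)\<^sup>2 + N)" unfolding fall4_def by algebra
    also have "\<dots> \<ge> 0" by (simp add: N_def)
    finally have up: "fall4 N \<le> N ^ 4" by simp
    have "fall4 N - (N ^ 4 - 6 * N ^ 3) = N * (11 * N - 6)" unfolding fall4_def by algebra
    also have "\<dots> \<ge> 0" using elim by (simp add: N_def)
    finally have lo: "N ^ 4 - 6 * N ^ 3 \<le> fall4 N" by simp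
    have "24 * real (n choose 4) = fall4 N" by (simp add: choose4_fall4 N_def)
    moreover have "24 * real (min_cliques n 4 3) \<le> 3 / 25 * N ^ 4 + 1500 * N ^ 3"
      using min_cliques_upper[OF elim] opt_count_upper[OF elim] by (simp add: N_def)
    moreover have "24 * real (min_cliques n 4 3) \<ge> 3 / 25 * N ^ 4 - 6 * N ^ 3"
      using min_cliques_lower[of n] by (simp add: N_def)
    moreover have "N ^ 3 \<ge> 0" by (simp add: N_def)
    ultimately have "\<bar>real (min_cliques n 4 3) - 3 / 25 * real (n choose 4)\<bar> \<le> 100 * N ^ 3"
      using up lo unfolding abs_le_iff by (intro conjI; linarith)
    then show ?case by (simp add: N_def)
  qed
qed

lemma extremal_graph_exists:
  assumes "n \<ge> N0"
  obtains V :: "nat set" and E \<kappa> where "fin_graph V E" "card V = n" "indep_number V E < 3"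
    "num_cliques 4 V E = min_cliques n 4 3" "compl_adj V E = blowup V \<kappa>" "opt_parts V \<kappa>"
proof -
  obtain V :: "nat set" and E where E: "fin_graph V E" "card V = n" "indep_number V E < 3"
    "num_cliques 4 V E = min_cliques n 4 3" by (rule min_cliques_attained)
  obtain \<kappa> where "compl_adj V E = blowup V \<kappa>" "opt_parts V \<kappa>"
    by (rule extremal_opt_parts[OF E(1,3)]) (use E assms in auto)
  then show ?thesis using that E by blast
qed

theorem theorem1p1:
  shows "(\<lambda>n. real (min_cliques n 4 3) - 3 / 25 * real (n choose 4)) \<in> O(\<lambda>n. real n ^ 3)
    \<and> (\<exists>(V :: nat \<Rightarrow> nat set) E P.
         (\<exists>n0. \<forall>n\<ge>n0. fin_graph (V n) (E n) \<and> card (V n) = n \<and> indep_number (V n) (E n) < 3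
            \<and> num_cliques 4 (V n) (E n) = min_cliques n 4 3
            \<and> C5_blowup_parts (P n) (V n) (E n))
         \<and> (\<forall>i<5. (\<lambda>n. real (card (P n i)) - real n / 5) \<in> o(\<lambda>n. real n)))
    \<and> (\<exists>n0. \<forall>n\<ge>n0. \<exists>(V :: nat set) E.
         fin_graph V E \<and> card V = n \<and> indep_number V E \<le> 2
         \<and> num_cliques 4 V E = min_cliques n 4 3 \<and> C5_blowup V E
         \<and> (\<forall>(V' :: nat set) E'. fin_graph V' E' \<and> card V' = n \<and> indep_number V' E' \<le> 2
               \<and> num_cliques 4 V' E' = min_cliques n 4 3 \<longrightarrow> graph_iso V E V' E'))"
proof (intro conjI)
  show "(\<lambda>n. real (min_cliques n 4 3) - 3 / 25 * real (n choose 4)) \<in> O(\<lambda>n. real n ^ 3)"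
    by (rule min_cliques_asymp)
next
  \<comment> \<open>Placing the implication under the existential quantifiers lets choice produce
    sequences defined for all n, arbitrary below \<open>N0\<close>.\<close>
  have "\<forall>n. \<exists>V E P. n \<ge> N0 \<longrightarrow> fin_graph (V :: nat set) E \<and> card V = n \<and> indep_number V E < 3
      \<and> num_cliques 4 V E = min_cliques n 4 3 \<and> C5_blowup_parts P V E
      \<and> (\<forall>i. \<bar>real (card (P i)) - real n / 5\<bar> \<le> 2)"
  proof
    fix n
    show "\<exists>V E P. n \<ge> N0 \<longrightarrow> fin_graph (V :: nat set) E \<and> card V = n \<and> indep_number V E < 3
      \<and> num_cliques 4 V E = min_cliques n 4 3 \<and> C5_blowup_parts P V E
      \<and> (\<forall>i. \<bar>real (card (P i)) - real n / 5\<bar> \<le> 2)"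
    proof (cases "n \<ge> N0")
      case True
      then obtain V :: "nat set" and E \<kappa> where E: "fin_graph V E" "card V = n" "indep_number V E < 3"
        "num_cliques 4 V E = min_cliques n 4 3" "compl_adj V E = blowup V \<kappa>" "opt_parts V \<kappa>"
        by (rule extremal_graph_exists)
      with C5_blowup_parts_compl[OF E(5)] opt_parts_dev[OF E(6)] show ?thesis by blast
    qed blast
  qed
  then obtain V :: "nat \<Rightarrow> nat set" and E P where VEP: "\<And>n. n \<ge> N0 \<Longrightarrow>
      fin_graph (V n) (E n) \<and> card (V n) = n \<and> indep_number (V n) (E n) < 3
      \<and> num_cliques 4 (V n) (E n) = min_cliques n 4 3 \<and> C5_blowup_parts (P n) (V n) (E n)
      \<and> (\<forall>i. \<bar>real (card (P n i)) - real n / 5\<bar> \<le> 2)"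
    by metis
  have "(\<lambda>n. real (card (P n i)) - real n / 5) \<in> o(\<lambda>n. real n)" for i
  proof -
    have "(\<lambda>n. real (card (P n i)) - real n / 5) \<in> O(\<lambda>_. 1)"
      using VEP by (intro bigoI[where c = 2] eventually_sequentiallyI[of N0]) auto
    also have "(\<lambda>_. 1) \<in> o(\<lambda>n. real n)"
    proof (rule smalloI_tendsto)
      show "((\<lambda>n. 1 / real n) \<longlongrightarrow> 0) sequentially" by (rule lim_1_over_n)
      show "\<forall>\<^sub>F n in sequentially. real n \<noteq> 0"
        using eventually_gt_at_top[of 0] by eventually_elim simp
    qed
    finally show ?thesis .
  qed
  with VEP show "\<exists>(V :: nat \<Rightarrow> nat set) E P.
         (\<exists>n0. \<forall>n\<ge>n0. fin_graph (V n) (E n) \<and> card (V n) = n \<and> indep_number (V n) (E n) < 3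
            \<and> num_cliques 4 (V n) (E n) = min_cliques n 4 3
            \<and> C5_blowup_parts (P n) (V n) (E n))
         \<and> (\<forall>i<5. (\<lambda>n. real (card (P n i)) - real n / 5) \<in> o(\<lambda>n. real n))"
    by blast
next
  have "\<exists>(V :: nat set) E.
         fin_graph V E \<and> card V = n \<and> indep_number V E \<le> 2
         \<and> num_cliques 4 V E = min_cliques n 4 3 \<and> C5_blowup V E
         \<and> (\<forall>(V' :: nat set) E'. fin_graph V' E' \<and> card V' = n \<and> indep_number V' E' \<le> 2
               \<and> num_cliques 4 V' E' = min_cliques n 4 3 \<longrightarrow> graph_iso V E V' E')" if n: "n \<ge> N0" for n
  proof -
    obtain V :: "nat set" and E \<kappa> where E: "fin_graph V E" "card V = n" "indep_number V E < 3"
        "num_cliques 4 V E = min_cliques n 4 3" "compl_adj V E = blowup V \<kappa>" "opt_parts V \<kappa>"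
      by (rule extremal_graph_exists[OF n])
    have "graph_iso V E V' E'" if E': "fin_graph V' E'" "card V' = n" "indep_number V' E' \<le> 2"
      "num_cliques 4 V' E' = min_cliques n 4 3" for V' :: "nat set" and E'
    proof -
      obtain \<kappa>' where "compl_adj V' E' = blowup V' \<kappa>'" "opt_parts V' \<kappa>'"
        by (rule extremal_opt_parts[OF E'(1)]) (use E' n in auto)
      with E E' show ?thesis by (intro opt_parts_graph_iso) auto
    qed
    moreover have "C5_blowup V E" unfolding C5_blowup_def using C5_blowup_parts_compl[OF E(5)] by blast
    ultimately show ?thesis using E by (intro exI[of _ V] exI[of _ E]) auto
  qed
  then show "\<exists>n0. \<forall>n\<ge>n0. \<exists>(V :: nat set) E.
         fin_graph V E \<and> card V = n \<and> indep_number V E \<le> 2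
         \<and> num_cliques 4 V E = min_cliques n 4 3 \<and> C5_blowup V E
         \<and> (\<forall>(V' :: nat set) E'. fin_graph V' E' \<and> card V' = n \<and> indep_number V' E' \<le> 2
               \<and> num_cliques 4 V' E' = min_cliques n 4 3 \<longrightarrow> graph_iso V E V' E')"
    by blast
qed

end
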